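(* Let $(\mathcal{M},\tau)$ be a noncommutative probability space, let $d,n\in\mathbb{N}$, and equip $\mathbb{M}_d(\mathcal{M})$ with the normalized trace $\overline{\tau}$. Let $\mathcal{U}_j$ ($1\le j\le n$) be either freely independent or tensor independent von Neumann subalgebras of $\left(\mathbb{M}_d(\mathcal{M}),\overline{\tau}\right)$, and let $U_j\in L_1(\mathcal{U}_j)$ ($1\le j\le n$) be self-adjoint matrices. Let $F: L_1(\mathbb{M}_d(\mathcal{M}))_{sa}\times\cdots\times L_1(\mathbb{M}_d(\mathcal{M}))_{sa}\to L_1(\mathbb{M}_d(\mathcal{M}))_{sa}$ be an arbitrary function of $n$ variables. Let $U_1',\ldots,U_n'\in L_1(\mathbb{M}_d(\mathcal{M}))_{sa}$, and let $$V=F(U_1,\ldots,U_n),\qquad V^{(j)}=F(U_1,\ldots,U_{j-1},U_j',U_{j+1},\ldots,U_n)\quad(1\le j\le n)$$ be such that $$\overline{\tau}\left(VV^{(j)}\right)\le\|\mathcal{E}_j(V)\|_2^2\qquad\text{and}\qquad\overline{\tau}\left((V^{(j)})^2\right)\ge\overline{\tau}\left(V^2\right)$$ for all $j=1,2,\ldots,n$, where $\mathcal{E}_j$ denotes the conditional expectation of $\mathbb{M}_d(\mathcal{M})$ with respect to $\mathcal{U}_j$. Then $$\tau\left(\mathrm{tr}\left(\left(V-\tau(V)\right)^2\right)\right)\le\frac12\,\tau\left(\mathrm{tr}\left(\sum_{j=1}^n\left(V-V^{(j)}\right)^2\right)\right).$$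
   Context: A noncommutative probability space $(\mathcal{M},\tau)$ is a von Neumann algebra $\mathcal{M}$ with a normal faithful finite trace $\tau$, $\tau(1)=1$. For $1\le p<\infty$, $L_p(\mathcal{M})$ is the completion of $\mathcal{M}$ in the norm $\|x\|_p=\tau(|x|^p)^{1/p}$; the subscript $sa$ denotes self-adjoint elements. $\mathbb{M}_d(\mathcal{M})\cong\mathbb{M}_d(\mathbb{C})\otimes\mathcal{M}$ is the von Neumann algebra of $d\times d$ matrices with entries in $\mathcal{M}$. For $X=(X_{ij})$, $\mathrm{tr}(X)=\sum_{i=1}^dX_{ii}$, $\overline{\mathrm{tr}}=\frac1d\mathrm{tr}$, and $\overline\tau(X)=\tau(\overline{\mathrm{tr}}(X))=\frac1d\sum_{i=1}^d\tau(X_{ii})$, which is a normalized normal faithful finite trace; thus $(\mathbb{M}_d(\mathcal{M}),\overline\tau)$ is a noncommutative probability space, and $L_p(\mathbb{M}_d(\mathcal{M}))$ and $\|\cdot\|_2$ on it are taken with respect to $\overline\tau$. For a matrix $X=(X_{ij})$, $\tau(X)$ denotes the matrix $(\tau(X_{ij}))_{d\times d}\in\mathbb{M}_d(\mathbb{C})\subset\mathbb{M}_d(\mathcal{M})$. For a von Neumann subalgebra $\mathcal{N}$ of a noncommutative probability space $(\mathcal{A},\phi)$, the conditional expectation with respect to $\mathcal{N}$ is the unique normal positive contractive projection $\mathcal{E}_{\mathcal{N}}$ from $\mathcal{A}$ onto $\mathcal{N}$ with $\mathcal{E}_{\mathcal{N}}(axb)=a\mathcal{E}_{\mathcal{N}}(x)b$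 for $a,b\in\mathcal{N}$, $x\in\mathcal{A}$, and $\phi\circ\mathcal{E}_{\mathcal{N}}=\phi$; it extends to a contractive positive projection from $L_p(\mathcal{A})$ onto $L_p(\mathcal{N})$, denoted by the same symbol. Von Neumann subalgebras $\mathcal{N}_1,\ldots,\mathcal{N}_n$ of $(\mathcal{A},\phi)$ are tensor independent if $\phi\left(\prod_{i=1}^m\left(\prod_{k=1}^n a_{ki}\right)\right)=\prod_{k=1}^n\phi\left(\prod_{i=1}^m a_{ki}\right)$ for all $m\in\mathbb{N}$ and $a_{ki}\in\mathcal{N}_k$ (ordered products, with increasing indices); they are freely independent if $\phi(a_1a_2\cdots a_m)=0$ whenever $a_k\in\mathcal{N}_{i_k}$, $\phi(a_k)=0$ for all $k\in\{1,\ldots,m\}$, and $i_1\ne i_2\ne\cdots\ne i_m$ (consecutive indices distinct).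
   Formalization: The number n of subalgebras is assumed to be at least 2; for n=1 the claim fails (take U_1 the whole matrix algebra and F constant equal to a bounded self-adjoint c with c ≠ τ(c)), and similarly for n=0. *)

theory Defs
  imports "HOL-Analysis.Analysis"
begin

section \<open>Complex Hilbert spaces and bounded operators\<close>

(* The inner product is conjugate-linear in its first argument. Its real part is the real
   inner product of the library, so that norm and completeness are the library's. *)
class complex_hilbert = real_inner + complete_space +
  fixes scaleC :: "complex \<Rightarrow> 'a \<Rightarrow> 'a" (infixr "*\<^sub>C" 75)
    and cinner :: "'a \<Rightarrow> 'a \<Rightarrow> complex"
  assumes scaleC_add_right: "c *\<^sub>C (x + y) = c *\<^sub>C x + c *\<^sub>C y"
    and scaleC_add_left: "(b + c) *\<^sub>C x = b *\<^sub>C x + c *\<^sub>C x"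
    and scaleC_scaleC: "b *\<^sub>C (c *\<^sub>C x) = (b * c) *\<^sub>C x"
    and scaleC_of_real: "complex_of_real r *\<^sub>C x = r *\<^sub>R x"
    and cinner_commute: "cinner x y = cnj (cinner y x)"
    and cinner_add_right: "cinner x (y + z) = cinner x y + cinner x z"
    and cinner_scaleC_right: "cinner x (c *\<^sub>C y) = c * cinner x y"
    and Re_cinner: "Re (cinner x y) = x \<bullet> y"

instantiation vec :: (complex_hilbert, finite) complex_hilbert
begin

definition scaleC_vec :: "complex \<Rightarrow> 'a ^ 'b \<Rightarrow> 'a ^ 'b" where
  "scaleC_vec c v = (\<chi> i. c *\<^sub>C (v $ i))"

definition cinner_vec :: "'a ^ 'b \<Rightarrow> 'a ^ 'b \<Rightarrow> complex" where
  "cinner_vec v w = (\<Sum>i\<in>UNIV. cinner (v $ i) (w $ i))"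

instance
proof
  fix b c :: complex and r :: real and x y z :: "'a ^ 'b"
  show "c *\<^sub>C (x + y) = c *\<^sub>C x + c *\<^sub>C y"
    by (simp add: scaleC_vec_def vec_eq_iff scaleC_add_right)
  show "(b + c) *\<^sub>C x = b *\<^sub>C x + c *\<^sub>C x"
    by (simp add: scaleC_vec_def vec_eq_iff scaleC_add_left)
  show "b *\<^sub>C (c *\<^sub>C x) = (b * c) *\<^sub>C x"
    by (simp add: scaleC_vec_def vec_eq_iff scaleC_scaleC)
  show "complex_of_real r *\<^sub>C x = r *\<^sub>R x"
    by (simp add: scaleC_vec_def vec_eq_iff scaleC_of_real)
  have "cinner (x $ i) (y $ i) = cnj (cinner (y $ i) (x $ i))" for i
    by (rule cinner_commute)
  then show "cinner x y = cnj (cinner y x)"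
    unfolding cinner_vec_def cnj_sum by (rule sum.cong[OF refl])
  show "cinner x (y + z) = cinner x y + cinner x z"
    by (simp add: cinner_vec_def cinner_add_right sum.distrib)
  show "cinner x (c *\<^sub>C y) = c * cinner x y"
    by (simp add: cinner_vec_def scaleC_vec_def cinner_scaleC_right sum_distrib_left)
  show "Re (cinner x y) = x \<bullet> y"
    by (simp add: cinner_vec_def inner_vec_def Re_cinner)
qed

end

type_synonym 'h bop = "'h \<Rightarrow>\<^sub>L 'h"

(* The library's bounded operators are real-linear; B(H) is the set of complex-linear ones. *)
definition BH :: "'h::complex_hilbert bop set" where
  "BH = {a. \<forall>c x. blinfun_apply a (c *\<^sub>C x) = c *\<^sub>C blinfun_apply a x}"

definition op_scale :: "complex \<Rightarrow> 'h::complex_hilbert bop \<Rightarrow> 'h bop" where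
  "op_scale c a = Blinfun (\<lambda>x. c *\<^sub>C blinfun_apply a x)"

definition is_adjoint :: "'h::complex_hilbert bop \<Rightarrow> 'h bop \<Rightarrow> bool" where
  "is_adjoint a b \<longleftrightarrow> (\<forall>x y. cinner (blinfun_apply a x) y = cinner x (blinfun_apply b y))"

definition adj :: "'h::complex_hilbert bop \<Rightarrow> 'h bop" where
  "adj a = (THE b. is_adjoint a b)"

definition positive_op :: "'h::complex_hilbert bop \<Rightarrow> bool" where
  "positive_op a \<longleftrightarrow> a \<in> BH \<and>
     (\<forall>x. cinner x (blinfun_apply a x) \<in> \<real> \<and> 0 \<le> Re (cinner x (blinfun_apply a x)))"

definition op_le :: "'h::complex_hilbert bop \<Rightarrow> 'h bop \<Rightarrow> bool" where
  "op_le a b \<longleftrightarrow> positive_op (b - a)"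

definition op_prod :: "'h::complex_hilbert bop list \<Rightarrow> 'h bop" where
  "op_prod as = foldr (o\<^sub>L) as id_blinfun"

definition op_abs :: "'h::complex_hilbert bop \<Rightarrow> 'h bop" where
  "op_abs a = (THE b. positive_op b \<and> b o\<^sub>L b = adj a o\<^sub>L a)"


section \<open>Noncommutative probability spaces\<close>

definition commutant :: "'h::complex_hilbert bop set \<Rightarrow> 'h bop set" where
  "commutant S = {b \<in> BH. \<forall>a\<in>S. a o\<^sub>L b = b o\<^sub>L a}"

(* A *-closed set of operators that equals its bicommutant. *)
definition von_neumann_algebra :: "'h::complex_hilbert bop set \<Rightarrow> bool" where
  "von_neumann_algebra M \<longleftrightarrow> M \<subseteq> BH \<and> (\<forall>a\<in>M. \<exists>b\<in>M. is_adjoint a b) \<and>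
     commutant (commutant M) = M"

(* Both algebras act on the same space, so they have the same unit. *)
definition vn_subalgebra :: "'h::complex_hilbert bop set \<Rightarrow> 'h bop set \<Rightarrow> bool" where
  "vn_subalgebra A N \<longleftrightarrow> von_neumann_algebra N \<and> N \<subseteq> A"

definition op_lub :: "'h::complex_hilbert bop set \<Rightarrow> 'h bop set \<Rightarrow> 'h bop \<Rightarrow> bool" where
  "op_lub M D a \<longleftrightarrow> a \<in> M \<and> (\<forall>d\<in>D. op_le d a) \<and>
     (\<forall>b\<in>M. (\<forall>d\<in>D. op_le d b) \<longrightarrow> op_le a b)"

(* D is the range of an increasing net of positive elements of M with supremum a in M. *)
definition increasing_to :: "'h::complex_hilbert bop set \<Rightarrow> 'h bop set \<Rightarrow> 'h bop \<Rightarrow> bool" where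
  "increasing_to M D a \<longleftrightarrow> D \<noteq> {} \<and> D \<subseteq> {x \<in> M. positive_op x} \<and>
     (\<forall>x\<in>D. \<forall>y\<in>D. \<exists>z\<in>D. op_le x z \<and> op_le y z) \<and> op_lub M D a"

definition nc_prob_space :: "'h::complex_hilbert bop set \<Rightarrow> ('h bop \<Rightarrow> complex) \<Rightarrow> bool" where
  "nc_prob_space M \<tau> \<longleftrightarrow> von_neumann_algebra M \<and>
     (\<forall>a\<in>M. \<forall>b\<in>M. \<tau> (a + b) = \<tau> a + \<tau> b) \<and>
     (\<forall>c. \<forall>a\<in>M. \<tau> (op_scale c a) = c * \<tau> a) \<and>
     (\<forall>a\<in>M. positive_op a \<longrightarrow> \<tau> a \<in> \<real> \<and> 0 \<le> Re (\<tau> a)) \<and>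
     (\<forall>a\<in>M. \<forall>b\<in>M. \<tau> (a o\<^sub>L b) = \<tau> (b o\<^sub>L a)) \<and>
     (\<forall>a\<in>M. positive_op a \<longrightarrow> \<tau> a = 0 \<longrightarrow> a = 0) \<and>
     (\<forall>D a. increasing_to M D a \<longrightarrow> (SUP d\<in>D. Re (\<tau> d)) = Re (\<tau> a)) \<and>
     \<tau> id_blinfun = 1"

definition cond_expectation ::
  "'h::complex_hilbert bop set \<Rightarrow> ('h bop \<Rightarrow> complex) \<Rightarrow> 'h bop set \<Rightarrow> ('h bop \<Rightarrow> 'h bop) \<Rightarrow> bool"
  where
  "cond_expectation A \<phi> N E \<longleftrightarrow>
     (\<forall>x\<in>A. E x \<in> N) \<and> (\<forall>x\<in>N. E x = x) \<and>
     (\<forall>x\<in>A. \<forall>y\<in>A. E (x + y) = E x + E y) \<and>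
     (\<forall>c. \<forall>x\<in>A. E (op_scale c x) = op_scale c (E x)) \<and>
     (\<forall>x\<in>A. positive_op x \<longrightarrow> positive_op (E x)) \<and>
     (\<forall>x\<in>A. norm (E x) \<le> norm x) \<and>
     (\<forall>D a. increasing_to A D a \<longrightarrow> op_lub N (E ` D) (E a)) \<and>
     (\<forall>a\<in>N. \<forall>x\<in>A. \<forall>b\<in>N. E (a o\<^sub>L x o\<^sub>L b) = a o\<^sub>L E x o\<^sub>L b) \<and>
     (\<forall>x\<in>A. \<phi> (E x) = \<phi> x)"

definition tensor_independent ::
  "('h::complex_hilbert bop \<Rightarrow> complex) \<Rightarrow> nat \<Rightarrow> (nat \<Rightarrow> 'h bop set) \<Rightarrow> bool" where
  "tensor_independent \<phi> n N \<longleftrightarrow>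
     (\<forall>m. \<forall>a :: nat \<Rightarrow> nat \<Rightarrow> 'h bop. (\<forall>k\<in>{1..n}. \<forall>i\<in>{1..m}. a k i \<in> N k) \<longrightarrow>
        \<phi> (op_prod (map (\<lambda>i. op_prod (map (\<lambda>k. a k i) [1..<n+1])) [1..<m+1]))
        = (\<Prod>k=1..n. \<phi> (op_prod (map (\<lambda>i. a k i) [1..<m+1]))))"

definition freely_independent ::
  "('h::complex_hilbert bop \<Rightarrow> complex) \<Rightarrow> nat \<Rightarrow> (nat \<Rightarrow> 'h bop set) \<Rightarrow> bool" where
  "freely_independent \<phi> n N \<longleftrightarrow>
     (\<forall>m\<ge>1. \<forall>\<iota> :: nat \<Rightarrow> nat. \<forall>a :: nat \<Rightarrow> 'h bop.
        (\<forall>k\<in>{1..m}. \<iota> k \<in> {1..n} \<and> a k \<in> N (\<iota> k) \<and> \<phi> (a k) = 0) \<longrightarrow>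
        (\<forall>k\<in>{1..<m}. \<iota> k \<noteq> \<iota> (k + 1)) \<longrightarrow>
        \<phi> (op_prod (map a [1..<m+1])) = 0)"


section \<open>Noncommutative Lp spaces\<close>

(* Only integer exponents p >= 1 are covered, so that the p-th power of |x| is an iterated
   product. *)
definition pnorm :: "('h::complex_hilbert bop \<Rightarrow> complex) \<Rightarrow> nat \<Rightarrow> 'h bop \<Rightarrow> real" where
  "pnorm \<phi> p x = root p (Re (\<phi> (op_prod (replicate p (op_abs x)))))"

(* An element of the completion of A is an equivalence class of Cauchy sequences in A. *)
type_synonym 'h lp = "(nat \<Rightarrow> 'h bop) set"

definition Lp_cauchy ::
  "'h::complex_hilbert bop set \<Rightarrow> ('h bop \<Rightarrow> complex) \<Rightarrow> nat \<Rightarrow> (nat \<Rightarrow> 'h bop) set" where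
  "Lp_cauchy A \<phi> p = {xs. range xs \<subseteq> A \<and>
     (\<forall>e>0. \<exists>K. \<forall>m\<ge>K. \<forall>n\<ge>K. pnorm \<phi> p (xs m - xs n) < e)}"

definition Lp_rel ::
  "'h::complex_hilbert bop set \<Rightarrow> ('h bop \<Rightarrow> complex) \<Rightarrow> nat \<Rightarrow> (nat \<Rightarrow> 'h bop) rel" where
  "Lp_rel A \<phi> p = {(xs, ys). xs \<in> Lp_cauchy A \<phi> p \<and> ys \<in> Lp_cauchy A \<phi> p \<and>
     (\<lambda>n. pnorm \<phi> p (xs n - ys n)) \<longlonglongrightarrow> 0}"

definition Lp :: "'h::complex_hilbert bop set \<Rightarrow> ('h bop \<Rightarrow> complex) \<Rightarrow> nat \<Rightarrow> 'h lp set" where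
  "Lp A \<phi> p = Lp_cauchy A \<phi> p // Lp_rel A \<phi> p"

(* The image of Lp(N) in Lp(A), for N contained in A. *)
definition Lp_sub ::
  "'h::complex_hilbert bop set \<Rightarrow> ('h bop \<Rightarrow> complex) \<Rightarrow> nat \<Rightarrow> 'h bop set \<Rightarrow> 'h lp set" where
  "Lp_sub A \<phi> p N = {X \<in> Lp A \<phi> p. \<exists>Y\<in>Lp N \<phi> p. Y \<subseteq> X}"

(* The p-norm on L1(A), with values in [0,\<infinity>]. Since p >= 1 and \<phi> 1 = 1, a sequence that is
   Cauchy for the p-norm is Cauchy for the 1-norm, and this embeds Lp(A) in L1(A); elements of
   L1(A) outside Lp(A) get the value \<infinity>. *)
definition Lp_norm ::
  "'h::complex_hilbert bop set \<Rightarrow> ('h bop \<Rightarrow> complex) \<Rightarrow> nat \<Rightarrow> 'h lp \<Rightarrow> ereal" where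
  "Lp_norm A \<phi> p X =
     (if X \<inter> Lp_cauchy A \<phi> p = {} then \<infinity>
      else ereal (THE r. \<forall>xs \<in> X \<inter> Lp_cauchy A \<phi> p. (\<lambda>n. pnorm \<phi> p (xs n)) \<longlonglongrightarrow> r))"

definition L1_of ::
  "'h::complex_hilbert bop set \<Rightarrow> ('h bop \<Rightarrow> complex) \<Rightarrow> 'h bop \<Rightarrow> 'h lp" where
  "L1_of A \<phi> x = Lp_rel A \<phi> 1 `` {\<lambda>n. x}"

(* Extension by continuity of T to a map into L1(A) (the source may be another L1 space). *)
definition L1_map ::
  "'h::complex_hilbert bop set \<Rightarrow> ('h bop \<Rightarrow> complex) \<Rightarrow>
   ('k::complex_hilbert bop \<Rightarrow> 'h bop) \<Rightarrow> 'k lp \<Rightarrow> 'h lp" where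
  "L1_map A \<phi> T X = (\<Union>xs\<in>X. Lp_rel A \<phi> 1 `` {\<lambda>n. T (xs n)})"

definition L1_diff ::
  "'h::complex_hilbert bop set \<Rightarrow> ('h bop \<Rightarrow> complex) \<Rightarrow> 'h lp \<Rightarrow> 'h lp \<Rightarrow> 'h lp" where
  "L1_diff A \<phi> X Y = (\<Union>xs\<in>X. \<Union>ys\<in>Y. Lp_rel A \<phi> 1 `` {\<lambda>n. xs n - ys n})"

definition L1_sum ::
  "'h::complex_hilbert bop set \<Rightarrow> ('h bop \<Rightarrow> complex) \<Rightarrow> 'i set \<Rightarrow> ('i \<Rightarrow> 'h lp) \<Rightarrow> 'h lp" where
  "L1_sum A \<phi> I X = (\<Union>xs \<in> {xs. \<forall>i\<in>I. xs i \<in> X i}. Lp_rel A \<phi> 1 `` {\<lambda>n. \<Sum>i\<in>I. xs i n})"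

definition L1_sa :: "'h::complex_hilbert bop set \<Rightarrow> ('h bop \<Rightarrow> complex) \<Rightarrow> 'h lp set" where
  "L1_sa A \<phi> = {X \<in> Lp A \<phi> 1. L1_map A \<phi> adj X = X}"

definition L1_trace :: "('h::complex_hilbert bop \<Rightarrow> complex) \<Rightarrow> 'h lp \<Rightarrow> complex" where
  "L1_trace \<phi> X = (THE t. \<forall>xs\<in>X. (\<lambda>n. \<phi> (xs n)) \<longlonglongrightarrow> t)"

(* L1_prod A \<phi> X Y Z says that the product XY, formed in the algebra of measurable operators,
   belongs to L1(A) and equals Z. If x_n -> X, y_n -> Y and x_n y_n -> Z in L1, then the
   convergences hold in measure and so Z = XY. Conversely, if XY lies in L1, put
   p_n = 1_[0,n](|X*|) and q_n = 1_[0,n](|Y|); then p_n X and Y q_n are bounded, and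
   p_n X -> X, Y q_n -> Y and p_n X Y q_n -> XY in L1. In particular, for self-adjoint X the
   product XX is in L1(A) iff X is in L2(A). *)
definition L1_prod ::
  "'h::complex_hilbert bop set \<Rightarrow> ('h bop \<Rightarrow> complex) \<Rightarrow> 'h lp \<Rightarrow> 'h lp \<Rightarrow> 'h lp \<Rightarrow> bool" where
  "L1_prod A \<phi> X Y Z \<longleftrightarrow> Z \<in> Lp A \<phi> 1 \<and> (\<exists>xs\<in>X. \<exists>ys\<in>Y. (\<lambda>n. xs n o\<^sub>L ys n) \<in> Z)"

definition prod_in_L1 ::
  "'h::complex_hilbert bop set \<Rightarrow> ('h bop \<Rightarrow> complex) \<Rightarrow> 'h lp \<Rightarrow> 'h lp \<Rightarrow> bool" where
  "prod_in_L1 A \<phi> X Y \<longleftrightarrow> (\<exists>Z. L1_prod A \<phi> X Y Z)"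

definition L1_mult ::
  "'h::complex_hilbert bop set \<Rightarrow> ('h bop \<Rightarrow> complex) \<Rightarrow> 'h lp \<Rightarrow> 'h lp \<Rightarrow> 'h lp" where
  "L1_mult A \<phi> X Y = (THE Z. L1_prod A \<phi> X Y Z)"

(* Values in [0,\<infinity>] of a positive functional T (a trace) at X^2 and at the sum of the X_i^2,
   for self-adjoint X, X_i in L1(A). These are positive measurable operators, on which T takes the
   value \<infinity> when they are not in L1(A); a finite sum of positive operators is in L1(A) iff each
   summand is. *)
definition square_trace ::
  "'h::complex_hilbert bop set \<Rightarrow> ('h bop \<Rightarrow> complex) \<Rightarrow> ('h lp \<Rightarrow> complex) \<Rightarrow> 'h lp \<Rightarrow> ereal"
  where
  "square_trace A \<phi> T X =
     (if prod_in_L1 A \<phi> X X then ereal (Re (T (L1_mult A \<phi> X X))) else \<infinity>)"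

definition sum_squares_trace ::
  "'h::complex_hilbert bop set \<Rightarrow> ('h bop \<Rightarrow> complex) \<Rightarrow> ('h lp \<Rightarrow> complex) \<Rightarrow>
   'i set \<Rightarrow> ('i \<Rightarrow> 'h lp) \<Rightarrow> ereal" where
  "sum_squares_trace A \<phi> T I X =
     (if \<forall>i\<in>I. prod_in_L1 A \<phi> (X i) (X i)
      then ereal (Re (T (L1_sum A \<phi> I (\<lambda>i. L1_mult A \<phi> (X i) (X i))))) else \<infinity>)"


section \<open>Matrices over a von Neumann algebra\<close>

(* Matrices over operators on H, with rows and columns indexed by 'd, are the operators on the
   direct sum of CARD('d) copies of H. *)
definition entry :: "'d::finite \<Rightarrow> 'd \<Rightarrow> ('h::complex_hilbert ^ 'd) bop \<Rightarrow> 'h bop" where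
  "entry i j X = Blinfun (\<lambda>v. blinfun_apply X (axis j v) $ i)"

definition matrices :: "'h::complex_hilbert bop set \<Rightarrow> ('h ^ 'd::finite) bop set" where
  "matrices M = {X \<in> BH. \<forall>i j. entry i j X \<in> M}"

definition scalar_matrix :: "complex ^ 'd ^ 'd \<Rightarrow> ('h::complex_hilbert ^ 'd::finite) bop" where
  "scalar_matrix C = Blinfun (\<lambda>v. \<chi> i. \<Sum>j\<in>UNIV. (C $ i $ j) *\<^sub>C (v $ j))"

definition mat_tr :: "('h::complex_hilbert ^ 'd::finite) bop \<Rightarrow> 'h bop" where
  "mat_tr X = (\<Sum>i\<in>UNIV. entry i i X)"

definition tau_bar ::
  "('h::complex_hilbert bop \<Rightarrow> complex) \<Rightarrow> ('h ^ 'd::finite) bop \<Rightarrow> complex" where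
  "tau_bar \<tau> X = \<tau> ((1 / real CARD('d)) *\<^sub>R mat_tr X)"

(* The entries of an element of L1(matrices M) lie in L1(M). *)
definition L1_entry ::
  "'h::complex_hilbert bop set \<Rightarrow> ('h bop \<Rightarrow> complex) \<Rightarrow> 'd::finite \<Rightarrow> 'd \<Rightarrow>
   ('h ^ 'd) lp \<Rightarrow> 'h lp" where
  "L1_entry M \<tau> i j X = L1_map M \<tau> (entry i j) X"

definition L1_tr ::
  "'h::complex_hilbert bop set \<Rightarrow> ('h bop \<Rightarrow> complex) \<Rightarrow> ('h ^ 'd::finite) lp \<Rightarrow> 'h lp" where
  "L1_tr M \<tau> X = L1_sum M \<tau> UNIV (\<lambda>i. L1_entry M \<tau> i i X)"

definition tau_matrix ::
  "'h::complex_hilbert bop set \<Rightarrow> ('h bop \<Rightarrow> complex) \<Rightarrow> ('h ^ 'd::finite) lp \<Rightarrow> ('h ^ 'd) lp" where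
  "tau_matrix M \<tau> X = L1_of (matrices M) (tau_bar \<tau>)
     (scalar_matrix (\<chi> i j. L1_trace \<tau> (L1_entry M \<tau> i j X)))"

end

theory Submission
  imports Defs
begin

text \<open>In the square-integrable case let \<open>e\<^sub>j = E\<^sub>j V - \<phi>(V)\<close>. Independence makes the \<open>e\<^sub>j\<close>
  orthogonal, so Bessel's inequality gives \<open>\<Sum>\<^sub>j \<parallel>e\<^sub>j\<parallel>\<^sup>2 \<le> \<parallel>V - \<phi>(V)\<parallel>\<^sup>2\<close>, and for \<open>n \<ge> 2\<close>
  \<open>\<parallel>V - \<tau>(V)\<parallel>\<^sup>2 \<le> \<parallel>V - \<phi>(V)\<parallel>\<^sup>2 \<le> \<Sum>\<^sub>j (\<parallel>V\<parallel>\<^sup>2 - \<parallel>E\<^sub>j V\<parallel>\<^sup>2)\<close>; the hypotheses bound each summand by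
  half of \<open>\<parallel>V - V\<^sub>j\<parallel>\<^sup>2\<close>. If the right-hand side is finite, then \<open>V - V\<^sub>j\<close> is in \<open>L\<^sub>2\<close> and \<open>V V\<^sub>j\<close> is
  in \<open>L\<^sub>1\<close>, which forces \<open>V\<close> into \<open>L\<^sub>2\<close> because \<open>V\<^sup>2 = V V\<^sub>j + V (V - V\<^sub>j)\<close>.

  Products of elements of \<open>L\<^sub>1\<close> are controlled with the resolvents \<open>(1 + r\<^sup>2 y\<^sup>* y)\<^sup>-\<^sup>1\<close> in place of
  spectral projections: they are bounded, tame \<open>y\<close>, and tend to \<open>1\<close> in \<open>L\<^sub>1\<close> as \<open>r\<close> tends to \<open>0\<close>.\<close>

section \<open>Operators on complex Hilbert spaces\<close>

\<comment> \<open>The bound for a single summand is the expansion |V - V_j|^2 = |V|^2 + |V_j|^2 - 2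
  phi(V V_j) >= 2 |V|^2 - 2 |E_j V|^2 in the 2-norm. It can be written down only once V is known to
  be square-integrable, hence the detour through products in L1. The obstacle there is that an
  element of L1 is a class of 1-Cauchy sequences of bounded operators, and \<open>L1_prod\<close>
  merely asks for some representatives whose products converge. The limit has to be shown
  independent of the representatives although neither factor is norm-bounded along its sequence. All
  estimates are therefore made on the approximating bounded operators, with constants uniform along
  the sequence. They rest on duality: the 1-norm of x is the supremum of |phi(u x)| over
  contractions u. It follows from an approximate polar decomposition whose partial isometry is
  replaced by an element of the norm-closed algebra.\<close>
subclass (in complex_hilbert) banach ..

\<comment> \<open>The library's composition symbol binds weaker than addition.\<close>
abbreviation op_times :: "'h::complex_hilbert bop \<Rightarrow> 'h bop \<Rightarrow> 'h bop" (infixl "\<cdot>" 70)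
  where "a \<cdot> b \<equiv> a o\<^sub>L b"

section \<open>The complex inner product in terms of the real one\<close>

lemma cinner_add_left: "cinner (x + y) z = cinner x z + cinner y z"
  for x y z :: "'h::complex_hilbert"
  by (metis cinner_commute cinner_add_right complex_cnj_add)

lemma cinner_scaleC_left: "cinner (c *\<^sub>C x) z = cnj c * cinner x z"
  for x z :: "'h::complex_hilbert"
  by (metis cinner_commute cinner_scaleC_right complex_cnj_mult)

lemma Im_cinner: "Im (cinner x y) = - (x \<bullet> (\<i> *\<^sub>C y))"
  for x y :: "'h::complex_hilbert"
  by (simp add: cinner_scaleC_right flip: Re_cinner)

text \<open>The imaginary part of the inner product of x and y is minus the real inner product of x
  and i y. Complex identities thus reduce to two real ones.\<close>

lemma cinner_eqI: "x \<bullet> y = x' \<bullet> y' \<Longrightarrow> x \<bullet> (\<i> *\<^sub>C y) = x' \<bullet> (\<i> *\<^sub>C y') \<Longrightarrow> cinner x y = cinner x' y'"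
  for x y :: "'h::complex_hilbert" and x' y' :: "'k::complex_hilbert"
  by (simp add: complex_eq_iff Re_cinner Im_cinner)

lemma cinner_ext: "(\<And>z. cinner z x = cinner z y) \<Longrightarrow> x = y"
  for x y :: "'h::complex_hilbert"
  by (metis Re_cinner inner_diff_right inner_eq_zero_iff right_minus_eq)

lemma norm_scaleC: "norm (c *\<^sub>C x) = cmod c * norm x"
  for x :: "'h::complex_hilbert"
proof -
  have "(norm (c *\<^sub>C x))\<^sup>2 = Re (cnj c * (c * cinner x x))"
    by (simp only: power2_norm_eq_inner cinner_scaleC_right cinner_scaleC_left mult_ac flip: Re_cinner)
  also have "cnj c * (c * cinner x x) = complex_of_real ((cmod c)\<^sup>2) * cinner x x"
    by (simp only: mult.assoc[symmetric] complex_norm_square mult.commute[of "cnj c"] )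
  also have "Re (complex_of_real ((cmod c)\<^sup>2) * cinner x x) = (cmod c)\<^sup>2 * (norm x)\<^sup>2"
    by (simp only: Re_complex_of_real Im_complex_of_real times_complex.simps dot_square_norm Re_cinner)
  finally have "(norm (c *\<^sub>C x))\<^sup>2 = (cmod c * norm x)\<^sup>2"
    by (simp add: power_mult_distrib)
  then show ?thesis
    by (simp add: power2_eq_iff_nonneg)
qed

lemma bounded_linear_scaleC: "bounded_linear (\<lambda>x::'h::complex_hilbert. c *\<^sub>C x)"
proof (rule bounded_linear_intro[where K = "cmod c"])
  show "c *\<^sub>C (x + y) = c *\<^sub>C x + c *\<^sub>C y" for x y :: 'h
    by (rule scaleC_add_right)
  show "c *\<^sub>C (r *\<^sub>R x) = r *\<^sub>R (c *\<^sub>C x)" for r and x :: 'h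
    by (metis mult.commute scaleC_of_real scaleC_scaleC)
qed (simp add: norm_scaleC)

section \<open>The algebra of bounded complex-linear operators and their adjoints\<close>

lemma op_scale_apply [simp]: "blinfun_apply (op_scale c a) x = c *\<^sub>C (a x)"
proof -
  have "bounded_linear (\<lambda>x. c *\<^sub>C a x)"
    using bounded_linear_compose[OF bounded_linear_scaleC blinfun.bounded_linear_right] .
  then show ?thesis
    by (simp add: op_scale_def bounded_linear_Blinfun_apply)
qed

lemma op_scale_of_real: "op_scale (complex_of_real r) a = r *\<^sub>R a"
  by (rule blinfun_eqI) (simp add: scaleC_of_real blinfun.scaleR_left)

lemma blinfun_compose_assoc: "(a o\<^sub>L b) o\<^sub>L c = a o\<^sub>L (b o\<^sub>L c)"
  by (rule blinfun_eqI) simp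

lemma blinfun_compose_id [simp]: "a o\<^sub>L id_blinfun = a" "id_blinfun o\<^sub>L a = a"
  by (rule blinfun_eqI, simp)+

lemmas op_simps = blinfun_compose_assoc
  bounded_bilinear.add_left[OF bounded_bilinear_blinfun_compose]
  bounded_bilinear.add_right[OF bounded_bilinear_blinfun_compose]
  bounded_bilinear.diff_left[OF bounded_bilinear_blinfun_compose]
  bounded_bilinear.diff_right[OF bounded_bilinear_blinfun_compose]
  bounded_bilinear.minus_left[OF bounded_bilinear_blinfun_compose]
  bounded_bilinear.minus_right[OF bounded_bilinear_blinfun_compose]
  bounded_bilinear.scaleR_left[OF bounded_bilinear_blinfun_compose]
  bounded_bilinear.scaleR_right[OF bounded_bilinear_blinfun_compose]

lemma norm_compose_le: "norm a \<le> r \<Longrightarrow> norm b \<le> s \<Longrightarrow> norm (a \<cdot> b) \<le> r * s"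
  by (rule order_trans[OF norm_blinfun_compose mult_mono]) (auto intro: order_trans[OF norm_ge_zero])

lemma norm_compose_le1: "norm a \<le> 1 \<Longrightarrow> norm b \<le> 1 \<Longrightarrow> norm (a \<cdot> b) \<le> 1"
  using norm_compose_le[of a 1 b 1] by simp

lemma op_scale_compose:
  assumes "a \<in> BH"
  shows "op_scale c a \<cdot> b = op_scale c (a \<cdot> b)" "a \<cdot> op_scale c b = op_scale c (a \<cdot> b)"
  using assms by (auto intro!: blinfun_eqI simp: BH_def)

lemma scaleC_zero [simp]: "c *\<^sub>C (0::'h::complex_hilbert) = 0"
  using norm_scaleC[of c "0::'h"] by simp

lemma scaleC_diff_right: "c *\<^sub>C (x - y) = c *\<^sub>C x - c *\<^sub>C y" for x y :: "'h::complex_hilbert"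
  by (metis add_diff_cancel_right' diff_add_cancel scaleC_add_right)

lemma BH_id [simp]: "id_blinfun \<in> BH"
  by (simp add: BH_def)

lemma BH_add: "a \<in> BH \<Longrightarrow> b \<in> BH \<Longrightarrow> a + b \<in> BH"
  by (simp add: BH_def blinfun.add_left scaleC_add_right)

lemma BH_diff: "a \<in> BH \<Longrightarrow> b \<in> BH \<Longrightarrow> a - b \<in> BH"
  by (simp add: BH_def blinfun.diff_left scaleC_diff_right)

lemma BH_scale: "a \<in> BH \<Longrightarrow> op_scale c a \<in> BH"
  by (simp add: BH_def scaleC_scaleC mult.commute)

lemma BH_scaleR: "a \<in> BH \<Longrightarrow> r *\<^sub>R a \<in> BH"
  using BH_scale[of a "complex_of_real r"] by (simp add: op_scale_of_real)

lemma BH_compose: "a \<in> BH \<Longrightarrow> b \<in> BH \<Longrightarrow> a \<cdot> b \<in> BH"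
  by (simp add: BH_def)

lemma closed_BH: "closed (BH :: 'h::complex_hilbert bop set)"
proof -
  have "closed {a :: 'h bop. a (c *\<^sub>C x) = c *\<^sub>C a x}" for c x
    by (intro closed_Collect_eq continuous_intros linear_continuous_on
        bounded_linear_compose[OF bounded_linear_scaleC bounded_linear_apply_blinfun])
  then have "closed (\<Inter>c x. {a :: 'h bop. a (c *\<^sub>C x) = c *\<^sub>C a x})"
    by (intro closed_INT ballI)
  moreover have "(\<Inter>c x. {a :: 'h bop. a (c *\<^sub>C x) = c *\<^sub>C a x}) = BH"
    by (auto simp: BH_def)
  ultimately show ?thesis by simp
qed

text \<open>The real relation suffices for complex-linear operators: evaluating it at i y gives the
  imaginary part.\<close>

lemma is_adjointI:
  assumes "a \<in> BH" "b \<in> BH" "\<And>x y. a x \<bullet> y = x \<bullet> b y"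
  shows "is_adjoint a b"
  unfolding is_adjoint_def
proof (intro allI cinner_eqI)
  fix x y
  show "a x \<bullet> (\<i> *\<^sub>C y) = x \<bullet> (\<i> *\<^sub>C b y)"
    using assms(2) assms(3)[of x "\<i> *\<^sub>C y"] by (simp add: BH_def)
qed (rule assms)

lemma is_adjointD: "is_adjoint a b \<Longrightarrow> a x \<bullet> y = x \<bullet> b y"
  by (metis is_adjoint_def Re_cinner)

lemma is_adjoint_sym: "is_adjoint a b \<Longrightarrow> is_adjoint b a"
  unfolding is_adjoint_def by (metis cinner_commute)

lemma is_adjoint_unique: "is_adjoint a b \<Longrightarrow> is_adjoint a c \<Longrightarrow> b = c"
  unfolding is_adjoint_def by (metis blinfun_eqI cinner_ext)

lemma adj_eqI: "is_adjoint a b \<Longrightarrow> adj a = b"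
  unfolding adj_def by (blast intro: the_equality is_adjoint_unique)

lemma is_adjoint_id: "is_adjoint id_blinfun id_blinfun"
  by (simp add: is_adjoint_def)

lemma is_adjoint_add: "is_adjoint a b \<Longrightarrow> is_adjoint c d \<Longrightarrow> is_adjoint (a + c) (b + d)"
  by (simp add: is_adjoint_def blinfun.add_left cinner_add_left cinner_add_right)

lemma is_adjoint_compose: "is_adjoint a b \<Longrightarrow> is_adjoint c d \<Longrightarrow> is_adjoint (a \<cdot> c) (d \<cdot> b)"
  by (simp add: is_adjoint_def)

lemma is_adjoint_scale: "is_adjoint a b \<Longrightarrow> is_adjoint (op_scale c a) (op_scale (cnj c) b)"
  by (simp add: is_adjoint_def cinner_scaleC_left cinner_scaleC_right)

lemma is_adjoint_scaleR: "is_adjoint a b \<Longrightarrow> is_adjoint (r *\<^sub>R a) (r *\<^sub>R b)"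
  using is_adjoint_scale[of a b "complex_of_real r"] by (simp add: op_scale_of_real)

lemma is_adjoint_diff: "is_adjoint a b \<Longrightarrow> is_adjoint c d \<Longrightarrow> is_adjoint (a - c) (b - d)"
  using is_adjoint_add[of a b "(-1) *\<^sub>R c" "(-1) *\<^sub>R d"] is_adjoint_scaleR[of c d "-1"] by simp

text \<open>The square of \<open>norm (b y)\<close> is the inner product of a (b y) with y;
  Cauchy-Schwarz and cancelling one factor \<open>norm (b y)\<close> finish.\<close>

lemma is_adjoint_norm_le:
  assumes "is_adjoint a b"
  shows "norm b \<le> norm a"
proof (rule norm_blinfun_bound)
  fix y
  have "(norm (b y))\<^sup>2 = a (b y) \<bullet> y"
    using is_adjointD[OF assms] by (simp add: power2_norm_eq_inner)
  also have "\<dots> \<le> norm a * norm (b y) * norm y"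
    by (rule order_trans[OF norm_cauchy_schwarz mult_right_mono[OF norm_blinfun]]) simp
  finally have "norm (b y) * norm (b y)
      \<le> norm (b y) * (norm a * norm y)"
    by (simp add: power2_eq_square mult_ac)
  then show "norm (b y) \<le> norm a * norm y"
    by (cases "norm (b y) = 0") auto
qed simp

lemma is_adjoint_LIMSEQ:
  assumes "\<And>n. is_adjoint (a n) (b n)" "a \<longlonglongrightarrow> a'" "b \<longlonglongrightarrow> b'" "a' \<in> BH" "b' \<in> BH"
  shows "is_adjoint a' b'"
proof (rule is_adjointI[OF assms(4,5)])
  fix x y
  have "(\<lambda>n. blinfun_apply (a n) x \<bullet> y) \<longlonglongrightarrow> blinfun_apply a' x \<bullet> y"
    by (intro tendsto_intros assms)
  moreover have "(\<lambda>n. blinfun_apply (a n) x \<bullet> y) \<longlonglongrightarrow> x \<bullet> blinfun_apply b' y"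
    unfolding is_adjointD[OF assms(1)] by (intro tendsto_intros assms)
  ultimately show "blinfun_apply a' x \<bullet> y = x \<bullet> blinfun_apply b' y"
    by (rule LIMSEQ_unique)
qed

section \<open>Positive operators and their quadratic forms\<close>

lemma positive_opI:
  assumes "a \<in> BH" "is_adjoint a a" "\<And>x. 0 \<le> x \<bullet> a x"
  shows "positive_op a"
proof -
  have "cinner x (a x) \<in> \<real>" for x
    using assms(2) by (metis is_adjoint_def Reals_cnj_iff cinner_commute)
  then show ?thesis
    using assms by (simp add: positive_op_def Re_cinner)
qed

text \<open>Self-adjointness comes by polarization. The quadratic form is real, so x is orthogonal
  to a (i x) in the real inner product for every x; expanding this at x + i y gives the symmetry of
  a.\<close>

lemma positive_opD:
  assumes "positive_op a"
  shows "a \<in> BH" "is_adjoint a a" "0 \<le> x \<bullet> a x"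
proof -
  show a: "a \<in> BH" and "0 \<le> x \<bullet> a x" for x
    using assms by (auto simp: positive_op_def Re_cinner)
  have *: "x \<bullet> a (\<i> *\<^sub>C x) = 0" for x
    using assms a Im_cinner[of x "a x"]
    by (simp add: positive_op_def BH_def complex_is_Real_iff)
  show "is_adjoint a a"
  proof (rule is_adjointI[OF a a])
    fix x y :: 'a
    define z where "z = \<i> *\<^sub>C y"
    have iz: "\<i> *\<^sub>C z = - y"
      using scaleC_of_real[of "-1" y] by (simp add: z_def scaleC_scaleC)
    have i: "(\<i> *\<^sub>C u) \<bullet> (\<i> *\<^sub>C v) = u \<bullet> v" for u v :: 'a
      by (simp add: cinner_scaleC_left cinner_scaleC_right flip: Re_cinner)
    have "0 = (x + z) \<bullet> a (\<i> *\<^sub>C (x + z))"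
      by (simp add: *)
    also have "\<dots> = x \<bullet> a (\<i> *\<^sub>C z) + z \<bullet> a (\<i> *\<^sub>C x)"
      using * by (simp add: scaleC_add_right blinfun.add_right inner_add_left inner_add_right)
    also have "z \<bullet> a (\<i> *\<^sub>C x) = y \<bullet> a x"
      using a by (simp add: z_def BH_def i)
    finally show "a x \<bullet> y = x \<bullet> a y"
      by (simp add: iz blinfun.minus_right inner_commute)
  qed
qed

lemma positive_op_square: "a \<in> BH \<Longrightarrow> b \<in> BH \<Longrightarrow> is_adjoint a b \<Longrightarrow> positive_op (b \<cdot> a)"
  by (rule positive_opI) (auto intro: BH_compose is_adjoint_compose is_adjoint_sym
      simp flip: is_adjointD)

lemma positive_op_conj:
  assumes "positive_op p" "a \<in> BH" "b \<in> BH" "is_adjoint a b"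
  shows "positive_op (b \<cdot> p \<cdot> a)"
proof (rule positive_opI)
  show "is_adjoint (b \<cdot> p \<cdot> a) (b \<cdot> p \<cdot> a)"
    unfolding blinfun_compose_assoc
    using is_adjoint_compose[OF is_adjoint_compose[OF is_adjoint_sym[OF assms(4)] positive_opD(2)[OF assms(1)]] assms(4)]
    by (simp add: blinfun_compose_assoc)
  show "0 \<le> x \<bullet> blinfun_apply (b \<cdot> p \<cdot> a) x" for x
    using positive_opD(3)[OF assms(1), of "a x"] is_adjointD[OF assms(4)] by simp
qed (intro BH_compose assms positive_opD(1))

lemma positive_op_scaleR: "positive_op a \<Longrightarrow> 0 \<le> r \<Longrightarrow> positive_op (r *\<^sub>R a)"
  by (rule positive_opI)
    (auto intro!: BH_scaleR is_adjoint_scaleR mult_nonneg_nonneg intro: positive_opD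
      simp: blinfun.scaleR_left)

lemma positive_op_norm_diff:
  assumes "a \<in> BH" "is_adjoint a a" "norm a \<le> r"
  shows "positive_op (r *\<^sub>R id_blinfun - a)"
proof (rule positive_opI)
  show "0 \<le> x \<bullet> blinfun_apply (r *\<^sub>R id_blinfun - a) x" for x
  proof -
    have "x \<bullet> a x \<le> norm x * norm (a x)"
      by (rule norm_cauchy_schwarz)
    also have "\<dots> \<le> norm x * (norm a * norm x)"
      by (intro mult_left_mono norm_blinfun) simp
    also have "\<dots> \<le> norm x * (r * norm x)"
      by (intro mult_left_mono mult_right_mono assms) auto
    also have "\<dots> = r * (x \<bullet> x)"
      by (simp add: dot_square_norm power2_eq_square)
    finally show ?thesis
      by (simp add: blinfun.diff_left blinfun.scaleR_left inner_diff_right)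
  qed
qed (auto intro!: BH_diff BH_scaleR is_adjoint_diff is_adjoint_scaleR is_adjoint_id assms)

lemma discriminant_le:
  fixes a b c :: real
  assumes "0 \<le> c" "\<And>t. 0 \<le> a + 2 * t * b + t\<^sup>2 * c"
  shows "b\<^sup>2 \<le> a * c"
proof (cases "c = 0")
  case True
  have "b = 0"
  proof (rule ccontr)
    assume "b \<noteq> 0"
    \<comment> \<open>For c = 0 the polynomial is a + 2 t b, and at the chosen t it equals
      -1.\<close>
    then show False
      using assms(2)[of "- (a + 1) / (2 * b)"] True by simp argo
  qed
  then show ?thesis using True by simp
next
  case False
  then show ?thesis
    using assms(1) assms(2)[of "- b / c"] by (simp add: field_simps power2_eq_square)
qed

lemma positive_op_cauchy_schwarz:
  assumes "positive_op a"
  shows "(x \<bullet> a y)\<^sup>2 \<le> (x \<bullet> a x) * (y \<bullet> a y)"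
proof (rule discriminant_le)
  have *: "y \<bullet> a x = x \<bullet> a y"
    using is_adjointD[OF positive_opD(2)[OF assms]] by (simp add: inner_commute)
  show "0 \<le> (x \<bullet> a x) + 2 * t * (x \<bullet> a y) + t\<^sup>2 * (y \<bullet> a y)" for t
    using positive_opD(3)[OF assms, of "x + t *\<^sub>R y"] *
    by (simp add: inner_add_left inner_add_right blinfun.add_right blinfun.scaleR_right
        power2_eq_square algebra_simps)
qed (rule positive_opD(3)[OF assms])

text \<open>This is a^2 <= a for 0 <= a <= 1. No square root of a is available yet; Cauchy-Schwarz
  for the form of a at the pair x, a x replaces it.\<close>

lemma positive_op_norm_square_le:
  assumes "positive_op a" "norm a \<le> 1"
  shows "(norm (a x))\<^sup>2 \<le> x \<bullet> a x"
proof -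
  let ?y = "a x"
  have "((norm ?y)\<^sup>2)\<^sup>2 = (x \<bullet> a ?y)\<^sup>2"
    using is_adjointD[OF positive_opD(2)[OF assms(1)], of x ?y] by (simp add: power2_norm_eq_inner)
  also have "\<dots> \<le> (x \<bullet> ?y) * (?y \<bullet> a ?y)"
    by (rule positive_op_cauchy_schwarz[OF assms(1)])
  also have "\<dots> \<le> (x \<bullet> ?y) * (norm ?y)\<^sup>2"
  proof -
    have "?y \<bullet> a ?y \<le> norm ?y * (norm a * norm ?y)"
      by (rule order_trans[OF norm_cauchy_schwarz mult_left_mono[OF norm_blinfun]]) simp
    also have "\<dots> \<le> norm ?y * (1 * norm ?y)"
      by (intro mult_left_mono mult_right_mono assms) auto
    finally show ?thesis
      using positive_opD(3)[OF assms(1)] by (intro mult_left_mono) (simp_all add: power2_eq_square)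
  qed
  finally have "(norm ?y)\<^sup>2 * (norm ?y)\<^sup>2 \<le> (norm ?y)\<^sup>2 * (x \<bullet> ?y)"
    by (simp only: power2_eq_square mult_ac)
  then show ?thesis
    using positive_opD(3)[OF assms(1), of x] mult_left_le_imp_le[of "(norm ?y)\<^sup>2"]
    by (cases "?y = 0") (simp, metis zero_less_norm_iff zero_less_power)
qed

text \<open>In the expansion of the squared norm of x - a x, the term \<open>norm (a x)\<close>
  squared is absorbed by the mixed term because a^2 <= a.\<close>

lemma norm_id_diff_positive:
  assumes "positive_op a" "norm a \<le> 1"
  shows "norm (id_blinfun - a) \<le> 1"
proof (rule norm_blinfun_bound)
  fix x
  have "(norm (blinfun_apply (id_blinfun - a) x))\<^sup>2
      = (norm x)\<^sup>2 - 2 * (x \<bullet> a x) + (norm (a x))\<^sup>2"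
    by (simp add: blinfun.diff_left power2_norm_eq_inner inner_diff_left inner_diff_right inner_commute)
  also have "\<dots> \<le> (norm x)\<^sup>2"
    using positive_op_norm_square_le[OF assms, of x] positive_opD(3)[OF assms(1), of x] by simp
  finally show "norm (blinfun_apply (id_blinfun - a) x) \<le> 1 * norm x"
    by (simp add: abs_le_square_iff[symmetric])
qed simp

lemma inner_le_norm_add_square: "0 \<le> u \<bullet> v \<Longrightarrow> u \<bullet> v \<le> (norm (u + v))\<^sup>2" for u v :: "'a::real_inner"
  using inner_ge_zero[of u] inner_ge_zero[of v] inner_commute[of v u]
  unfolding power2_norm_eq_inner inner_add_left inner_add_right by linarith

section \<open>Unital norm-closed star-algebras: resolvents and square roots\<close>

lemmas tendsto_op_times = bounded_bilinear.tendsto[OF bounded_bilinear_blinfun_compose]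

text \<open>A concrete unital C*-algebra. Norm closedness keeps the fixed points and limits
  constructed below inside the algebra.\<close>

locale op_algebra =
  fixes A :: "'h::complex_hilbert bop set"
  assumes sub_BH: "A \<subseteq> BH"
    and id_mem [simp, intro]: "id_blinfun \<in> A"
    and add_mem [intro]: "a \<in> A \<Longrightarrow> b \<in> A \<Longrightarrow> a + b \<in> A"
    and scale_mem [intro]: "a \<in> A \<Longrightarrow> op_scale c a \<in> A"
    and comp_mem [intro]: "a \<in> A \<Longrightarrow> b \<in> A \<Longrightarrow> a \<cdot> b \<in> A"
    and ex_adjoint: "a \<in> A \<Longrightarrow> \<exists>b\<in>A. is_adjoint a b"
    and closed_A: "closed A"
begin

lemma mem_BH: "a \<in> A \<Longrightarrow> a \<in> BH"
  using sub_BH by blast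

lemma scaleR_mem [intro]: "a \<in> A \<Longrightarrow> r *\<^sub>R a \<in> A"
  using scale_mem[of a "complex_of_real r"] by (simp add: op_scale_of_real)

lemma diff_mem [intro]: "a \<in> A \<Longrightarrow> b \<in> A \<Longrightarrow> a - b \<in> A"
  using add_mem[OF _ scaleR_mem[of b "-1"], of a] by simp

lemma uminus_mem [intro]: "a \<in> A \<Longrightarrow> - a \<in> A"
  using scaleR_mem[of a "-1"] by simp

lemma zero_mem [simp, intro]: "0 \<in> A"
  using scaleR_mem[OF id_mem, of 0] by simp

lemma sum_mem [intro]: "(\<And>i. i \<in> I \<Longrightarrow> f i \<in> A) \<Longrightarrow> sum f I \<in> A"
  by (induction I rule: infinite_finite_induct) auto

lemma is_adjoint_adj: "a \<in> A \<Longrightarrow> is_adjoint a (adj a)"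
  using ex_adjoint adj_eqI by blast

lemma adj_mem [intro]: "a \<in> A \<Longrightarrow> adj a \<in> A"
  using ex_adjoint adj_eqI by blast

lemma adj_adj [simp]: "a \<in> A \<Longrightarrow> adj (adj a) = a"
  by (rule adj_eqI[OF is_adjoint_sym[OF is_adjoint_adj]])

lemma adj_id [simp]: "adj id_blinfun = id_blinfun"
  by (intro adj_eqI is_adjoint_id)

lemma adj_zero [simp]: "adj (0 :: 'h bop) = 0"
  by (rule adj_eqI) (simp add: is_adjointI BH_def)

lemma adj_add: "a \<in> A \<Longrightarrow> b \<in> A \<Longrightarrow> adj (a + b) = adj a + adj b"
  by (intro adj_eqI is_adjoint_add is_adjoint_adj)

lemma adj_diff: "a \<in> A \<Longrightarrow> b \<in> A \<Longrightarrow> adj (a - b) = adj a - adj b"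
  by (intro adj_eqI is_adjoint_diff is_adjoint_adj)

lemma adj_compose: "a \<in> A \<Longrightarrow> b \<in> A \<Longrightarrow> adj (a \<cdot> b) = adj b \<cdot> adj a"
  by (intro adj_eqI is_adjoint_compose is_adjoint_adj)

lemma adj_scale: "a \<in> A \<Longrightarrow> adj (op_scale c a) = op_scale (cnj c) (adj a)"
  by (intro adj_eqI is_adjoint_scale is_adjoint_adj)

lemma adj_scaleR: "a \<in> A \<Longrightarrow> adj (r *\<^sub>R a) = r *\<^sub>R adj a"
  by (intro adj_eqI is_adjoint_scaleR is_adjoint_adj)

lemma norm_adj_le: "a \<in> A \<Longrightarrow> norm (adj a) \<le> norm a"
  by (rule is_adjoint_norm_le[OF is_adjoint_adj])

lemma adj_positive: "positive_op a \<Longrightarrow> adj a = a"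
  by (rule adj_eqI[OF positive_opD(2)])

lemma positive_adj_compose: "a \<in> A \<Longrightarrow> positive_op (adj a \<cdot> a)"
  by (rule positive_op_square[OF _ _ is_adjoint_adj]) (simp_all add: mem_BH adj_mem)

text \<open>With R > norm b and k = 1 - b / R one has 1 + b = (1 + R) - R k and norm k <= 1. The
  equation for the inverse is then a fixed-point equation with contraction ratio R / (1 +
  R).\<close>

lemma inverse_id_add_positive:
  assumes b: "b \<in> A" "positive_op b"
  obtains c where "c \<in> A" "positive_op c" "c + b \<cdot> c = id_blinfun" "c + c \<cdot> b = id_blinfun"
    "norm c \<le> 1"
proof -
  define R where "R = norm b + 1"
  have R: "R > 0" by (simp add: R_def add_nonneg_pos)
  define k where "k = id_blinfun - (1 / R) *\<^sub>R b"
  have kA: "k \<in> A" unfolding k_def using b by blast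
  have "norm b \<le> R" by (simp add: R_def)
  then have nk: "norm k \<le> 1"
    unfolding k_def using R b
    by (intro norm_id_diff_positive positive_op_scaleR) (auto simp: field_simps)
  define q where "q = R / (1 + R)"
  define f where "f c = (1 / (1 + R)) *\<^sub>R id_blinfun + q *\<^sub>R (k \<cdot> c)" for c
  have "\<exists>!c\<in>A. f c = c"
  proof (rule Banach_fix)
    show "complete A" using closed_A by (simp add: complete_eq_closed)
    show "0 \<le> q" "q < 1" using R by (auto simp: q_def field_simps)
    show "f ` A \<subseteq> A" unfolding f_def using kA by blast
    show "dist (f x) (f y) \<le> q * dist x y" for x y
    proof -
      have "f x - f y = q *\<^sub>R (k \<cdot> (x - y))"
        by (simp add: f_def op_simps scaleR_diff_right)
      moreover have "norm (k \<cdot> (x - y)) \<le> norm (x - y)"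
        using norm_compose_le[OF nk order_refl] by simp
      ultimately show ?thesis
        using R by (simp add: dist_norm q_def mult_left_mono divide_right_mono)
    qed
  qed auto
  then obtain c where c: "c \<in> A" "f c = c" by blast
  have "(1 + R) *\<^sub>R c = (1 + R) *\<^sub>R f c" using c by simp
  also have "\<dots> = id_blinfun + R *\<^sub>R (k \<cdot> c)"
    using R by (simp add: f_def q_def scaleR_add_right)
  also have "R *\<^sub>R (k \<cdot> c) = R *\<^sub>R c - b \<cdot> c"
    using R by (simp add: k_def op_simps scaleR_diff_right)
  finally have 1: "c + b \<cdot> c = id_blinfun"
    by (simp add: algebra_simps)
  have 2: "adj c + adj c \<cdot> b = id_blinfun"
    using arg_cong[OF 1, of adj] b c by (simp add: adj_add adj_compose comp_mem adj_positive)
  \<comment> \<open>A left inverse and a right inverse coincide; here they are \<open>adj c\<close>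
    and c.\<close>
  have "adj c = adj c \<cdot> (c + b \<cdot> c)" by (simp add: 1)
  also have "\<dots> = (adj c + adj c \<cdot> b) \<cdot> c" by (simp add: op_simps)
  finally have adjc: "adj c = c" by (simp add: 2)
  \<comment> \<open>Both positivity and the norm bound of c are read off after writing x as (1 + b)
    applied to c x.\<close>
  have x: "x = c x + b (c x)" for x
    using arg_cong[OF 1, of "\<lambda>f. blinfun_apply f x"] by (simp add: blinfun.add_left)
  have pos: "0 \<le> y \<bullet> b y" for y
    using positive_opD(3)[OF b(2)] .
  show ?thesis
  proof (rule that[OF c(1) _ 1])
    show "positive_op c"
    proof (rule positive_opI)
      show "0 \<le> x \<bullet> c x" for x
        using pos[of "c x"] by (subst x) (simp add: inner_add_left inner_add_right inner_commute)
    qed (use sub_BH c is_adjoint_adj[OF c(1)] adjc in auto)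
    show "c + c \<cdot> b = id_blinfun" using 2 adjc by simp
    show "norm c \<le> 1"
    proof (rule norm_blinfun_bound)
      fix x
      let ?y = "c x"
      have "(norm ?y)\<^sup>2 \<le> (norm (?y + b ?y))\<^sup>2"
        using pos[of ?y] by (simp add: power2_norm_eq_inner inner_add_left inner_add_right inner_commute)
      then show "norm ?y \<le> 1 * norm x"
        using x[of x] by (simp add: abs_le_square_iff[symmetric])
    qed simp
  qed
qed

text \<open>For u = c x, the squared norm of r y u is the form of \<open>?b\<close> at u, hence at
  most the squared norm of u + \<open>?b\<close> u = x. The two formulas for 1 - c express that c is
  a left and a right inverse of 1 + \<open>?b\<close>.\<close>

lemma cutoff_op:
  assumes y: "y \<in> A" and "0 \<le> r"
  obtains c where "c \<in> A" "adj c = c" "norm c \<le> 1" "norm (r *\<^sub>R (y \<cdot> c)) \<le> 1"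
    "id_blinfun - c = r\<^sup>2 *\<^sub>R (c \<cdot> adj y \<cdot> y)" "id_blinfun - c = r\<^sup>2 *\<^sub>R (adj y \<cdot> y \<cdot> c)"
proof -
  let ?b = "r\<^sup>2 *\<^sub>R (adj y \<cdot> y)"
  have b: "?b \<in> A" "positive_op ?b"
    using y by (auto intro!: positive_op_scaleR positive_adj_compose)
  obtain c where c: "c \<in> A" "positive_op c" "c + ?b \<cdot> c = id_blinfun" "c + c \<cdot> ?b = id_blinfun"
    "norm c \<le> 1"
    by (rule inverse_id_add_positive[OF b])
  have "norm (r *\<^sub>R (y \<cdot> c)) \<le> 1"
  proof (rule norm_blinfun_bound)
    fix x
    let ?u = "c x"
    have x: "x = ?u + ?b ?u"
      using arg_cong[OF c(3), of "\<lambda>f. blinfun_apply f x"] by (simp add: blinfun.add_left)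
    have "(norm (blinfun_apply (r *\<^sub>R (y \<cdot> c)) x))\<^sup>2 = ?u \<bullet> ?b ?u"
      using is_adjointD[OF is_adjoint_adj[OF y], of ?u "y ?u"]
      by (simp add: power2_norm_eq_inner blinfun.scaleR_left power_mult_distrib)
    also have "\<dots> \<le> (norm (?u + ?b ?u))\<^sup>2"
      by (rule inner_le_norm_add_square[OF positive_opD(3)[OF b(2)]])
    finally show "norm (blinfun_apply (r *\<^sub>R (y \<cdot> c)) x) \<le> 1 * norm x"
      using x by (simp add: abs_le_square_iff[symmetric])
  qed simp
  then show ?thesis
    using c by (rule_tac that[of c]) (simp_all add: adj_positive op_simps eq_diff_eq diff_eq_eq add.commute)
qed

lemma positive_sqrt_contraction:
  assumes a: "a \<in> A" "positive_op a" "norm a \<le> 1"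
  obtains r where "r \<in> A" "positive_op r" "r \<cdot> r = a" "\<forall>d. a \<cdot> d = d \<cdot> a \<longrightarrow> r \<cdot> d = d \<cdot> r"
proof -
  \<comment> \<open>The iteration \<open>y \<mapsto> (b + y\<^sup>2) / 2\<close> for \<open>1 - sqrt (1 - b)\<close> is dominated by the real one at
      \<open>b = 1\<close>, so it converges in norm although the binomial series is at its radius of convergence.\<close>
  define b where "b = id_blinfun - a"
  have b: "b \<in> A" "norm b \<le> 1"
    unfolding b_def using a by (auto intro: norm_id_diff_positive)
  have adjb: "adj b = b" using a by (simp add: b_def adj_diff adj_positive)
  define y where "y = rec_nat 0 (\<lambda>_ y. (1/2) *\<^sub>R (b + y \<cdot> y))"
  define t where "t = rec_nat (0::real) (\<lambda>_ t. (1 + t * t) / 2)"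
  have y0: "y 0 = 0" and yS: "y (Suc k) = (1/2) *\<^sub>R (b + y k \<cdot> y k)" for k
    by (simp_all add: y_def)
  have t0: "t 0 = 0" and tS: "t (Suc k) = (1 + t k * t k) / 2" for k
    by (simp_all add: t_def)
  have t01: "0 \<le> t k \<and> t k \<le> 1" for k
  proof (induction k)
    case (Suc k)
    then show ?case by (simp add: tS mult_le_one add_nonneg_nonneg)
  qed (simp add: t0)
  have yA: "y k \<in> A" for k
    by (induction k) (use b in \<open>auto simp: y0 yS\<close>)
  have adjy: "adj (y k) = y k" for k
    by (induction k)
      (use b yA adjb in \<open>auto simp: y0 yS adj_scaleR adj_add adj_compose add_mem comp_mem\<close>)
  have nt: "norm (y k) \<le> t k" for k
  proof (induction k)
    case (Suc k)
    have "norm (y (Suc k)) \<le> (norm b + norm (y k \<cdot> y k)) / 2"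
      using norm_triangle_ineq[of b "y k \<cdot> y k"] by (simp add: yS)
    also have "\<dots> \<le> (1 + t k * t k) / 2"
      using b norm_compose_le[OF Suc Suc] by simp
    finally show ?case by (simp add: tS)
  qed (simp add: y0 t0)
  have nd: "norm (y (Suc k) - y k) \<le> t (Suc k) - t k" for k
  proof (induction k)
    case 0
    show ?case using b by (simp add: y0 yS t0 tS)
  next
    case (Suc k)
    \<comment> \<open>The difference of squares is split without commuting the iterates. The same
      expression in t is an exact equality, so the increments stay dominated.\<close>
    have "y (Suc (Suc k)) - y (Suc k)
        = (1/2) *\<^sub>R ((y (Suc k) - y k) \<cdot> y (Suc k) + y k \<cdot> (y (Suc k) - y k))"
    proof -
      have "y (Suc (Suc k)) - y (Suc k) = (1/2) *\<^sub>R (y (Suc k) \<cdot> y (Suc k) - y k \<cdot> y k)"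
        unfolding yS[of "Suc k"] by (subst (3) yS) (simp only: scaleR_diff_right scaleR_add_right add_diff_cancel_left)
      then show ?thesis by (simp add: op_simps)
    qed
    then have "norm (y (Suc (Suc k)) - y (Suc k))
        \<le> (norm ((y (Suc k) - y k) \<cdot> y (Suc k)) + norm (y k \<cdot> (y (Suc k) - y k))) / 2"
      using norm_triangle_ineq by simp
    also have "\<dots> \<le> ((t (Suc k) - t k) * t (Suc k) + t k * (t (Suc k) - t k)) / 2"
      using norm_compose_le[OF Suc nt[of "Suc k"]] norm_compose_le[OF nt[of k] Suc] by simp
    also have "\<dots> = t (Suc (Suc k)) - t (Suc k)"
      by (simp add: tS[of "Suc k"] tS[of k] field_simps)
    finally show ?case .
  qed
  have nd': "norm (y (k + m) - y k) \<le> t (k + m) - t k" for k m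
  proof (induction m)
    case (Suc m)
    have "norm (y (k + Suc m) - y k) \<le> norm (y (Suc (k + m)) - y (k + m)) + norm (y (k + m) - y k)"
      using norm_triangle_ineq[of "y (Suc (k + m)) - y (k + m)" "y (k + m) - y k"] by simp
    then show ?case using Suc nd[of "k + m"] by simp
  qed simp
  have "t k \<le> t (Suc k)" for k
    using nd[of k] norm_ge_zero[of "y (Suc k) - y k"] by linarith
  then have "incseq t" by (rule incseq_SucI)
  then have "convergent t"
    using t01 by (intro Bseq_monoseq_convergent BseqI'[of t 1]) (auto simp: incseq_imp_monoseq)
  then have "Cauchy t" by (rule convergent_Cauchy)
  have "Cauchy y"
  proof (rule metric_CauchyI)
    fix e :: real assume "0 < e"
    then obtain K where K: "\<And>m n. m \<ge> K \<Longrightarrow> n \<ge> K \<Longrightarrow> dist (t m) (t n) < e"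
      using metric_CauchyD[OF \<open>Cauchy t\<close>] by blast
    have *: "dist (y m) (y n) < e" if "n \<ge> K" "m \<ge> n" for m n
      using nd'[of n "m - n"] K[of m n] that by (auto simp: dist_norm)
    show "\<exists>K. \<forall>m\<ge>K. \<forall>n\<ge>K. dist (y m) (y n) < e"
      using * by (metis dist_commute nle_le)
  qed
  then obtain Y where Y: "y \<longlonglongrightarrow> Y"
    by (auto simp: Cauchy_convergent_iff convergent_def)
  have YA: "Y \<in> A"
    using closed_sequentially[OF closed_A _ Y] yA by blast
  have adjY: "is_adjoint Y Y"
  proof (rule is_adjoint_LIMSEQ[OF _ Y Y])
    show "is_adjoint (y n) (y n)" for n
      using is_adjoint_adj[OF yA[of n]] adjy by simp
  qed (use YA sub_BH in auto)
  have nY: "norm Y \<le> 1"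
    using tendsto_norm[OF Y] nt t01 by (intro LIMSEQ_le_const2) (auto intro: order_trans)
  have "(\<lambda>k. (1/2) *\<^sub>R (b + y k \<cdot> y k)) \<longlonglongrightarrow> (1/2) *\<^sub>R (b + Y \<cdot> Y)"
    by (intro tendsto_scaleR tendsto_add tendsto_const tendsto_op_times Y)
  moreover have "(\<lambda>k. (1/2) *\<^sub>R (b + y k \<cdot> y k)) \<longlonglongrightarrow> Y"
    using LIMSEQ_Suc[OF Y] by (simp only: yS)
  ultimately have eq: "(1/2) *\<^sub>R (b + Y \<cdot> Y) = Y"
    by (rule LIMSEQ_unique)
  \<comment> \<open>Each iterate is built from b = 1 - a alone, so it commutes with whatever
    commutes with a; the limit inherits this.\<close>
  have comm: "y k \<cdot> d = d \<cdot> y k" if "a \<cdot> d = d \<cdot> a" for d k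
  proof (induction k)
    case (Suc k)
    have "y k \<cdot> (y k \<cdot> d) = d \<cdot> (y k \<cdot> y k)"
      by (metis Suc blinfun_compose_assoc)
    then show ?case using that by (simp add: yS op_simps b_def)
  qed (simp add: y0)
  show ?thesis
  proof (rule that[of "id_blinfun - Y"])
    show "id_blinfun - Y \<in> A" using YA by blast
    show "positive_op (id_blinfun - Y)"
      using positive_op_norm_diff[OF _ adjY nY] YA sub_BH by auto
    have "2 *\<^sub>R Y = b + Y \<cdot> Y" by (subst (1) eq[symmetric]) simp
    then show "(id_blinfun - Y) \<cdot> (id_blinfun - Y) = a"
      by (simp add: op_simps b_def scaleR_2 algebra_simps)
    show "\<forall>d. a \<cdot> d = d \<cdot> a \<longrightarrow> (id_blinfun - Y) \<cdot> d = d \<cdot> (id_blinfun - Y)"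
    proof (intro allI impI)
    fix d assume d: "a \<cdot> d = d \<cdot> a"
    have "(\<lambda>k. y k \<cdot> d) \<longlonglongrightarrow> Y \<cdot> d" "(\<lambda>k. d \<cdot> y k) \<longlonglongrightarrow> d \<cdot> Y"
  by (intro tendsto_op_times tendsto_const Y)+
    then have "Y \<cdot> d = d \<cdot> Y" unfolding comm[OF d] by (rule LIMSEQ_unique)
    then show "(id_blinfun - Y) \<cdot> d = d \<cdot> (id_blinfun - Y)" by (simp add: op_simps)
    qed
  qed
qed

text \<open>Dividing by norm a + 1, which is nonzero even for a = 0, reduces to contractions. The
  commutation clause is what will make the root unique and \<open>op_abs\<close> well
  defined.\<close>

lemma positive_sqrt:
  assumes a: "a \<in> A" "positive_op a"
  obtains r where "r \<in> A" "positive_op r" "r \<cdot> r = a" "\<forall>d. a \<cdot> d = d \<cdot> a \<longrightarrow> r \<cdot> d = d \<cdot> r"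
proof -
  define s where "s = norm a + 1"
  have s: "s > 0" "norm a \<le> s" by (simp_all add: s_def add_nonneg_pos)
  have sa: "(1 / s) *\<^sub>R a \<in> A" "positive_op ((1 / s) *\<^sub>R a)" "norm ((1 / s) *\<^sub>R a) \<le> 1"
    using a s by (simp_all add: scaleR_mem positive_op_scaleR)
  obtain r where r: "r \<in> A" "positive_op r" "r \<cdot> r = (1 / s) *\<^sub>R a"
    "\<forall>d. ((1 / s) *\<^sub>R a) \<cdot> d = d \<cdot> ((1 / s) *\<^sub>R a) \<longrightarrow> r \<cdot> d = d \<cdot> r"
    by (rule positive_sqrt_contraction[OF sa])
  show ?thesis
  proof (rule that[of "sqrt s *\<^sub>R r"])
    show "sqrt s *\<^sub>R r \<cdot> sqrt s *\<^sub>R r = a" using r(3) s by (simp add: op_simps)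
    show "\<forall>d. a \<cdot> d = d \<cdot> a \<longrightarrow> sqrt s *\<^sub>R r \<cdot> d = d \<cdot> sqrt s *\<^sub>R r"
    proof (intro allI impI)
      fix d assume "a \<cdot> d = d \<cdot> a"
      then have "r \<cdot> d = d \<cdot> r" by (intro r(4)[rule_format]) (simp add: op_simps)
      then show "sqrt s *\<^sub>R r \<cdot> d = d \<cdot> sqrt s *\<^sub>R r" by (simp add: op_simps)
    qed
    show "sqrt s *\<^sub>R r \<in> A" "positive_op (sqrt s *\<^sub>R r)"
      using r(1,2) s(1) by (simp_all add: scaleR_mem positive_op_scaleR)
  qed
qed

end

lemma positive_op_kernel:
  assumes "positive_op a" "x \<bullet> a x = 0"
  shows "a x = 0"
  using positive_op_cauchy_schwarz[OF assms(1), of "a x" x] assms(2) by simp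

text \<open>Since c commutes with c^2 = r^2, it commutes with r, so (r + c) d = 0 for d = r - c.
  Testing this against d x, both nonnegative terms vanish, hence r d = c d = 0 and d^2 = 0; a
  self-adjoint d with d^2 = 0 is 0.\<close>

lemma positive_sqrt_unique:
  assumes r: "positive_op r" "\<And>d. (r \<cdot> r) \<cdot> d = d \<cdot> (r \<cdot> r) \<Longrightarrow> r \<cdot> d = d \<cdot> r"
    and c: "positive_op c" "c \<cdot> c = r \<cdot> r"
  shows "c = r"
proof -
  have comm: "r \<cdot> c = c \<cdot> r"
    by (rule r(2)) (simp add: blinfun_compose_assoc flip: c(2))
  define d where "d = r - c"
  have adjd: "is_adjoint d d"
    unfolding d_def by (intro is_adjoint_diff positive_opD r c)
  have "(r + c) \<cdot> d = 0"
    by (simp only: d_def op_simps comm c(2)) simp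
  have *: "r (d x) + c (d x) = 0" for x
    using arg_cong[OF \<open>(r + c) \<cdot> d = 0\<close>, of "\<lambda>f. blinfun_apply f x"] by (simp add: blinfun.add_left)
  have "d x \<bullet> r (d x)
      + d x \<bullet> c (d x) = 0" for x
    unfolding inner_add_right[symmetric] * by simp
  then have "d x \<bullet> r (d x) = 0 \<and>
    d x \<bullet> c (d x) = 0" for x
    using positive_opD(3)[OF r(1), of "d x"] positive_opD(3)[OF c(1), of "d x"]
    by (metis add_nonneg_eq_0_iff)
  then have "r (d x) - c (d x) = 0" for x
    using positive_op_kernel[OF r(1), of "d x"]
      positive_op_kernel[OF c(1), of "d x"] by simp
  then have "d (d x) = 0" for x
    by (subst (1) d_def) (simp add: blinfun.diff_left)
  then have "d x \<bullet> d x = 0" for x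
    using is_adjointD[OF adjd, of x "d x"] by simp
  then have "d = 0" by (intro blinfun_eqI) simp
  then show ?thesis by (simp add: d_def)
qed

context op_algebra
begin

lemma op_abs:
  assumes "a \<in> A"
  shows "op_abs a \<in> A" "positive_op (op_abs a)" "op_abs a \<cdot> op_abs a = adj a \<cdot> a"
proof -
  obtain r where r: "r \<in> A" "positive_op r" "r \<cdot> r = adj a \<cdot> a"
    "\<forall>d. (adj a \<cdot> a) \<cdot> d = d \<cdot> (adj a \<cdot> a) \<longrightarrow> r \<cdot> d = d \<cdot> r"
    by (rule positive_sqrt[OF comp_mem[OF adj_mem[OF assms] assms] positive_adj_compose[OF assms]])
  have "op_abs a = r"
    unfolding op_abs_def
  proof (rule the_equality)
    show "positive_op r \<and> r \<cdot> r = adj a \<cdot> a" using r(2,3) by simp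
    show "b = r" if "positive_op b \<and> b \<cdot> b = adj a \<cdot> a" for b
    proof (rule positive_sqrt_unique[OF r(2)])
      show "r \<cdot> d = d \<cdot> r" if "r \<cdot> r \<cdot> d = d \<cdot> (r \<cdot> r)" for d
        using that r(4) unfolding r(3) by blast
      show "positive_op b" "b \<cdot> b = r \<cdot> r"
        using that unfolding r(3) by blast+
    qed
  qed
  then show "op_abs a \<in> A" "positive_op (op_abs a)" "op_abs a \<cdot> op_abs a = adj a \<cdot> a"
    using r(1-3) by auto
qed

end

section \<open>Tracial algebras and their p-norms\<close>

text \<open>Kept at this generality so that the theory applies to M, to the matrices over M, and to
  each subalgebra with the restricted trace.\<close>

locale tracial_algebra = op_algebra A for A :: "'h::complex_hilbert bop set" +
  fixes \<phi> :: "'h bop \<Rightarrow> complex"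
  assumes phi_add: "a \<in> A \<Longrightarrow> b \<in> A \<Longrightarrow> \<phi> (a + b) = \<phi> a + \<phi> b"
    and phi_scale: "a \<in> A \<Longrightarrow> \<phi> (op_scale c a) = c * \<phi> a"
    and phi_positive: "a \<in> A \<Longrightarrow> positive_op a \<Longrightarrow> \<phi> a \<in> \<real> \<and> 0 \<le> Re (\<phi> a)"
    and phi_commute: "a \<in> A \<Longrightarrow> b \<in> A \<Longrightarrow> \<phi> (a \<cdot> b) = \<phi> (b \<cdot> a)"
    and phi_id [simp]: "\<phi> id_blinfun = 1"
begin

text \<open>\<open>Suc 0\<close> is the form to which the simplifier brings the exponent 1.\<close>

abbreviation N1 where "N1 \<equiv> pnorm \<phi> (Suc 0)"
abbreviation N2 where "N2 \<equiv> pnorm \<phi> 2"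

lemma phi_scaleR: "a \<in> A \<Longrightarrow> \<phi> (r *\<^sub>R a) = complex_of_real r * \<phi> a"
  using phi_scale[of a "complex_of_real r"] by (simp add: op_scale_of_real)

lemma phi_diff: "a \<in> A \<Longrightarrow> b \<in> A \<Longrightarrow> \<phi> (a - b) = \<phi> a - \<phi> b"
  using phi_add[of a "(-1) *\<^sub>R b"] phi_scaleR[of b "-1"] uminus_mem[of b] by simp

lemma phi_zero [simp]: "\<phi> 0 = 0"
  using phi_diff[OF id_mem id_mem] by simp

lemma phi_sum: "(\<And>i. i \<in> I \<Longrightarrow> f i \<in> A) \<Longrightarrow> \<phi> (sum f I) = (\<Sum>i\<in>I. \<phi> (f i))"
  by (induction I rule: infinite_finite_induct) (simp_all add: phi_add sum_mem)

text \<open>The trace of \<open>adj (a + c) \<cdot> (a + c)\<close> is real for every scalar c, so c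
  \<open>\<phi> (adj a)\<close> + conj(c) \<open>\<phi> a\<close> is real. The choices c = 1 and c =
  i give the claim.\<close>

lemma phi_adj:
  assumes a: "a \<in> A"
  shows "\<phi> (adj a) = cnj (\<phi> a)"
proof -
  have *: "\<phi> (adj b \<cdot> b) \<in> \<real>" if "b \<in> A" for b
    using phi_positive[OF _ positive_adj_compose[OF that]] adj_mem comp_mem that by blast
  have 1: "\<phi> (adj (a + op_scale c id_blinfun) \<cdot> (a + op_scale c id_blinfun))
      = \<phi> (adj a \<cdot> a) + c * \<phi> (adj a) + cnj c * \<phi> a + cnj c * c" for c
  proof -
    have m: "adj a \<in> A" "op_scale c id_blinfun \<in> A" "adj a \<cdot> a \<in> A" "op_scale c (adj a) \<in> A"
      "op_scale (cnj c) a \<in> A" "op_scale c id_blinfun \<in> A" "op_scale (cnj c) (op_scale c id_blinfun) \<in> A"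
      using a by blast+
    have "adj (a + op_scale c id_blinfun) \<cdot> (a + op_scale c id_blinfun)
        = (adj a \<cdot> a + op_scale c (adj a)) + (op_scale (cnj c) a + op_scale (cnj c) (op_scale c id_blinfun))"
      using a m by (simp add: adj_add adj_scale op_simps op_scale_compose mem_BH)
    then show ?thesis
      using a m by (simp add: phi_add phi_scale add_mem)
  qed
  have r: "c * \<phi> (adj a) + cnj c * \<phi> a \<in> \<real>" for c
  proof -
    have "c * \<phi> (adj a) + cnj c * \<phi> a
       = \<phi> (adj (a + op_scale c id_blinfun) \<cdot> (a + op_scale c id_blinfun)) - \<phi> (adj a \<cdot> a)
         - complex_of_real ((cmod c)\<^sup>2)"
      unfolding 1 complex_norm_square by (simp add: mult.commute)
    moreover have "a + op_scale c id_blinfun \<in> A" using a by blast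
    ultimately show ?thesis
      using a by (simp add: *)
  qed
  show ?thesis
    using r[of 1] r[of \<i>] by (simp add: complex_is_Real_iff complex_eq_iff)
qed

section \<open>The Hilbert space structure of the 2-norm\<close>

lemma pnorm_1: "N1 x = Re (\<phi> (op_abs x))"
  by (simp add: pnorm_def op_prod_def)

lemma N2_eq_sqrt: "x \<in> A \<Longrightarrow> N2 x = sqrt (Re (\<phi> (adj x \<cdot> x)))"
  by (simp add: pnorm_def op_prod_def sqrt_def op_abs numeral_2_eq_2)

lemma N2_nonneg [simp]: "x \<in> A \<Longrightarrow> 0 \<le> N2 x"
  using phi_positive[OF _ positive_adj_compose, of x] by (simp add: N2_eq_sqrt comp_mem adj_mem)

lemma phi_adj_compose: "x \<in> A \<Longrightarrow> \<phi> (adj x \<cdot> x) = complex_of_real ((N2 x)\<^sup>2)"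
  using phi_positive[OF _ positive_adj_compose, of x]
  by (simp add: N2_eq_sqrt comp_mem adj_mem complex_eq_iff complex_is_Real_iff)

lemma N2_square: "x \<in> A \<Longrightarrow> (N2 x)\<^sup>2 = Re (\<phi> (adj x \<cdot> x))"
  by (simp add: phi_adj_compose)

lemma N2_adj [simp]: "x \<in> A \<Longrightarrow> N2 (adj x) = N2 x"
  using phi_commute[of x "adj x"] by (simp add: N2_eq_sqrt adj_mem)

lemma N2_add_square:
  assumes x: "x \<in> A" and y: "y \<in> A"
  shows "(N2 (x + y))\<^sup>2 = (N2 x)\<^sup>2 + 2 * Re (\<phi> (adj x \<cdot> y)) + (N2 y)\<^sup>2"
proof -
  have m: "adj x \<in> A" "adj y \<in> A" "adj x \<cdot> y \<in> A" "adj y \<cdot> x \<in> A" "adj x \<cdot> x \<in> A" "adj y \<cdot> y \<in> A"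
    using x y by blast+
  have "adj y \<cdot> x = adj (adj x \<cdot> y)" using x y m by (simp add: adj_compose)
  then have "\<phi> (adj y \<cdot> x) = cnj (\<phi> (adj x \<cdot> y))" using m by (simp add: phi_adj)
  then show ?thesis
    using x y m by (simp add: N2_square add_mem adj_add op_simps phi_add)
qed

lemma N2_scaleR: "x \<in> A \<Longrightarrow> N2 (r *\<^sub>R x) = \<bar>r\<bar> * N2 x"
  by (simp add: N2_eq_sqrt scaleR_mem adj_scaleR op_simps phi_scaleR comp_mem adj_mem real_sqrt_mult
      flip: power2_eq_square)

lemma Re_phi_cauchy_schwarz:
  assumes x: "x \<in> A" and y: "y \<in> A"
  shows "\<bar>Re (\<phi> (adj x \<cdot> y))\<bar> \<le> N2 x * N2 y"
proof -
  have "(Re (\<phi> (adj x \<cdot> y)))\<^sup>2 \<le> (N2 x)\<^sup>2 * (N2 y)\<^sup>2"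
  proof (rule discriminant_le)
    fix t
    have "0 \<le> (N2 (x + t *\<^sub>R y))\<^sup>2" by simp
    also have "\<dots> = (N2 x)\<^sup>2 + 2 * (t * Re (\<phi> (adj x \<cdot> y))) + (\<bar>t\<bar> * N2 y)\<^sup>2"
      using x y by (simp add: N2_add_square N2_scaleR scaleR_mem op_simps phi_scaleR comp_mem adj_mem)
    finally show "0 \<le> (N2 x)\<^sup>2 + 2 * t * Re (\<phi> (adj x \<cdot> y)) + t\<^sup>2 * (N2 y)\<^sup>2"
      by (simp add: power_mult_distrib mult.assoc)
  qed simp
  then show ?thesis
    using x y by (simp add: abs_le_square_iff[symmetric] abs_mult flip: power_mult_distrib)
qed

lemma phi_cauchy_schwarz:
  assumes x: "x \<in> A" and y: "y \<in> A"
  shows "cmod (\<phi> (x \<cdot> y)) \<le> N2 x * N2 y"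
proof (cases "\<phi> (x \<cdot> y) = 0")
  case False
  define z where "z = \<phi> (x \<cdot> y)"
  \<comment> \<open>The phase that makes the trace of x times c y equal to its modulus, which
    reduces the claim to the real version.\<close>
  define c where "c = cnj z / cmod z"
  have z: "cmod z \<noteq> 0" using False by (simp add: z_def)
  have c: "c * z = cmod z" "cnj c * c = 1"
    using z complex_norm_square[of z]
    by (simp_all add: c_def power2_eq_square mult.commute[of _ z] field_simps)
  have m: "op_scale c y \<in> A" using y by blast
  have "\<phi> (adj (op_scale c y) \<cdot> op_scale c y) = cnj c * (c * \<phi> (adj y \<cdot> y))"
    using y by (simp add: adj_scale op_scale_compose mem_BH adj_mem phi_scale comp_mem scale_mem)
  then have N: "N2 (op_scale c y) = N2 y"
    using c y m by (simp add: N2_eq_sqrt flip: mult.assoc)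
  have "cmod z = Re (\<phi> (adj (adj x) \<cdot> op_scale c y))"
    using x y c by (simp add: op_scale_compose mem_BH phi_scale comp_mem flip: z_def)
  also have "\<dots> \<le> N2 (adj x) * N2 (op_scale c y)"
    using Re_phi_cauchy_schwarz[OF adj_mem[OF x] m] by linarith
  finally show ?thesis using N x by (simp add: z_def)
qed (use x y in simp)

lemma N2_triangle:
  assumes x: "x \<in> A" and y: "y \<in> A"
  shows "N2 (x + y) \<le> N2 x + N2 y"
proof (rule power2_le_imp_le)
  show "(N2 (x + y))\<^sup>2 \<le> (N2 x + N2 y)\<^sup>2"
    using Re_phi_cauchy_schwarz[OF x y] by (simp add: N2_add_square x y power2_sum)
qed (use x y in simp)

lemma N2_minus: "x \<in> A \<Longrightarrow> y \<in> A \<Longrightarrow> N2 (y - x) = N2 (x - y)"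
  using N2_scaleR[of "x - y" "-1"] diff_mem[of x y] by simp

lemma N2_triangle_diff: "x \<in> A \<Longrightarrow> y \<in> A \<Longrightarrow> z \<in> A \<Longrightarrow> N2 (x - z) \<le> N2 (x - y) + N2 (y - z)"
  using N2_triangle[of "x - y" "y - z"] diff_mem[of x y] diff_mem[of y z] by simp

lemma N2_abs_diff: "x \<in> A \<Longrightarrow> y \<in> A \<Longrightarrow> \<bar>N2 x - N2 y\<bar> \<le> N2 (x - y)"
  using N2_triangle[of "x - y" y] N2_triangle[of "y - x" x] N2_minus[of x y]
  by (simp add: diff_mem abs_le_iff)

lemma phi_mono: "a \<in> A \<Longrightarrow> b \<in> A \<Longrightarrow> positive_op (b - a) \<Longrightarrow> Re (\<phi> a) \<le> Re (\<phi> b)"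
  using phi_positive[of "b - a"] diff_mem[of b a] by (simp add: phi_diff)

text \<open>Conjugating \<open>adj b \<cdot> b\<close> <= (norm b)^2 by x and taking traces gives
  the squared inequality.\<close>

lemma N2_mult_left:
  assumes b: "b \<in> A" and x: "x \<in> A"
  shows "N2 (b \<cdot> x) \<le> norm b * N2 x"
proof (rule power2_le_imp_le)
  have m: "adj b \<in> A" "adj x \<in> A" "adj b \<cdot> b \<in> A" "adj x \<cdot> x \<in> A"
    "adj x \<cdot> (adj b \<cdot> (b \<cdot> x)) \<in> A"
    using b x by blast+
  have "norm (adj b \<cdot> b) \<le> norm b * norm b"
    by (rule norm_compose_le[OF norm_adj_le[OF b] order_refl])
  then have p: "positive_op ((norm b * norm b) *\<^sub>R id_blinfun - adj b \<cdot> b)"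
    using positive_opD[OF positive_adj_compose[OF b]] by (intro positive_op_norm_diff) auto
  have "positive_op (adj x \<cdot> ((norm b * norm b) *\<^sub>R id_blinfun - adj b \<cdot> b) \<cdot> x)"
    using x m by (intro positive_op_conj[OF p] mem_BH is_adjoint_adj)
  then have "positive_op ((norm b * norm b) *\<^sub>R (adj x \<cdot> x) - adj x \<cdot> (adj b \<cdot> (b \<cdot> x)))"
    by (simp add: op_simps)
  from phi_mono[OF _ _ this] m have "Re (\<phi> (adj x \<cdot> (adj b \<cdot> (b \<cdot> x)))) \<le> (norm b * norm b) * (N2 x)\<^sup>2"
    by (simp add: scaleR_mem phi_scaleR N2_square x)
  then show "(N2 (b \<cdot> x))\<^sup>2 \<le> (norm b * N2 x)\<^sup>2"
    using b x m by (simp add: N2_square[OF comp_mem] adj_compose op_simps power_mult_distrib power2_eq_square[of "norm b"])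
qed (use x in simp)

lemma N2_mult_right:
  assumes b: "b \<in> A" and x: "x \<in> A"
  shows "N2 (x \<cdot> b) \<le> N2 x * norm b"
proof -
  have "N2 (x \<cdot> b) = N2 (adj b \<cdot> adj x)"
    using N2_adj[of "x \<cdot> b"] b x by (simp add: adj_compose comp_mem)
  also have "\<dots> \<le> norm (adj b) * N2 (adj x)"
    using b x by (intro N2_mult_left adj_mem)
  also have "\<dots> \<le> norm b * N2 x"
    using norm_adj_le[OF b] x by (simp add: mult_right_mono)
  finally show ?thesis by (simp add: mult.commute)
qed

lemma N2_id [simp]: "N2 id_blinfun = 1"
  by (simp add: N2_eq_sqrt)

lemma N2_le_norm: "x \<in> A \<Longrightarrow> N2 x \<le> norm x"
  using N2_mult_left[of x id_blinfun] by simp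

lemma phi_le_N2: "x \<in> A \<Longrightarrow> cmod (\<phi> x) \<le> N2 x"
  using phi_cauchy_schwarz[of id_blinfun x] by simp

lemma phi_le_norm: "x \<in> A \<Longrightarrow> cmod (\<phi> x) \<le> norm x"
  using phi_le_N2[of x] N2_le_norm[of x] by simp

text \<open>The exact polar part of x need not lie in a norm-closed algebra; w = x (e + |x|)^(-1)
  does. With c = (1 + |x| / e)^(-1), the two errors are -e (1 - c) and e w, both of norm at most
  e.\<close>

lemma approximate_polar_decomposition:
  assumes x: "x \<in> A" and e: "0 < e"
  obtains w where "w \<in> A" "norm w \<le> 1" "norm (adj w \<cdot> x - op_abs x) \<le> e" "norm (x - w \<cdot> op_abs x) \<le> e"
proof -
  define p where "p = op_abs x"
  note p = op_abs[OF x, folded p_def]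
  define q where "q = (1 / e) *\<^sub>R p"
  have q: "q \<in> A" "positive_op q"
    unfolding q_def using p e by (simp_all add: scaleR_mem positive_op_scaleR)
  obtain c where c: "c \<in> A" "positive_op c" "c + q \<cdot> c = id_blinfun" "c + c \<cdot> q = id_blinfun" "norm c \<le> 1"
    by (rule inverse_id_add_positive[OF q])
  have qc: "q \<cdot> c = id_blinfun - c" "c \<cdot> q = id_blinfun - c"
    using c(3,4) by (simp_all add: eq_diff_eq add.commute)
  have n1: "norm (id_blinfun - c) \<le> 1"
    using c by (intro norm_id_diff_positive)
  define w where "w = (1 / e) *\<^sub>R (x \<cdot> c)"
  have w: "w \<in> A" unfolding w_def using x c by blast
  have nw: "norm w \<le> 1"
  proof (rule norm_blinfun_bound)
    fix v
    let ?u = "c v"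
    have "x ?u \<bullet> x ?u = ?u \<bullet> blinfun_apply (adj x \<cdot> x) ?u"
      using is_adjointD[OF is_adjoint_adj[OF x]] by simp
    also have "\<dots> = p ?u \<bullet> p ?u"
      unfolding p(3)[symmetric] using is_adjointD[OF positive_opD(2)[OF p(2)]] by simp
    finally have "norm (x ?u) = norm (p ?u)"
      by (simp add: norm_eq_sqrt_inner)
    then have "norm (w v) = norm (blinfun_apply (q \<cdot> c) v)"
      by (simp add: w_def q_def blinfun.scaleR_left)
    also have "\<dots> \<le> 1 * norm v"
      unfolding qc using norm_blinfun[of "id_blinfun - c" v] n1
      by (meson mult_right_mono norm_ge_zero order_trans)
    finally show "norm (w v) \<le> 1 * norm v" .
  qed simp
  show ?thesis
  proof (rule that[OF w nw, folded p_def])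
    have "adj w \<cdot> x = c \<cdot> q \<cdot> p"
      using x c p by (simp add: w_def q_def adj_scaleR adj_compose comp_mem op_simps adj_positive)
    then have "adj w \<cdot> x - p = - (c \<cdot> p)"
      unfolding qc by (simp add: op_simps)
    also have "c \<cdot> p = e *\<^sub>R (c \<cdot> q)"
      using e by (simp add: q_def op_simps)
    finally show "norm (adj w \<cdot> x - p) \<le> e"
      using n1 e by (simp add: qc mult_left_le)
    have "w \<cdot> p = x \<cdot> (c \<cdot> q)"
      by (simp add: w_def q_def op_simps)
    then have "x - w \<cdot> p = e *\<^sub>R w"
      unfolding qc using e by (simp add: w_def op_simps)
    then show "norm (x - w \<cdot> p) \<le> e"
      using nw e by (simp add: mult_left_le)
  qed
qed

text \<open>Split p as r^2 and apply Cauchy-Schwarz to b r and r: both 2-norms are at most the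
  2-norm of r, whose square is the trace of p.\<close>

lemma phi_compose_positive_le:
  assumes p: "p \<in> A" "positive_op p" and b: "b \<in> A" "norm b \<le> 1"
  shows "cmod (\<phi> (b \<cdot> p)) \<le> Re (\<phi> p)"
proof -
  obtain r where r: "r \<in> A" "positive_op r" "r \<cdot> r = p" "\<forall>d. p \<cdot> d = d \<cdot> p \<longrightarrow> r \<cdot> d = d \<cdot> r"
    by (rule positive_sqrt[OF p])
  have "cmod (\<phi> (b \<cdot> p)) = cmod (\<phi> ((b \<cdot> r) \<cdot> r))"
    by (simp add: op_simps r(3))
  also have "\<dots> \<le> N2 (b \<cdot> r) * N2 r"
    by (intro phi_cauchy_schwarz comp_mem b r)
  also have "\<dots> \<le> N2 r * N2 r"
  proof (intro mult_right_mono N2_nonneg r)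
    have "norm b * N2 r \<le> N2 r" using b r(1) by (simp add: mult_left_le_one_le)
    then show "N2 (b \<cdot> r) \<le> N2 r" using N2_mult_left[OF b(1) r(1)] by linarith
  qed
  also have "\<dots> = Re (\<phi> p)"
    using N2_square[OF r(1)] r(2,3) by (simp add: adj_positive power2_eq_square)
  finally show ?thesis .
qed

text \<open>One half of trace-norm duality: x is replaced, up to e, by w |x|, and u w is again a
  contraction.\<close>

lemma phi_compose_le_N1:
  assumes x: "x \<in> A" and u: "u \<in> A" "norm u \<le> 1"
  shows "cmod (\<phi> (u \<cdot> x)) \<le> N1 x"
proof (rule field_le_epsilon)
  fix e :: real assume e: "0 < e"
  obtain w where w: "w \<in> A" "norm w \<le> 1" "norm (x - w \<cdot> op_abs x) \<le> e"
    using approximate_polar_decomposition[OF x e] by blast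
  note p = op_abs[OF x]
  have m: "u \<cdot> w \<in> A" "u \<cdot> w \<cdot> op_abs x \<in> A" "u \<cdot> (x - w \<cdot> op_abs x) \<in> A"
    using u w x p(1) by blast+
  have "u \<cdot> x = u \<cdot> w \<cdot> op_abs x + u \<cdot> (x - w \<cdot> op_abs x)"
    by (simp add: op_simps)
  then have "\<phi> (u \<cdot> x) = \<phi> (u \<cdot> w \<cdot> op_abs x) + \<phi> (u \<cdot> (x - w \<cdot> op_abs x))"
    using phi_add[OF m(2,3)] by simp
  then have "cmod (\<phi> (u \<cdot> x)) \<le> cmod (\<phi> (u \<cdot> w \<cdot> op_abs x)) + cmod (\<phi> (u \<cdot> (x - w \<cdot> op_abs x)))"
    using norm_triangle_ineq by simp
  also have "cmod (\<phi> (u \<cdot> w \<cdot> op_abs x)) \<le> N1 x"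
    unfolding pnorm_1 using u w p m by (intro phi_compose_positive_le norm_compose_le1)
  also have "cmod (\<phi> (u \<cdot> (x - w \<cdot> op_abs x))) \<le> e"
    using phi_le_norm[OF m(3)] norm_compose_le[OF u(2) w(3)] by simp
  finally show "cmod (\<phi> (u \<cdot> x)) \<le> N1 x + e" by simp
qed

text \<open>The other half of duality: u = \<open>adj w\<close> nearly attains the 1-norm. The
  triangle inequality and the ideal property of the 1-norm follow from the two halves.\<close>

lemma N1_leI:
  assumes x: "x \<in> A" and r: "\<And>u. u \<in> A \<Longrightarrow> norm u \<le> 1 \<Longrightarrow> cmod (\<phi> (u \<cdot> x)) \<le> r"
  shows "N1 x \<le> r"
proof (rule field_le_epsilon)
  fix e :: real assume e: "0 < e"
  obtain w where w: "w \<in> A" "norm w \<le> 1" "norm (adj w \<cdot> x - op_abs x) \<le> e"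
    using approximate_polar_decomposition[OF x e] by blast
  have m: "adj w \<in> A" "adj w \<cdot> x \<in> A" "adj w \<cdot> x - op_abs x \<in> A"
    using w x op_abs(1)[OF x] by blast+
  have "\<phi> (op_abs x) = \<phi> (adj w \<cdot> x) - \<phi> (adj w \<cdot> x - op_abs x)"
    using m op_abs(1)[OF x] by (simp add: phi_diff)
  then have "N1 x \<le> cmod (\<phi> (adj w \<cdot> x)) + cmod (\<phi> (adj w \<cdot> x - op_abs x))"
    unfolding pnorm_1 by (metis complex_Re_le_cmod norm_triangle_ineq4 order_trans)
  also have "cmod (\<phi> (adj w \<cdot> x)) \<le> r"
    using r[OF m(1)] norm_adj_le[OF w(1)] w(2) by linarith
  also have "cmod (\<phi> (adj w \<cdot> x - op_abs x)) \<le> e"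
    using phi_le_norm[OF m(3)] w(3) by linarith
  finally show "N1 x \<le> r + e" by simp
qed

lemma N1_nonneg [simp]: "x \<in> A \<Longrightarrow> 0 \<le> N1 x"
  using phi_positive[OF op_abs(1,2), of x] by (simp add: pnorm_1)

lemma phi_compose_le_N1':
  assumes x: "x \<in> A" and u: "u \<in> A" "norm u \<le> k"
  shows "cmod (\<phi> (u \<cdot> x)) \<le> k * N1 x"
proof (cases "k \<le> 0")
  case True
  with u have "u = 0" by (metis norm_le_zero_iff order_trans)
  moreover have "k = 0" using True u \<open>u = 0\<close> by simp
  ultimately show ?thesis by simp
next
  case False
  have "cmod (\<phi> (((1 / k) *\<^sub>R u) \<cdot> x)) \<le> N1 x"
    using False u by (intro phi_compose_le_N1 x scaleR_mem) simp_all
  moreover have "\<phi> (((1 / k) *\<^sub>R u) \<cdot> x) = complex_of_real (1 / k) * \<phi> (u \<cdot> x)"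
    using u x by (simp only: op_simps phi_scaleR comp_mem)
  ultimately show ?thesis
    using False by (simp add: norm_mult norm_divide field_simps)
qed

lemma phi_le_N1: "x \<in> A \<Longrightarrow> cmod (\<phi> x) \<le> N1 x"
  using phi_compose_le_N1'[of x id_blinfun 1] norm_blinfun_id_le by simp

lemma N1_triangle:
  assumes x: "x \<in> A" and y: "y \<in> A"
  shows "N1 (x + y) \<le> N1 x + N1 y"
proof (rule N1_leI)
  fix u assume u: "u \<in> A" "norm u \<le> 1"
  have "cmod (\<phi> (u \<cdot> (x + y))) \<le> cmod (\<phi> (u \<cdot> x)) + cmod (\<phi> (u \<cdot> y))"
    using u x y norm_triangle_ineq by (simp add: op_simps phi_add comp_mem)
  then show "cmod (\<phi> (u \<cdot> (x + y))) \<le> N1 x + N1 y"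
    using phi_compose_le_N1[OF x u] phi_compose_le_N1[OF y u] by linarith
qed (use x y in blast)

lemma N1_mult_left:
  assumes b: "b \<in> A" "norm b \<le> k" and x: "x \<in> A"
  shows "N1 (b \<cdot> x) \<le> k * N1 x"
proof (rule N1_leI)
  fix u assume u: "u \<in> A" "norm u \<le> 1"
  show "cmod (\<phi> (u \<cdot> (b \<cdot> x))) \<le> k * N1 x"
    using phi_compose_le_N1'[OF x comp_mem[OF u(1) b(1)] norm_compose_le[OF u(2) b(2)]]
    by (simp add: op_simps)
qed (use b x in blast)

lemma N1_adj_le: assumes x: "x \<in> A" shows "N1 (adj x) \<le> N1 x"
proof (rule N1_leI)
  fix u assume u: "u \<in> A" "norm u \<le> 1"
  have "\<phi> (u \<cdot> adj x) = \<phi> (adj x \<cdot> u)"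
    using u x by (intro phi_commute adj_mem)
  also have "adj x \<cdot> u = adj (adj u \<cdot> x)"
    using u x by (simp add: adj_compose adj_mem)
  also have "\<phi> \<dots> = cnj (\<phi> (adj u \<cdot> x))"
    using u x by (intro phi_adj comp_mem adj_mem)
  finally have "cmod (\<phi> (u \<cdot> adj x)) = cmod (\<phi> (adj u \<cdot> x))" by simp
  then show "cmod (\<phi> (u \<cdot> adj x)) \<le> N1 x"
    using phi_compose_le_N1[OF x adj_mem[OF u(1)]] norm_adj_le[OF u(1)] u(2) by simp
qed (use x in blast)

lemma N1_adj [simp]: "x \<in> A \<Longrightarrow> N1 (adj x) = N1 x"
  using N1_adj_le[of x] N1_adj_le[of "adj x"] by (simp add: adj_mem)

lemma N1_mult_right:
  assumes b: "b \<in> A" "norm b \<le> k" and x: "x \<in> A"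
  shows "N1 (x \<cdot> b) \<le> k * N1 x"
proof -
  have "N1 (x \<cdot> b) = N1 (adj b \<cdot> adj x)"
    using N1_adj[of "x \<cdot> b"] b x by (simp add: adj_compose comp_mem)
  also have "\<dots> \<le> k * N1 (adj x)"
    using b x norm_adj_le[OF b(1)] by (intro N1_mult_left adj_mem) auto
  finally show ?thesis using x by simp
qed

lemma N1_mult_both:
  assumes b: "b \<in> A" "norm b \<le> k" and c: "c \<in> A" "norm c \<le> l" and x: "x \<in> A"
  shows "N1 (b \<cdot> x \<cdot> c) \<le> k * l * N1 x"
proof -
  have "N1 (b \<cdot> x \<cdot> c) \<le> l * N1 (b \<cdot> x)"
    by (intro N1_mult_right comp_mem b c x)
  also have "\<dots> \<le> l * (k * N1 x)"
    using order_trans[OF norm_ge_zero c(2)] by (intro mult_left_mono N1_mult_left b x)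
  finally show ?thesis by (simp add: mult_ac)
qed

lemma N1_scaleR_le: assumes "x \<in> A" shows "N1 (r *\<^sub>R x) \<le> \<bar>r\<bar> * N1 x"
proof -
  have "norm (r *\<^sub>R (id_blinfun :: 'h bop)) \<le> \<bar>r\<bar>"
    using norm_blinfun_id_le[where ?'a='h] by (simp add: mult_left_le)
  then show ?thesis
    using N1_mult_left[of "r *\<^sub>R id_blinfun" "\<bar>r\<bar>" x] assms by (simp add: op_simps scaleR_mem)
qed

lemma N1_minus: "x \<in> A \<Longrightarrow> y \<in> A \<Longrightarrow> N1 (y - x) = N1 (x - y)"
  using N1_scaleR_le[of "x - y" "-1"] N1_scaleR_le[of "y - x" "-1"] by (simp add: diff_mem)

lemma N1_triangle_diff: "x \<in> A \<Longrightarrow> y \<in> A \<Longrightarrow> z \<in> A \<Longrightarrow> N1 (x - z) \<le> N1 (x - y) + N1 (y - z)"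
  using N1_triangle[of "x - y" "y - z"] diff_mem[of x y] diff_mem[of y z] by simp

lemma N1_triangle_minus: "x \<in> A \<Longrightarrow> y \<in> A \<Longrightarrow> N1 (x - y) \<le> N1 x + N1 y"
  using N1_triangle[of x "(-1) *\<^sub>R y"] N1_scaleR_le[of y "-1"] uminus_mem[of y] by simp

text \<open>Duality reduces this case of Hoelder's inequality to Cauchy-Schwarz for u x and
  y.\<close>

lemma N1_mult_le: 
  assumes x: "x \<in> A" and y: "y \<in> A"
  shows "N1 (x \<cdot> y) \<le> N2 x * N2 y"
proof (rule N1_leI)
  fix u assume u: "u \<in> A" "norm u \<le> 1"
  have "cmod (\<phi> ((u \<cdot> x) \<cdot> y)) \<le> N2 (u \<cdot> x) * N2 y"
    using u x y by (intro phi_cauchy_schwarz comp_mem)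
  also have "N2 (u \<cdot> x) \<le> 1 * N2 x"
    using N2_mult_left[OF u(1) x] u(2) N2_nonneg[OF x] by (meson mult_right_mono order_trans)
  finally show "cmod (\<phi> (u \<cdot> (x \<cdot> y))) \<le> N2 x * N2 y"
    using y by (simp add: op_simps mult_right_mono)
qed (use x y in blast)

lemma N1_le_N2: "x \<in> A \<Longrightarrow> N1 x \<le> N2 x"
  using N1_mult_le[of id_blinfun x] by simp

text \<open>Interpolation: on norm-bounded sets, smallness in the 1-norm gives smallness in the
  2-norm.\<close>

lemma N2_square_le: "x \<in> A \<Longrightarrow> norm x \<le> k \<Longrightarrow> (N2 x)\<^sup>2 \<le> k * N1 x"
proof -
  assume x: "x \<in> A" "norm x \<le> k"
  have "(N2 x)\<^sup>2 \<le> cmod (\<phi> (adj x \<cdot> x))"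
    using N2_square[OF x(1)] complex_Re_le_cmod by simp
  also have "\<dots> \<le> k * N1 x"
    using x norm_adj_le[OF x(1)] by (intro phi_compose_le_N1' adj_mem) auto
  finally show ?thesis .
qed

lemma N1_zero [simp]: "N1 0 = 0"
  using N1_scaleR_le[OF zero_mem, of 0] N1_nonneg[OF zero_mem] by (simp del: N1_nonneg)

lemma N2_zero [simp]: "N2 0 = 0"
  by (simp add: N2_eq_sqrt)

end

section \<open>Cauchy sequences for the trace norms\<close>

text \<open>For estimates in which an approximation chosen at precision e leaves e plus a null
  sequence; the null sequence may depend on e.\<close>

lemma LIMSEQ_null_leI:
  fixes f :: "nat \<Rightarrow> real"
  assumes "\<And>n. 0 \<le> f n"
    and "\<And>e. 0 < e \<Longrightarrow> \<exists>g. g \<longlonglongrightarrow> 0 \<and> eventually (\<lambda>n. f n \<le> e + g n) sequentially"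
  shows "f \<longlonglongrightarrow> 0"
proof (rule tendstoI)
  fix e :: real assume "0 < e"
  then obtain g where g: "g \<longlonglongrightarrow> 0" "eventually (\<lambda>n. f n \<le> e / 2 + g n) sequentially"
    using assms(2)[of "e / 2"] by auto
  have "eventually (\<lambda>n. dist (g n) 0 < e / 2) sequentially"
    using \<open>0 < e\<close> by (intro tendstoD[OF g(1)]) simp
  with g(2) show "eventually (\<lambda>n. dist (f n) 0 < e) sequentially"
  proof eventually_elim
    case (elim n)
    then show ?case using assms(1)[of n] by (simp add: dist_real_def abs_if split: if_splits)
  qed
qed

lemma LIMSEQ_null_le:
  fixes f g :: "nat \<Rightarrow> real"
  assumes "\<And>n. 0 \<le> f n" "\<And>n. f n \<le> g n" "g \<longlonglongrightarrow> 0"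
  shows "f \<longlonglongrightarrow> 0"
  by (rule tendsto_sandwich[OF _ _ tendsto_const assms(3)]) (use assms in auto)

lemma Lp_cauchy_mem: "xs \<in> Lp_cauchy A \<phi> p \<Longrightarrow> xs n \<in> A"
  by (auto simp: Lp_cauchy_def)

lemma Lp_cauchyD:
  assumes "xs \<in> Lp_cauchy A \<phi> p" "0 < e"
  obtains K where "\<And>m n. K \<le> m \<Longrightarrow> K \<le> n \<Longrightarrow> pnorm \<phi> p (xs m - xs n) < e"
proof -
  have "\<exists>K. \<forall>m\<ge>K. \<forall>n\<ge>K. pnorm \<phi> p (xs m - xs n) < e"
    using assms by (simp add: Lp_cauchy_def)
  then show ?thesis using that by blast
qed

lemma Lp_cauchyI:
  assumes "\<And>n. xs n \<in> A" "\<And>e. 0 < e \<Longrightarrow> \<exists>K. \<forall>m\<ge>K. \<forall>n\<ge>K. pnorm \<phi> p (xs m - xs n) < e"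
  shows "xs \<in> Lp_cauchy A \<phi> p"
  using assms by (auto simp: Lp_cauchy_def)

text \<open>The dominating sequences may live in another algebra and have different exponents, so
  sums, products and Lipschitz maps are all covered; for one dominating sequence it is supplied
  twice.\<close>

lemma Lp_cauchy_dominated:
  assumes "\<And>n. xs n \<in> A" "ys \<in> Lp_cauchy B \<psi> q" "zs \<in> Lp_cauchy B \<psi> r" "0 \<le> k"
    and le: "\<And>m n. pnorm \<phi> p (xs m - xs n) \<le> k * (pnorm \<psi> q (ys m - ys n) + pnorm \<psi> r (zs m - zs n))"
  shows "xs \<in> Lp_cauchy A \<phi> p"
proof (rule Lp_cauchyI)
  fix e :: real assume e: "0 < e"
  \<comment> \<open>The 2 is for the two summands; k + 1 avoids a division by zero when k =
    0.\<close>
  define e' where "e' = e / (2 * (k + 1))"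
  have e': "0 < e'" using e assms(4) by (simp add: e'_def)
  obtain K where K: "\<And>m n. K \<le> m \<Longrightarrow> K \<le> n \<Longrightarrow> pnorm \<psi> q (ys m - ys n) < e'"
    using Lp_cauchyD[OF assms(2) e'] by blast
  obtain L where L: "\<And>m n. L \<le> m \<Longrightarrow> L \<le> n \<Longrightarrow> pnorm \<psi> r (zs m - zs n) < e'"
    using Lp_cauchyD[OF assms(3) e'] by blast
  have "pnorm \<phi> p (xs m - xs n) < e" if "max K L \<le> m" "max K L \<le> n" for m n
  proof -
    have "pnorm \<phi> p (xs m - xs n) \<le> k * (pnorm \<psi> q (ys m - ys n) + pnorm \<psi> r (zs m - zs n))"
      by (rule le)
    also have "\<dots> \<le> k * (e' + e')"
      using that K[of m n] L[of m n] assms(4) by (intro mult_left_mono add_mono) auto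
    also have "\<dots> < (k + 1) * (e' + e')"
      using e' by simp
    also have "\<dots> = e"
    proof -
      have "2 * (k + 1) \<noteq> 0" using assms(4) by simp
      then have "(2 * (k + 1)) * e' = e" unfolding e'_def by simp
      then show ?thesis by (simp add: algebra_simps)
    qed
    finally show ?thesis .
  qed
  then show "\<exists>K. \<forall>m\<ge>K. \<forall>n\<ge>K. pnorm \<phi> p (xs m - xs n) < e" by blast
qed (rule assms(1))

lemma Lp_cauchy_convergent:
  fixes f :: "'h::complex_hilbert bop \<Rightarrow> 'b::complete_space"
  assumes xs: "xs \<in> Lp_cauchy A \<phi> p"
    and lip: "\<And>x y. x \<in> A \<Longrightarrow> y \<in> A \<Longrightarrow> dist (f x) (f y) \<le> pnorm \<phi> p (x - y)"
  obtains t where "(\<lambda>n. f (xs n)) \<longlonglongrightarrow> t"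
proof -
  note m = xs[THEN Lp_cauchy_mem]
  have "Cauchy (\<lambda>n. f (xs n))"
  proof (rule metric_CauchyI)
    fix e :: real assume "0 < e"
    then obtain K where K: "\<And>m n. K \<le> m \<Longrightarrow> K \<le> n \<Longrightarrow> pnorm \<phi> p (xs m - xs n) < e"
      using Lp_cauchyD[OF xs] by blast
    have "dist (f (xs i)) (f (xs j)) < e" if "K \<le> i" "K \<le> j" for i j
      by (rule le_less_trans[OF lip[OF m m] K[OF that]])
    then show "\<exists>K. \<forall>m\<ge>K. \<forall>n\<ge>K. dist (f (xs m)) (f (xs n)) < e" by blast
  qed
  then show ?thesis using that by (auto simp: Cauchy_convergent_iff convergent_def)
qed

context tracial_algebra
begin

abbreviation C1 where "C1 \<equiv> Lp_cauchy A \<phi> (Suc 0)"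
abbreviation C2 where "C2 \<equiv> Lp_cauchy A \<phi> 2"

section \<open>Arithmetic of Cauchy sequences\<close>

lemma C1_const: "x \<in> A \<Longrightarrow> (\<lambda>n. x) \<in> C1"
  by (rule Lp_cauchyI) auto

lemma C2_const: "x \<in> A \<Longrightarrow> (\<lambda>n. x) \<in> C2"
  by (rule Lp_cauchyI) auto

lemma C1_add:
  assumes "xs \<in> C1" "ys \<in> C1" shows "(\<lambda>n. xs n + ys n) \<in> C1"
proof (rule Lp_cauchy_dominated[OF _ assms, where k = 1])
  note m = assms[THEN Lp_cauchy_mem]
  show "N1 (xs m + ys m - (xs n + ys n)) \<le> 1 * (N1 (xs m - xs n) + N1 (ys m - ys n))" for m n
    using N1_triangle[of "xs m - xs n" "ys m - ys n"] m by (simp add: diff_mem algebra_simps)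
qed (use assms[THEN Lp_cauchy_mem] in auto)

lemma C1_diff:
  assumes "xs \<in> C1" "ys \<in> C1" shows "(\<lambda>n. xs n - ys n) \<in> C1"
proof (rule Lp_cauchy_dominated[OF _ assms, where k = 1])
  note m = assms[THEN Lp_cauchy_mem]
  show "N1 (xs m - ys m - (xs n - ys n)) \<le> 1 * (N1 (xs m - xs n) + N1 (ys m - ys n))" for m n
    using N1_triangle_minus[of "xs m - xs n" "ys m - ys n"] m by (simp add: diff_mem algebra_simps)
qed (use assms[THEN Lp_cauchy_mem] in auto)

lemma C2_diff:
  assumes "xs \<in> C2" "ys \<in> C2" shows "(\<lambda>n. xs n - ys n) \<in> C2"
proof (rule Lp_cauchy_dominated[OF _ assms, where k = 1])
  note m = assms[THEN Lp_cauchy_mem]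
  show "N2 (xs m - ys m - (xs n - ys n)) \<le> 1 * (N2 (xs m - xs n) + N2 (ys m - ys n))" for m n
    using N2_triangle_diff[of "xs m - xs n" 0 "ys m - ys n"] m N2_minus[of "ys m - ys n" 0]
    by (simp add: diff_mem algebra_simps)
qed (use assms[THEN Lp_cauchy_mem] in auto)

lemma C1_adj:
  assumes "xs \<in> C1" shows "(\<lambda>n. adj (xs n)) \<in> C1"
proof (rule Lp_cauchy_dominated[OF _ assms assms, where k = 1])
  note m = assms[THEN Lp_cauchy_mem]
  show "N1 (adj (xs m) - adj (xs n)) \<le> 1 * (N1 (xs m - xs n) + N1 (xs m - xs n))" for m n
    using m N1_nonneg[of "xs m - xs n"] by (simp add: diff_mem flip: adj_diff)
qed (use assms[THEN Lp_cauchy_mem] in auto)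

lemma C2_subset_C1:
  assumes "xs \<in> C2" shows "xs \<in> C1"
proof (rule Lp_cauchy_dominated[OF _ assms assms, where k = 1])
  note m = assms[THEN Lp_cauchy_mem]
  show "N1 (xs m - xs n) \<le> 1 * (N2 (xs m - xs n) + N2 (xs m - xs n))" for m n
    using N1_le_N2[OF diff_mem[OF m m], of m n] N2_nonneg[OF diff_mem[OF m m], of m n]
    unfolding mult_1 by (rule add_increasing[rotated])
qed (use assms[THEN Lp_cauchy_mem] in auto)

lemma C1_null_equiv:
  assumes x: "x \<in> C1" and y: "\<And>n. y n \<in> A" and null: "(\<lambda>n. N1 (x n - y n)) \<longlonglongrightarrow> 0"
  shows "y \<in> C1"
proof (rule Lp_cauchyI)
  fix e :: real assume e: "0 < e"
  obtain K where K: "\<And>m n. K \<le> m \<Longrightarrow> K \<le> n \<Longrightarrow> N1 (x m - x n) < e / 3"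
    using Lp_cauchyD[OF x, of "e / 3"] e by auto
  obtain L where L: "\<And>n. L \<le> n \<Longrightarrow> N1 (x n - y n) < e / 3"
    using LIMSEQ_D[OF null, of "e / 3"] e y Lp_cauchy_mem[OF x] by (force simp: diff_mem)
  have "N1 (y m - y n) < e" if "max K L \<le> m" "max K L \<le> n" for m n
    using N1_triangle_diff[of "y m" "x m" "y n"] N1_triangle_diff[of "x m" "x n" "y n"]
      N1_minus[of "x m" "y m"] K[of m n] L[of m] L[of n] that y Lp_cauchy_mem[OF x] by auto
  then show "\<exists>K. \<forall>m\<ge>K. \<forall>n\<ge>K. N1 (y m - y n) < e" by blast
qed (rule y)

lemma Lp_cauchy_bounded:
  assumes x: "x \<in> Lp_cauchy A \<phi> p"
    and nonneg: "\<And>a. a \<in> A \<Longrightarrow> 0 \<le> pnorm \<phi> p a"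
    and triangle: "\<And>a b. a \<in> A \<Longrightarrow> b \<in> A \<Longrightarrow> pnorm \<phi> p (a + b) \<le> pnorm \<phi> p a + pnorm \<phi> p b"
  obtains K where "0 \<le> K" "\<And>n. pnorm \<phi> p (x n) \<le> K"
proof -
  note m = Lp_cauchy_mem[OF x]
  obtain L where L: "\<And>m n. L \<le> m \<Longrightarrow> L \<le> n \<Longrightarrow> pnorm \<phi> p (x m - x n) < 1"
    using Lp_cauchyD[OF x zero_less_one] by blast
  define K where "K = (\<Sum>i\<le>L. pnorm \<phi> p (x i)) + 1"
  have s: "pnorm \<phi> p (x i) \<le> (\<Sum>i\<le>L. pnorm \<phi> p (x i))" if "i \<le> L" for i
    using that m by (intro member_le_sum nonneg) auto
  have "pnorm \<phi> p (x n) \<le> K" for n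
  proof (cases "n \<le> L")
    case True
    then show ?thesis using s[of n] by (simp add: K_def)
  next
    case False
    then show ?thesis
      using triangle[of "x n - x L" "x L"] m L[of n L] s[of L] by (simp add: K_def diff_mem)
  qed
  moreover have "0 \<le> K" using m by (simp add: K_def sum_nonneg add_nonneg_nonneg nonneg)
  ultimately show ?thesis using that by blast
qed

lemmas C1_bounded = Lp_cauchy_bounded[OF _ N1_nonneg N1_triangle]
lemmas C2_bounded = Lp_cauchy_bounded[OF _ N2_nonneg N2_triangle]

text \<open>The difference s m - s n is small only in the 1-norm, so it cannot be multiplied
  directly by x n. Subtracting the fixed bounded operator x L leaves a factor x n - x L that is
  small against the norm bound of s, and a term (s m - s n) x L that is small because x L is
  bounded.\<close>

lemma C1_mult_bounded_left:
  assumes s: "s \<in> C1" "\<And>n. norm (s n) \<le> k" and x: "x \<in> C1"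
  shows "(\<lambda>n. s n \<cdot> x n) \<in> C1"
proof (rule Lp_cauchyI)
  note m = s(1)[THEN Lp_cauchy_mem] x[THEN Lp_cauchy_mem]
  show "s n \<cdot> x n \<in> A" for n using m by blast
  have k: "0 \<le> k" using s(2)[of 0] norm_ge_zero order_trans by blast
  fix e :: real assume e: "0 < e"
  \<comment> \<open>Two terms use this bound, with factors k and 2 k, and together stay below e/2;
    the other half is for (s m - s n) x L.\<close>
  obtain L where L: "\<And>m n. L \<le> m \<Longrightarrow> L \<le> n \<Longrightarrow> N1 (x m - x n) < e / (6 * (k + 1))"
    using Lp_cauchyD[OF x, of "e / (6 * (k + 1))"] e k by auto
  obtain J where J: "\<And>m n. J \<le> m \<Longrightarrow> J \<le> n \<Longrightarrow> N1 (s m - s n) < e / (2 * (norm (x L) + 1))"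
    using Lp_cauchyD[OF s(1), of "e / (2 * (norm (x L) + 1))"] e by (auto simp: add_nonneg_pos)
  have "N1 (s m \<cdot> x m - s n \<cdot> x n) < e" if mn: "max J L \<le> m" "max J L \<le> n" for m n
  proof -
    have eq: "s m \<cdot> x m - s n \<cdot> x n
        = (s m \<cdot> (x m - x n) + (s m - s n) \<cdot> (x n - x L)) + (s m - s n) \<cdot> x L"
      by (simp add: op_simps)
    have mem: "s m \<cdot> (x m - x n) \<in> A" "(s m - s n) \<cdot> (x n - x L) \<in> A" "(s m - s n) \<cdot> x L \<in> A"
      using m by blast+
    have 1: "N1 (s m \<cdot> (x m - x n)) \<le> k * N1 (x m - x n)"
      using m s by (intro N1_mult_left) auto
    have "norm (s m - s n) \<le> 2 * k"
      using norm_triangle_ineq4[of "s m" "s n"] s(2)[of m] s(2)[of n] by linarith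
    then have 2: "N1 ((s m - s n) \<cdot> (x n - x L)) \<le> (2 * k) * N1 (x n - x L)"
      using m by (intro N1_mult_left) auto
    have 3: "N1 ((s m - s n) \<cdot> x L) \<le> norm (x L) * N1 (s m - s n)"
      using m by (intro N1_mult_right) auto
    have 4: "k * N1 (x m - x n) \<le> k * (e / (6 * (k + 1)))" "(2 * k) * N1 (x n - x L) \<le> (2 * k) * (e / (6 * (k + 1)))"
      "norm (x L) * N1 (s m - s n) \<le> norm (x L) * (e / (2 * (norm (x L) + 1)))"
      using mn k less_imp_le[OF L] less_imp_le[OF J] by (intro mult_left_mono; simp)+
    have 5: "k * (e / (6 * (k + 1))) + (2 * k) * (e / (6 * (k + 1))) < e / 2"
    proof -
      have "k * (e / (6 * (k + 1))) + (2 * k) * (e / (6 * (k + 1))) = (e / 2) * (k / (k + 1))"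
        using k by (simp add: divide_simps)
      also have "\<dots> < (e / 2) * 1"
        using k e by (intro mult_strict_left_mono) auto
      finally show ?thesis by simp
    qed
    have 6: "norm (x L) * (e / (2 * (norm (x L) + 1))) \<le> e / 2"
    proof -
      have "norm (x L) + 1 > 0" by (simp add: add_nonneg_pos)
      then show ?thesis using e by (simp add: field_simps)
    qed
    show ?thesis
      using N1_triangle[OF add_mem[OF mem(1,2)] mem(3)] N1_triangle[OF mem(1,2)] 1 2 3 4 5 6
      unfolding eq by linarith
  qed
  then show "\<exists>K. \<forall>m\<ge>K. \<forall>n\<ge>K. N1 (s m \<cdot> x m - s n \<cdot> x n) < e" by blast
qed

lemma C1_mult_bounded_right:
  assumes s: "s \<in> C1" "\<And>n. norm (s n) \<le> k" and x: "x \<in> C1"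
  shows "(\<lambda>n. x n \<cdot> s n) \<in> C1"
proof -
  note m = s(1)[THEN Lp_cauchy_mem] x[THEN Lp_cauchy_mem]
  have "(\<lambda>n. adj (adj (s n) \<cdot> adj (x n))) \<in> C1"
    by (intro C1_adj C1_mult_bounded_left[where k = k] s x order_trans[OF norm_adj_le] m)
  then show ?thesis using m by (simp add: adj_compose adj_mem)
qed

lemma C2_mult:
  assumes v: "v \<in> C2" and w: "w \<in> C2"
  shows "(\<lambda>n. v n \<cdot> w n) \<in> C1"
proof -
  note m = v[THEN Lp_cauchy_mem] w[THEN Lp_cauchy_mem]
  obtain K where K: "0 \<le> K" "\<And>n. N2 (v n) \<le> K" using C2_bounded[OF v] by blast
  obtain L where L: "0 \<le> L" "\<And>n. N2 (w n) \<le> L" using C2_bounded[OF w] by blast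
  show ?thesis
  proof (rule Lp_cauchy_dominated[OF _ v w, where k = "K + L"])
    show "N1 (v m \<cdot> w m - v n \<cdot> w n) \<le> (K + L) * (N2 (v m - v n) + N2 (w m - w n))" for m n
    proof -
      have eq: "v m \<cdot> w m - v n \<cdot> w n = (v m - v n) \<cdot> w m + v n \<cdot> (w m - w n)"
        by (simp add: op_simps)
      have d: "v m - v n \<in> A" "w m - w n \<in> A" using m by blast+
      have "N1 (v m \<cdot> w m - v n \<cdot> w n) \<le> N1 ((v m - v n) \<cdot> w m) + N1 (v n \<cdot> (w m - w n))"
        unfolding eq using m d by (intro N1_triangle comp_mem)
      also have "\<dots> \<le> N2 (v m - v n) * N2 (w m) + N2 (v n) * N2 (w m - w n)"
        using m d by (intro add_mono N1_mult_le)
      also have "\<dots> \<le> N2 (v m - v n) * (K + L) + (K + L) * N2 (w m - w n)"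
        using m d K L by (intro add_mono mult_left_mono mult_right_mono N2_nonneg) (auto intro: add_increasing add_increasing2)
      finally show ?thesis by (simp add: algebra_simps)
    qed
  qed (use m K L in auto)
qed

text \<open>This is injectivity of the map from L2 to L1, on which the well-definedness of
  \<open>Lp_norm\<close> rests. The squared 2-norm of u n is paired against u L, bounded and hence
  controlled by the 1-norm of u n, plus u n - u L, small in the 2-norm.\<close>

lemma C2_null:
  assumes u: "u \<in> C2" and null: "(\<lambda>n. N1 (u n)) \<longlonglongrightarrow> 0"
  shows "(\<lambda>n. N2 (u n)) \<longlonglongrightarrow> 0"
proof -
  note m = u[THEN Lp_cauchy_mem]
  obtain K where K: "0 \<le> K" "\<And>n. N2 (u n) \<le> K" using C2_bounded[OF u] by blast
  have "(\<lambda>n. (N2 (u n))\<^sup>2) \<longlonglongrightarrow> 0"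
  proof (rule LIMSEQ_null_leI)
    fix e :: real assume e: "0 < e"
    then have e': "0 < e / (K + 1)" using K(1) by simp
    obtain L where L: "\<And>m n. L \<le> m \<Longrightarrow> L \<le> n \<Longrightarrow> N2 (u m - u n) < e / (K + 1)"
      using Lp_cauchyD[OF u e'] by blast
    have "(N2 (u n))\<^sup>2 \<le> e + norm (u L) * N1 (u n)" if n: "L \<le> n" for n
    proof -
      have mem: "adj (u n) \<in> A" "adj (u L) \<in> A" "u n - u L \<in> A" "adj (u n) \<cdot> u L \<in> A"
        "adj (u n) \<cdot> (u n - u L) \<in> A" using m by blast+
      have "adj (u n) \<cdot> u n = adj (u n) \<cdot> u L + adj (u n) \<cdot> (u n - u L)"
        by (simp add: op_simps)
      then have "\<phi> (adj (u n) \<cdot> u n) = \<phi> (adj (u n) \<cdot> u L) + \<phi> (adj (u n) \<cdot> (u n - u L))"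
        using mem by (simp add: phi_add)
      then have "(N2 (u n))\<^sup>2 \<le> cmod (\<phi> (adj (u n) \<cdot> u L)) + cmod (\<phi> (adj (u n) \<cdot> (u n - u L)))"
        unfolding N2_square[OF m] using complex_Re_le_cmod norm_triangle_ineq order_trans by metis
      also have "cmod (\<phi> (adj (u n) \<cdot> u L)) \<le> norm (u L) * N1 (adj (u n))"
        unfolding phi_commute[OF mem(1) m] using mem m by (intro phi_compose_le_N1') auto
      also have "cmod (\<phi> (adj (u n) \<cdot> (u n - u L))) \<le> N2 (adj (u n)) * N2 (u n - u L)"
        using mem by (intro phi_cauchy_schwarz)
      also have "\<dots> \<le> K * (e / (K + 1))"
        using K less_imp_le[OF L[of n L]] n m mem by (intro mult_mono) auto
      also have "\<dots> \<le> e" using K e by (simp add: field_simps)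
      finally show ?thesis using m by simp
    qed
    moreover have "(\<lambda>n. norm (u L) * N1 (u n)) \<longlonglongrightarrow> 0"
      by (rule tendsto_mult_right_zero[OF null])
    ultimately show "\<exists>g. g \<longlonglongrightarrow> 0 \<and> eventually (\<lambda>n. (N2 (u n))\<^sup>2 \<le> e + g n) sequentially"
      unfolding eventually_sequentially by blast
  qed simp
  then have "(\<lambda>n. sqrt ((N2 (u n))\<^sup>2)) \<longlonglongrightarrow> sqrt 0" by (rule tendsto_real_sqrt)
  then show ?thesis using m by simp
qed

text \<open>Contractions that tend to the identity in \<open>L\<^sub>1\<close> act on a fixed bounded element, hence on an
  \<open>L\<^sub>1\<close>-Cauchy sequence, asymptotically like the identity. This replaces convergence in measure.\<close>

lemma C1_null_cutoff:
  assumes z: "z \<in> C1"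
    and c: "\<And>n. c n \<in> A" "\<And>n. norm (c n) \<le> 1" "(\<lambda>n. N1 (id_blinfun - c n)) \<longlonglongrightarrow> 0"
    and d: "\<And>n. d n \<in> A" "\<And>n. norm (d n) \<le> 1" "(\<lambda>n. N1 (id_blinfun - d n)) \<longlonglongrightarrow> 0"
    and null: "(\<lambda>n. N1 (d n \<cdot> z n \<cdot> c n)) \<longlonglongrightarrow> 0"
  shows "(\<lambda>n. N1 (z n)) \<longlonglongrightarrow> 0"
proof (rule LIMSEQ_null_leI)
  note m = z[THEN Lp_cauchy_mem]
  show "0 \<le> N1 (z n)" for n using m by simp
  fix e :: real assume e: "0 < e"
  obtain L where L: "\<And>m n. L \<le> m \<Longrightarrow> L \<le> n \<Longrightarrow> N1 (z m - z n) < e / 2"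
    using Lp_cauchyD[OF z, of "e / 2"] e by auto
  define g where "g n = N1 (d n \<cdot> z n \<cdot> c n)
    + norm (z L) * (N1 (id_blinfun - d n) + N1 (id_blinfun - c n))" for n
  have "g \<longlonglongrightarrow> 0 + norm (z L) * (0 + 0)"
    unfolding g_def by (intro tendsto_add tendsto_mult tendsto_const null c d)
  moreover have "N1 (z n) \<le> e + g n" if n: "L \<le> n" for n
  proof -
    let ?w = "z n - z L"
    have mem: "?w \<in> A" "d n \<cdot> ?w \<in> A" "d n \<cdot> ?w \<cdot> c n \<in> A" "d n \<cdot> z n \<cdot> c n \<in> A"
      "id_blinfun - d n \<in> A" "id_blinfun - c n \<in> A"
      "(id_blinfun - d n) \<cdot> z L \<in> A" "d n \<cdot> z L \<cdot> (id_blinfun - c n) \<in> A"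
      using m[of n] m[of L] c(1)[of n] d(1)[of n] by blast+
    \<comment> \<open>The defect of the cutoffs is computed separately on the small part
      \<open>?w\<close> and on the fixed bounded operator z L, where it telescopes.\<close>
    have eq: "z n = (d n \<cdot> z n \<cdot> c n + ?w) - d n \<cdot> ?w \<cdot> c n
        + ((id_blinfun - d n) \<cdot> z L + d n \<cdot> z L \<cdot> (id_blinfun - c n))"
      by (simp add: op_simps)
    have 1: "N1 (d n \<cdot> ?w \<cdot> c n) \<le> N1 ?w"
      using N1_mult_both[OF d(1,2) c(1,2) mem(1), of n n] by simp
    have 2: "N1 ((id_blinfun - d n) \<cdot> z L) \<le> norm (z L) * N1 (id_blinfun - d n)"
      using m mem by (intro N1_mult_right) auto
    have "norm (d n \<cdot> z L) \<le> norm (z L)"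
      using norm_compose_le[OF d(2)[of n] order_refl, of "z L"] by simp
    then have 3: "N1 (d n \<cdot> z L \<cdot> (id_blinfun - c n)) \<le> norm (z L) * N1 (id_blinfun - c n)"
      using m mem d(1) by (intro N1_mult_left comp_mem)
    have "N1 (z n) \<le> N1 (d n \<cdot> z n \<cdot> c n) + N1 ?w + N1 (d n \<cdot> ?w \<cdot> c n)
        + (N1 ((id_blinfun - d n) \<cdot> z L) + N1 (d n \<cdot> z L \<cdot> (id_blinfun - c n)))"
      by (subst eq) (intro order_trans[OF N1_triangle] order_trans[OF N1_triangle_minus]
          add_mono order_refl add_mem diff_mem mem)
    then show ?thesis
      using 1 2 3 L[of n L] n by (simp add: g_def algebra_simps)
  qed
  ultimately show "\<exists>g. g \<longlonglongrightarrow> 0 \<and> eventually (\<lambda>n. N1 (z n) \<le> e + g n) sequentially"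
    unfolding eventually_sequentially by auto
qed

text \<open>Here 1 - c = r \<open>adj (r *\<^sub>R (y \<cdot> c))\<close> y with a contraction in
  the middle. A smaller r brings c closer to 1 at the price of a worse bound 1/r on y c.\<close>

lemma cutoff_right:
  assumes y: "y \<in> A" and r: "0 < r"
  shows "\<exists>c\<in>A. norm c \<le> 1 \<and> norm (y \<cdot> c) \<le> 1 / r \<and> N1 (id_blinfun - c) \<le> r * N1 y"
proof -
  obtain c where c: "c \<in> A" "adj c = c" "norm c \<le> 1" "norm (r *\<^sub>R (y \<cdot> c)) \<le> 1"
    "id_blinfun - c = r\<^sup>2 *\<^sub>R (c \<cdot> adj y \<cdot> y)"
    using cutoff_op[OF y less_imp_le[OF r]] by metis
  have m: "r *\<^sub>R (y \<cdot> c) \<in> A" using y c by blast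
  have "adj (r *\<^sub>R (y \<cdot> c)) = r *\<^sub>R (c \<cdot> adj y)"
    using y c by (simp add: adj_scaleR adj_compose comp_mem)
  then have "id_blinfun - c = r *\<^sub>R (adj (r *\<^sub>R (y \<cdot> c)) \<cdot> y)"
    unfolding c(5) by (simp add: op_simps power2_eq_square)
  also have "N1 \<dots> \<le> \<bar>r\<bar> * N1 (adj (r *\<^sub>R (y \<cdot> c)) \<cdot> y)"
    using y m by (intro N1_scaleR_le comp_mem adj_mem)
  also have "\<dots> \<le> \<bar>r\<bar> * (1 * N1 y)"
    using y m c norm_adj_le[OF m] by (intro mult_left_mono N1_mult_left adj_mem) auto
  finally have "N1 (id_blinfun - c) \<le> r * N1 y" using r by simp
  moreover have "norm (y \<cdot> c) \<le> 1 / r" using c(4) r by (simp add: field_simps)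
  ultimately show ?thesis using c by blast
qed

lemma cutoff_left:
  assumes x: "x \<in> A" and r: "0 < r"
  shows "\<exists>d\<in>A. norm d \<le> 1 \<and> norm (d \<cdot> x) \<le> 1 / r \<and> N1 (id_blinfun - d) \<le> r * N1 x"
proof -
  obtain c where c: "c \<in> A" "norm c \<le> 1" "norm (adj x \<cdot> c) \<le> 1 / r" "N1 (id_blinfun - c) \<le> r * N1 (adj x)"
    using cutoff_right[OF adj_mem[OF x] r] by blast
  have "adj c \<cdot> x = adj (adj x \<cdot> c)" using x c by (simp add: adj_compose adj_mem)
  then have "norm (adj c \<cdot> x) \<le> 1 / r"
    using norm_adj_le[OF comp_mem[OF adj_mem[OF x] c(1)]] c(3) by simp
  moreover have "N1 (id_blinfun - adj c) \<le> r * N1 x"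
    using c(4) N1_adj[OF diff_mem[OF id_mem c(1)]] x c(1) by (simp add: adj_diff)
  moreover have "norm (adj c) \<le> 1" using norm_adj_le[OF c(1)] c(2) by linarith
  ultimately show ?thesis using c(1) by blast
qed

text \<open>Multiplying by d n on the left and c n on the right tames x' n and y n, the two factors
  that survive next to the differences in d (x - x') (y c) + (d x') (y - y') c; these are the
  factors whose 1-norms are assumed bounded. If s n is the total error, the result is at most s n /
  r n while the cutoffs are within r n K of 1. A rate r n of order sqrt (s n) makes both
  vanish.\<close>

lemma product_limit_unique:
  assumes x: "\<And>n. x n \<in> A" "\<And>n. x' n \<in> A" and y: "\<And>n. y n \<in> A" "\<And>n. y' n \<in> A"
    and yK: "\<And>n. N1 (y n) \<le> K" and xK: "\<And>n. N1 (x' n) \<le> K"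
    and xx: "(\<lambda>n. N1 (x n - x' n)) \<longlonglongrightarrow> 0" and yy: "(\<lambda>n. N1 (y n - y' n)) \<longlonglongrightarrow> 0"
    and z: "(\<lambda>n. x n \<cdot> y n - x' n \<cdot> y' n) \<in> C1"
  shows "(\<lambda>n. N1 (x n \<cdot> y n - x' n \<cdot> y' n)) \<longlonglongrightarrow> 0"
proof -
  define s where "s n = N1 (x n - x' n) + N1 (y n - y' n)" for n
  \<comment> \<open>The extra null term keeps r n positive where s n = 0.\<close>
  define r where "r n = sqrt (s n + 1 / real (Suc n))" for n
  have s0: "0 \<le> s n" for n using x y by (simp add: s_def diff_mem)
  have r0: "0 < r n" for n using s0[of n] by (simp add: r_def add_nonneg_pos)
  have "(\<lambda>n. s n + 1 / real (Suc n)) \<longlonglongrightarrow> 0"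
  proof -
    have "(\<lambda>n. N1 (x n - x' n) + N1 (y n - y' n) + 1 / real (Suc n)) \<longlonglongrightarrow> 0 + 0 + 0"
      by (intro tendsto_add xx yy LIMSEQ_Suc[OF lim_1_over_n])
    then show ?thesis by (simp add: s_def)
  qed
  then have r: "r \<longlonglongrightarrow> 0"
    unfolding r_def using tendsto_real_sqrt by fastforce
  have "\<forall>n. \<exists>c. c \<in> A \<and> norm c \<le> 1 \<and> norm (y n \<cdot> c) \<le> 1 / r n \<and> N1 (id_blinfun - c) \<le> r n * N1 (y n)"
    using cutoff_right[OF y(1) r0] by blast
  then obtain c where c: "\<And>n. c n \<in> A" "\<And>n. norm (c n) \<le> 1" "\<And>n. norm (y n \<cdot> c n) \<le> 1 / r n"
    "\<And>n. N1 (id_blinfun - c n) \<le> r n * N1 (y n)" by metis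
  have "\<forall>n. \<exists>d. d \<in> A \<and> norm d \<le> 1 \<and> norm (d \<cdot> x' n) \<le> 1 / r n \<and> N1 (id_blinfun - d) \<le> r n * N1 (x' n)"
    using cutoff_left[OF x(2) r0] by blast
  then obtain d where d: "\<And>n. d n \<in> A" "\<And>n. norm (d n) \<le> 1" "\<And>n. norm (d n \<cdot> x' n) \<le> 1 / r n"
    "\<And>n. N1 (id_blinfun - d n) \<le> r n * N1 (x' n)" by metis
  have rK: "(\<lambda>n. r n * K) \<longlonglongrightarrow> 0" by (rule tendsto_mult_left_zero[OF r])
  show ?thesis
  proof (rule C1_null_cutoff[OF z c(1,2) _ d(1,2)])
    show "(\<lambda>n. N1 (id_blinfun - c n)) \<longlonglongrightarrow> 0"
    proof (rule LIMSEQ_null_le[OF _ _ rK])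
      show "N1 (id_blinfun - c n) \<le> r n * K" for n
        using c(4)[of n] mult_left_mono[OF yK[of n] less_imp_le[OF r0[of n]]] by linarith
    qed (use c in \<open>simp add: diff_mem\<close>)
    show "(\<lambda>n. N1 (id_blinfun - d n)) \<longlonglongrightarrow> 0"
    proof (rule LIMSEQ_null_le[OF _ _ rK])
      show "N1 (id_blinfun - d n) \<le> r n * K" for n
        using d(4)[of n] mult_left_mono[OF xK[of n] less_imp_le[OF r0[of n]]] by linarith
    qed (use d in \<open>simp add: diff_mem\<close>)
    show "(\<lambda>n. N1 (d n \<cdot> (x n \<cdot> y n - x' n \<cdot> y' n) \<cdot> c n)) \<longlonglongrightarrow> 0"
    proof (rule LIMSEQ_null_le[OF _ _ r])
      fix n
      have mem: "x n - x' n \<in> A" "y n - y' n \<in> A" "y n \<cdot> c n \<in> A" "d n \<cdot> x' n \<in> A"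
        "d n \<cdot> (x n - x' n) \<in> A" "(y n - y' n) \<cdot> c n \<in> A"
        using x[of n] y[of n] c(1)[of n] d(1)[of n] by blast+
      have "d n \<cdot> (x n \<cdot> y n - x' n \<cdot> y' n) \<cdot> c n
          = d n \<cdot> (x n - x' n) \<cdot> (y n \<cdot> c n) + (d n \<cdot> x' n) \<cdot> ((y n - y' n) \<cdot> c n)"
        by (simp add: op_simps)
      then have "N1 (d n \<cdot> (x n \<cdot> y n - x' n \<cdot> y' n) \<cdot> c n)
          \<le> N1 (d n \<cdot> (x n - x' n) \<cdot> (y n \<cdot> c n)) + N1 ((d n \<cdot> x' n) \<cdot> ((y n - y' n) \<cdot> c n))"
        using mem by (simp add: N1_triangle comp_mem)
      also have "\<dots> \<le> 1 * (1 / r n) * N1 (x n - x' n) + 1 / r n * 1 * N1 (y n - y' n)"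
        unfolding blinfun_compose_assoc[of "d n \<cdot> x' n", symmetric]
        using mem c d by (intro add_mono N1_mult_both)
      also have "\<dots> = s n / r n"
        by (simp add: s_def add_divide_distrib)
      also have "s n \<le> r n * r n"
        using s0[of n] by (simp add: r_def add_nonneg_nonneg)
      finally show "N1 (d n \<cdot> (x n \<cdot> y n - x' n \<cdot> y' n) \<cdot> c n) \<le> r n"
        using r0[of n] by (simp add: divide_right_mono)
      show "0 \<le> N1 (d n \<cdot> (x n \<cdot> y n - x' n \<cdot> y' n) \<cdot> c n)"
        using x y c d by (intro N1_nonneg comp_mem diff_mem)
    qed
  qed
qed

end

section \<open>Square-integrability from products\<close>

context tracial_algebra
begin

text \<open>For self-adjoint a and r >= 0 this is (1 + r^2 a^2)^(-1), fixed as a function so that a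
  times \<open>res r a\<close> can serve as a bounded truncation of a.\<close>

definition res :: "real \<Rightarrow> 'h bop \<Rightarrow> 'h bop" where
  "res r a = (SOME c. c \<in> A \<and> adj c = c \<and> norm c \<le> 1 \<and> norm (r *\<^sub>R (a \<cdot> c)) \<le> 1 \<and>
    id_blinfun - c = r\<^sup>2 *\<^sub>R (c \<cdot> adj a \<cdot> a) \<and> id_blinfun - c = r\<^sup>2 *\<^sub>R (adj a \<cdot> a \<cdot> c))"

context
  fixes a :: "'h bop" and r :: real
  assumes a: "a \<in> A" "adj a = a" and r: "0 \<le> r"
begin

lemma res:
  shows "res r a \<in> A" "adj (res r a) = res r a" "norm (res r a) \<le> 1" "norm (r *\<^sub>R (a \<cdot> res r a)) \<le> 1"
    "id_blinfun - res r a = r\<^sup>2 *\<^sub>R (res r a \<cdot> a \<cdot> a)" "id_blinfun - res r a = r\<^sup>2 *\<^sub>R (a \<cdot> a \<cdot> res r a)"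
proof -
  have "\<exists>c. c \<in> A \<and> adj c = c \<and> norm c \<le> 1 \<and> norm (r *\<^sub>R (a \<cdot> c)) \<le> 1 \<and>
    id_blinfun - c = r\<^sup>2 *\<^sub>R (c \<cdot> adj a \<cdot> a) \<and> id_blinfun - c = r\<^sup>2 *\<^sub>R (adj a \<cdot> a \<cdot> c)"
    using cutoff_op[OF a(1) r] by metis
  from someI_ex[OF this, folded res_def] a(2)
  show "res r a \<in> A" "adj (res r a) = res r a" "norm (res r a) \<le> 1" "norm (r *\<^sub>R (a \<cdot> res r a)) \<le> 1"
    "id_blinfun - res r a = r\<^sup>2 *\<^sub>R (res r a \<cdot> a \<cdot> a)" "id_blinfun - res r a = r\<^sup>2 *\<^sub>R (a \<cdot> a \<cdot> res r a)"
    by metis+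
qed

lemma res_sum:
  "res r a + r\<^sup>2 *\<^sub>R (res r a \<cdot> (a \<cdot> a)) = id_blinfun" "res r a + r\<^sup>2 *\<^sub>R (a \<cdot> (a \<cdot> res r a)) = id_blinfun"
  by (simp_all only: blinfun_compose_assoc[symmetric] res(5)[symmetric] res(6)[symmetric]) simp_all

text \<open>Insert 1 = s + r^2 a a s to the right of s a, where s is the resolvent, and regroup as
  (s + r^2 s a a) (a s).\<close>

lemma res_commute: "res r a \<cdot> a = a \<cdot> res r a"
proof -
  have "res r a \<cdot> a = res r a \<cdot> a \<cdot> (res r a + r\<^sup>2 *\<^sub>R (a \<cdot> (a \<cdot> res r a)))"
    by (simp only: res_sum blinfun_compose_id)
  also have "\<dots> = (res r a + r\<^sup>2 *\<^sub>R (res r a \<cdot> (a \<cdot> a))) \<cdot> (a \<cdot> res r a)"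
    by (simp add: op_simps)
  also have "\<dots> = a \<cdot> res r a"
    by (simp only: res_sum blinfun_compose_id)
  finally show ?thesis .
qed

lemma N1_id_minus_res: "N1 (id_blinfun - res r a) \<le> r * N1 a"
proof -
  have "id_blinfun - res r a = r *\<^sub>R ((r *\<^sub>R (a \<cdot> res r a)) \<cdot> a)"
    unfolding res(5) by (simp add: op_simps res_commute power2_eq_square)
  also have "N1 \<dots> \<le> \<bar>r\<bar> * N1 ((r *\<^sub>R (a \<cdot> res r a)) \<cdot> a)"
    using a res(1) by (intro N1_scaleR_le comp_mem scaleR_mem)
  also have "\<dots> \<le> \<bar>r\<bar> * (1 * N1 a)"
    using a res(1,4) by (intro mult_left_mono N1_mult_left comp_mem scaleR_mem) auto
  finally show ?thesis using r by simp
qed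

end

text \<open>Resolvent identities: inserting 1 on both sides leaves one factor b - a between
  contractions, since r a s and r b t are contractions. The Lipschitz constant of the truncation is
  2 for every r, so truncations of a 1-Cauchy sequence are 1-Cauchy.\<close>

lemma N1_res_diff:
  assumes a: "a \<in> A" "adj a = a" and b: "b \<in> A" "adj b = b" and r: "0 \<le> r"
  shows "N1 (res r a - res r b) \<le> 2 * r * N1 (a - b)"
    and "N1 (a \<cdot> res r a - b \<cdot> res r b) \<le> 2 * N1 (a - b)"
proof -
  define s where "s = res r a"
  define t where "t = res r b"
  define g where "g = r *\<^sub>R (s \<cdot> a)"
  define h where "h = r *\<^sub>R (b \<cdot> t)"
  note s = res[OF a r, folded s_def] res_sum[OF a r, folded s_def] res_commute[OF a r, folded s_def]
  note t = res[OF b r, folded t_def] res_sum[OF b r, folded t_def]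
  have g: "g \<in> A" "norm g \<le> 1" and h: "h \<in> A" "norm h \<le> 1"
    using s(1,4) t(1,4) a(1) b(1) by (auto simp: g_def h_def s(9))
  have d: "b - a \<in> A" "a - b \<in> A" using a b by blast+
  have ba: "N1 (b - a) = N1 (a - b)" by (rule N1_minus[OF a(1) b(1)])
  have "s - t = s \<cdot> (t + r\<^sup>2 *\<^sub>R (b \<cdot> (b \<cdot> t))) - (s + r\<^sup>2 *\<^sub>R (s \<cdot> (a \<cdot> a))) \<cdot> t"
    by (simp only: s(7) t(8) blinfun_compose_id)
  also have "\<dots> = r *\<^sub>R (s \<cdot> (b - a) \<cdot> h + g \<cdot> (b - a) \<cdot> t)"
    by (simp add: g_def h_def op_simps power2_eq_square algebra_simps)
  also have "N1 \<dots> \<le> \<bar>r\<bar> * N1 (s \<cdot> (b - a) \<cdot> h + g \<cdot> (b - a) \<cdot> t)"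
    using s(1) t(1) g h d by (intro N1_scaleR_le comp_mem add_mem)
  also have "N1 (s \<cdot> (b - a) \<cdot> h + g \<cdot> (b - a) \<cdot> t) \<le> N1 (s \<cdot> (b - a) \<cdot> h) + N1 (g \<cdot> (b - a) \<cdot> t)"
    using s(1) t(1) g h d by (intro N1_triangle comp_mem)
  also have "\<dots> \<le> 1 * 1 * N1 (b - a) + 1 * 1 * N1 (b - a)"
    using s(1,3) t(1,3) g h d by (intro add_mono N1_mult_both)
  finally have "N1 (s - t) \<le> \<bar>r\<bar> * (1 * 1 * N1 (b - a) + 1 * 1 * N1 (b - a))"
    by (simp only: mult_left_mono abs_ge_zero)
  then show "N1 (res r a - res r b) \<le> 2 * r * N1 (a - b)"
    using r by (simp add: ba s_def t_def)
  have "a \<cdot> s - b \<cdot> t = s \<cdot> a \<cdot> (t + r\<^sup>2 *\<^sub>R (b \<cdot> (b \<cdot> t))) - (s + r\<^sup>2 *\<^sub>R (s \<cdot> (a \<cdot> a))) \<cdot> (b \<cdot> t)"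
    by (simp only: s(7,9) t(8) blinfun_compose_id)
  also have "\<dots> = s \<cdot> (a - b) \<cdot> t + g \<cdot> (b - a) \<cdot> h"
    by (simp add: g_def h_def op_simps power2_eq_square algebra_simps)
  also have "N1 \<dots> \<le> N1 (s \<cdot> (a - b) \<cdot> t) + N1 (g \<cdot> (b - a) \<cdot> h)"
    using s(1) t(1) g h d by (intro N1_triangle comp_mem)
  also have "\<dots> \<le> 1 * 1 * N1 (a - b) + 1 * 1 * N1 (b - a)"
    using s(1,3) t(1,3) g h d by (intro add_mono N1_mult_both)
  finally have "N1 (a \<cdot> s - b \<cdot> t) \<le> 1 * 1 * N1 (a - b) + 1 * 1 * N1 (b - a)" .
  then show "N1 (a \<cdot> res r a - b \<cdot> res r b) \<le> 2 * N1 (a - b)"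
    by (simp add: ba s_def t_def)
qed

lemma square_le_imp_le:
  fixes h p q :: real
  assumes "h\<^sup>2 \<le> p + q * h" "p \<le> s\<^sup>2" "0 \<le> s" "0 \<le> q"
  shows "h \<le> q + s"
proof (rule ccontr)
  assume "\<not> h \<le> q + s"
  then have h: "q + s < h" by simp
  have "s * s \<le> (h - q) * s" using h assms by (intro mult_right_mono) auto
  also have "\<dots> \<le> (h - q) * h" using h assms by (intro mult_left_mono) auto
  finally have "s * s = h * (h - q)" using assms(1,2) by (simp add: power2_eq_square algebra_simps)
  moreover have "s * s < h * (h - q)" if "0 < s"
    using h assms that by (intro mult_strict_mono) auto
  moreover have "0 < h * (h - q)" using h assms by simp
  ultimately show False using assms(3) by (cases "s = 0") auto
qed

text \<open>If \<open>V W\<close> is in \<open>L\<^sub>1\<close> and \<open>D = V - W\<close> is in \<open>L\<^sub>2\<close>, then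
  \<open>V\<^sup>2 = V W + V D\<close> gives \<open>\<parallel>V t\<parallel>\<^sub>2\<^sup>2 \<le> \<parallel>t V W t\<parallel>\<^sub>1 + \<parallel>V t\<parallel>\<^sub>2 \<parallel>D t\<parallel>\<^sub>2\<close> for every bounded \<open>t = t\<^sup>*\<close>
  commuting with \<open>V\<close> for which \<open>V t\<close> is bounded. For \<open>t\<close> the difference of two cutoffs of \<open>V\<close> both
  terms on the right are small, so the truncations of \<open>V\<close> converge in \<open>L\<^sub>2\<close>.\<close>

context
  fixes a x y d :: "nat \<Rightarrow> 'h bop"
  assumes a: "a \<in> C1" "\<And>n. adj (a n) = a n"
    and x: "\<And>n. x n \<in> A" "(\<lambda>n. N1 (x n - a n)) \<longlonglongrightarrow> 0"
    and y: "y \<in> C1" and d: "d \<in> C2" and ayd: "(\<lambda>n. N1 (a n - y n - d n)) \<longlonglongrightarrow> 0"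
    and z: "(\<lambda>n. x n \<cdot> y n) \<in> C1"
begin

text \<open>Two representatives of V occur: the self-adjoint a and the x for which x y converges.
  Exchanging t x for a t next to y t, which need not be norm-bounded, is where
  \<open>product_limit_unique\<close> enters; the remaining error a - y - d sits between bounded
  factors.\<close>

lemma truncation_limit:
  assumes t: "t \<in> C1" "\<And>n. adj (t n) = t n" "\<And>n. norm (t n) \<le> 2" "\<And>n. a n \<cdot> t n = t n \<cdot> a n"
    and h: "(\<lambda>n. a n \<cdot> t n) \<in> C1" "\<And>n. norm (a n \<cdot> t n) \<le> k"
  shows "(\<lambda>n. N1 ((a n \<cdot> t n) \<cdot> (a n \<cdot> t n) - (t n \<cdot> (x n \<cdot> y n)) \<cdot> t n - (a n \<cdot> t n) \<cdot> (d n \<cdot> t n)))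
    \<longlonglongrightarrow> 0"
proof -
  note m = a(1)[THEN Lp_cauchy_mem] x(1) y[THEN Lp_cauchy_mem] d[THEN Lp_cauchy_mem] t(1)[THEN Lp_cauchy_mem]
  obtain K where K: "0 \<le> K" "\<And>n. N1 (y n) \<le> K" using C1_bounded[OF y] by blast
  obtain L where L: "0 \<le> L" "\<And>n. N1 (a n \<cdot> t n) \<le> L" using C1_bounded[OF h(1)] by blast
  have x_C1: "x \<in> C1"
    using x m by (intro C1_null_equiv[OF a(1)]) (simp_all add: N1_minus)
  obtain J where J: "0 \<le> J" "\<And>n. N1 (x n) \<le> J" using C1_bounded[OF x_C1] by blast
  let ?p = "\<lambda>n. (a n \<cdot> t n) \<cdot> (y n \<cdot> t n) - (t n \<cdot> x n) \<cdot> (y n \<cdot> t n)"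
  have yt: "(\<lambda>n. y n \<cdot> t n) \<in> C1" by (rule C1_mult_bounded_right[OF t(1,3) y])
  have p: "(\<lambda>n. N1 (?p n)) \<longlonglongrightarrow> 0"
  proof (rule product_limit_unique[where K = "2 * K + 2 * J"])
    have "(\<lambda>n. t n \<cdot> (x n \<cdot> y n) \<cdot> t n) \<in> C1"
      by (rule C1_mult_bounded_right[OF t(1,3) C1_mult_bounded_left[OF t(1,3) z]])
    then have "(\<lambda>n. (t n \<cdot> x n) \<cdot> (y n \<cdot> t n)) \<in> C1" by (simp add: op_simps)
    then show "?p \<in> C1" by (rule C1_diff[OF C1_mult_bounded_left[OF h yt]])
    show "N1 (y n \<cdot> t n) \<le> 2 * K + 2 * J" for n
      using N1_mult_right[OF m(5) t(3) m(3), of n n] K(2)[of n] J(1) by linarith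
    show "N1 (t n \<cdot> x n) \<le> 2 * K + 2 * J" for n
      using N1_mult_left[OF m(5) t(3) m(2), of n n] J(2)[of n] K(1) by linarith
    show "(\<lambda>n. N1 (a n \<cdot> t n - t n \<cdot> x n)) \<longlonglongrightarrow> 0"
    proof (rule LIMSEQ_null_le[OF _ _ tendsto_mult_right_zero[OF x(2), of 2]])
      show "N1 (a n \<cdot> t n - t n \<cdot> x n) \<le> 2 * N1 (x n - a n)" for n
        using N1_mult_left[OF m(5) t(3) diff_mem[OF m(1,2)], of n n n] N1_minus[OF m(1,2), of n n]
        by (simp add: t(4) op_simps)
      show "0 \<le> N1 (a n \<cdot> t n - t n \<cdot> x n)" for n
        using m by (intro N1_nonneg comp_mem diff_mem)
    qed
    show "(\<lambda>n. N1 (y n \<cdot> t n - y n \<cdot> t n)) \<longlonglongrightarrow> 0" by simp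
  qed (use m in \<open>simp_all add: comp_mem\<close>)
  show ?thesis
  proof (rule LIMSEQ_null_le)
    have "(\<lambda>n. 2 * k * N1 (a n - y n - d n) + N1 (?p n)) \<longlonglongrightarrow> 2 * k * 0 + 0"
      by (intro tendsto_add tendsto_mult tendsto_const ayd p)
    then show "(\<lambda>n. 2 * k * N1 (a n - y n - d n) + N1 (?p n)) \<longlonglongrightarrow> 0" by simp
    fix n
    let ?h = "a n \<cdot> t n" and ?e = "a n - y n - d n"
    have mem: "?h \<in> A" "?e \<in> A" "?h \<cdot> ?e \<in> A" "?h \<cdot> ?e \<cdot> t n \<in> A" "?p n \<in> A"
      using m(1)[of n] m(2)[of n] m(3)[of n] m(4)[of n] m(5)[of n] by blast+
    have eq: "?h \<cdot> ?h - (t n \<cdot> (x n \<cdot> y n)) \<cdot> t n - ?h \<cdot> (d n \<cdot> t n) = ?h \<cdot> ?e \<cdot> t n + ?p n"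
      by (simp add: op_simps)
    show "0 \<le> N1 (?h \<cdot> ?h - (t n \<cdot> (x n \<cdot> y n)) \<cdot> t n - ?h \<cdot> (d n \<cdot> t n))"
      unfolding eq by (intro N1_nonneg add_mem mem)
    have "N1 (?h \<cdot> ?e \<cdot> t n) \<le> k * 2 * N1 ?e"
      using m t h mem by (intro N1_mult_both)
    then show "N1 (?h \<cdot> ?h - (t n \<cdot> (x n \<cdot> y n)) \<cdot> t n - ?h \<cdot> (d n \<cdot> t n)) \<le> 2 * k * N1 ?e + N1 (?p n)"
      unfolding eq using N1_triangle[OF mem(4,5)] by simp
  qed
qed

text \<open>The point is that \<open>\<eta>\<close> is chosen before t and before the norm bound k
  of a t. That bound only affects the stage from which the conclusion holds, so it may blow up as
  the cutoffs are relaxed.\<close>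

lemma truncation_small:
  assumes e: "0 < e"
  obtains \<eta> where "0 < \<eta>" "\<And>t k. t \<in> C1 \<Longrightarrow> (\<And>n. adj (t n) = t n) \<Longrightarrow> (\<And>n. norm (t n) \<le> 2) \<Longrightarrow>
    (\<And>n. a n \<cdot> t n = t n \<cdot> a n) \<Longrightarrow> (\<lambda>n. a n \<cdot> t n) \<in> C1 \<Longrightarrow> (\<And>n. norm (a n \<cdot> t n) \<le> k) \<Longrightarrow>
    (\<And>n. N1 (t n) \<le> \<eta>) \<Longrightarrow> eventually (\<lambda>n. N2 (a n \<cdot> t n) < e) sequentially"
proof -
  \<comment> \<open>The target is h^2 <= (e/3)^2 + (e/3) h for h =
    \<open>N2 (a n \<cdot> t n)\<close>, which gives h <= 2 e/3. Two factors t of norm at most 2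
    turn the first number into (e/3)^2 / 3; one such factor turns the second into e/6.\<close>
  have e1: "0 < (e / 3)\<^sup>2 / 12" "0 < e / 12" using e by auto
  obtain L1 where L1: "\<And>m n. L1 \<le> m \<Longrightarrow> L1 \<le> n \<Longrightarrow> N1 (x m \<cdot> y m - x n \<cdot> y n) < (e / 3)\<^sup>2 / 12"
    using Lp_cauchyD[OF z e1(1)] by blast
  obtain L2 where L2: "\<And>m n. L2 \<le> m \<Longrightarrow> L2 \<le> n \<Longrightarrow> N2 (d m - d n) < e / 12"
    using Lp_cauchyD[OF d e1(2)] by blast
  let ?z = "x L1 \<cdot> y L1" and ?d = "d L2"
  define B where "B = norm ?z + 1"
  define C where "C = norm ?d + 1"
  have BC: "0 < B" "0 < C" "norm ?z \<le> B" "norm ?d \<le> C" by (auto simp: B_def C_def add_nonneg_pos)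
  define \<eta> where "\<eta> = min ((e / 3)\<^sup>2 / 3 / (2 * B)) ((e / (6 * C))\<^sup>2 / 2)"
  have \<eta>: "0 < \<eta>" using e BC by (simp add: \<eta>_def)
  have \<eta>B: "2 * B * \<eta> \<le> (e / 3)\<^sup>2 / 3"
  proof -
    have "2 * B * \<eta> \<le> 2 * B * ((e / 3)\<^sup>2 / 3 / (2 * B))"
      using BC by (intro mult_left_mono) (auto simp: \<eta>_def)
    then show ?thesis using BC by simp
  qed
  have \<eta>C: "C * sqrt (2 * \<eta>) \<le> e / 6"
  proof -
    have "2 * \<eta> \<le> (e / (6 * C))\<^sup>2" by (simp add: \<eta>_def min_def)
    then have "sqrt (2 * \<eta>) \<le> e / (6 * C)" using e BC by (simp add: real_le_lsqrt)
    then have "C * sqrt (2 * \<eta>) \<le> C * (e / (6 * C))" using BC by (intro mult_left_mono) auto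
    then show ?thesis using BC by simp
  qed
  show ?thesis
  proof (rule that[OF \<eta>])
    fix t k
    assume t: "t \<in> C1" "\<And>n. adj (t n) = t n" "\<And>n. norm (t n) \<le> 2" "\<And>n. a n \<cdot> t n = t n \<cdot> a n"
      and h: "(\<lambda>n. a n \<cdot> t n) \<in> C1" "\<And>n. norm (a n \<cdot> t n) \<le> k" and small: "\<And>n. N1 (t n) \<le> \<eta>"
    note m = a(1)[THEN Lp_cauchy_mem] x(1) y[THEN Lp_cauchy_mem] d[THEN Lp_cauchy_mem] t(1)[THEN Lp_cauchy_mem]
    define r where "r n = (a n \<cdot> t n) \<cdot> (a n \<cdot> t n) - (t n \<cdot> (x n \<cdot> y n)) \<cdot> t n - (a n \<cdot> t n) \<cdot> (d n \<cdot> t n)" for n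
    have r: "(\<lambda>n. N1 (r n)) \<longlonglongrightarrow> 0"
      unfolding r_def by (rule truncation_limit[OF t h])
    have "eventually (\<lambda>n. N1 (r n) < (e / 3)\<^sup>2 / 3) sequentially"
      using e by (intro order_tendstoD(2)[OF r]) auto
    moreover have "eventually (\<lambda>n. L1 \<le> n) sequentially" "eventually (\<lambda>n. L2 \<le> n) sequentially"
      by (rule eventually_ge_at_top)+
    ultimately show "eventually (\<lambda>n. N2 (a n \<cdot> t n) < e) sequentially"
    proof eventually_elim
      case (elim n)
      let ?h = "a n \<cdot> t n" and ?zn = "x n \<cdot> y n"
      have sum3: "H \<le> p + q" if "H \<le> c1 + c2 + c3" "c1 \<le> p / 3" "c2 \<le> p / 3 + p / 3" "c3 \<le> q"
        for H c1 c2 c3 p q :: real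
        using that by linarith
      have mem: "?h \<in> A" "?zn \<in> A" "?z \<in> A" "?zn - ?z \<in> A" "r n \<in> A" "t n \<cdot> ?zn \<cdot> t n \<in> A" "d n \<cdot> t n \<in> A"
        "?h \<cdot> (d n \<cdot> t n) \<in> A" "t n \<cdot> (?zn - ?z) \<in> A" "t n \<cdot> (?zn - ?z) \<cdot> t n \<in> A" "?z \<cdot> t n \<in> A"
        "t n \<cdot> (?z \<cdot> t n) \<in> A" "d n - ?d \<in> A" "(d n - ?d) \<cdot> t n \<in> A" "?d \<cdot> t n \<in> A"
        unfolding r_def
        using m(1)[of n] m(2)[of n] m(2)[of L1] m(3)[of n] m(3)[of L1] m(4)[of n] m(4)[of L2] m(5)[of n]
        by blast+
      have adjh: "adj ?h = ?h" using m t by (simp add: adj_compose a(2))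
      have "?h \<cdot> ?h = (r n + t n \<cdot> ?zn \<cdot> t n) + ?h \<cdot> (d n \<cdot> t n)" by (simp add: r_def)
      then have "\<phi> (?h \<cdot> ?h) = \<phi> (r n) + \<phi> (t n \<cdot> ?zn \<cdot> t n) + \<phi> (?h \<cdot> (d n \<cdot> t n))"
        using mem by (simp only: phi_add add_mem)
      then have "(N2 ?h)\<^sup>2 \<le> cmod (\<phi> (r n)) + cmod (\<phi> (t n \<cdot> ?zn \<cdot> t n)) + cmod (\<phi> (?h \<cdot> (d n \<cdot> t n)))"
        unfolding N2_square[OF mem(1)] adjh
        using complex_Re_le_cmod[of "\<phi> (?h \<cdot> ?h)"] norm_triangle_ineq[of "\<phi> (r n)" "\<phi> (t n \<cdot> ?zn \<cdot> t n)"]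
          norm_triangle_ineq[of "\<phi> (r n) + \<phi> (t n \<cdot> ?zn \<cdot> t n)" "\<phi> (?h \<cdot> (d n \<cdot> t n))"] by simp
      moreover have "cmod (\<phi> (r n)) \<le> (e / 3)\<^sup>2 / 3"
        using phi_le_N1[OF mem(5)] elim by linarith
      moreover have "cmod (\<phi> (t n \<cdot> ?zn \<cdot> t n)) \<le> (e / 3)\<^sup>2 / 3 + (e / 3)\<^sup>2 / 3"
      proof -
        have "t n \<cdot> ?zn \<cdot> t n = t n \<cdot> (?zn - ?z) \<cdot> t n + t n \<cdot> (?z \<cdot> t n)"
          by (simp add: op_simps)
        then have "cmod (\<phi> (t n \<cdot> ?zn \<cdot> t n)) \<le> N1 (t n \<cdot> (?zn - ?z) \<cdot> t n) + N1 (t n \<cdot> (?z \<cdot> t n))"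
          using phi_le_N1[OF mem(6)] N1_triangle[OF mem(10) mem(12)] by simp
        moreover have "N1 (t n \<cdot> (?zn - ?z) \<cdot> t n) \<le> 2 * 2 * N1 (?zn - ?z)"
          using m t mem by (intro N1_mult_both)
        moreover have "N1 (?zn - ?z) < (e / 3)\<^sup>2 / 12"
          using L1 elim by simp
        moreover have "N1 (t n \<cdot> (?z \<cdot> t n)) \<le> B * 2 * N1 (t n)"
          using m mem norm_compose_le[OF BC(3) t(3)] by (intro N1_mult_right)
        moreover have "B * 2 * N1 (t n) \<le> B * 2 * \<eta>"
          using BC small by (intro mult_left_mono) auto
        ultimately show ?thesis using \<eta>B by linarith
      qed
      moreover have "cmod (\<phi> (?h \<cdot> (d n \<cdot> t n))) \<le> (e / 3) * N2 ?h"
      proof -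
        have "d n \<cdot> t n = (d n - ?d) \<cdot> t n + ?d \<cdot> t n" by (simp add: op_simps)
        then have "N2 (d n \<cdot> t n) \<le> N2 ((d n - ?d) \<cdot> t n) + N2 (?d \<cdot> t n)"
          using N2_triangle[OF mem(14,15)] by simp
        moreover have "N2 ((d n - ?d) \<cdot> t n) \<le> N2 (d n - ?d) * norm (t n)"
          using m mem by (intro N2_mult_right)
        moreover have "N2 (d n - ?d) * norm (t n) \<le> e / 12 * 2"
          using L2[of n L2] elim t(3) mem e by (intro mult_mono) auto
        moreover have "N2 (?d \<cdot> t n) \<le> norm ?d * N2 (t n)"
          using m by (intro N2_mult_left)
        moreover have "norm ?d * N2 (t n) \<le> C * sqrt (2 * \<eta>)"
        proof (intro mult_mono BC)
          have "(N2 (t n))\<^sup>2 \<le> 2 * N1 (t n)" using m t by (intro N2_square_le)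
          then show "N2 (t n) \<le> sqrt (2 * \<eta>)" using small[of n] by (intro real_le_rsqrt) linarith
        qed (use m BC in auto)
        ultimately have "N2 (d n \<cdot> t n) \<le> e / 3" using \<eta>C by linarith
        then have "N2 ?h * N2 (d n \<cdot> t n) \<le> N2 ?h * (e / 3)"
          using mem by (intro mult_left_mono) auto
        then show ?thesis using phi_cauchy_schwarz[OF mem(1,7)] by (simp add: mult.commute)
      qed
      ultimately have "(N2 ?h)\<^sup>2 \<le> (e / 3)\<^sup>2 + (e / 3) * N2 ?h" by (rule sum3)
      then have "N2 ?h \<le> e / 3 + e / 3"
        by (rule square_le_imp_le[OF _ order_refl]) (use e in simp_all)
      then show ?case using e by simp
    qed
  qed
qed

text \<open>For each cutoff level r the truncations \<open>g r n\<close> form a 2-Cauchy sequence in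
  n, and different small levels agree up to e in the 2-norm for large n. A diagonal choice is then
  2-Cauchy and still approximates a in the 1-norm.\<close>

lemma square_integrable_representative:
  obtains w where "w \<in> C2" "\<And>n. adj (w n) = w n" "(\<lambda>n. N1 (w n - a n)) \<longlonglongrightarrow> 0"
proof -
  note m = a(1)[THEN Lp_cauchy_mem]
  obtain K0 where K0: "0 \<le> K0" "\<And>n. N1 (a n) \<le> K0" using C1_bounded[OF a(1)] by blast
  \<comment> \<open>Strictly positive, since thresholds are divided by it.\<close>
  define K where "K = K0 + 1"
  have K: "0 < K" "\<And>n. N1 (a n) \<le> K" using K0 by (simp_all add: K_def add_increasing2)
  define s where "s r n = res r (a n)" for r n
  define g where "g r n = a n \<cdot> s r n" for r n
  have s: "s r n \<in> A" "adj (s r n) = s r n" "norm (s r n) \<le> 1" "s r n \<cdot> a n = a n \<cdot> s r n"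
    "N1 (id_blinfun - s r n) \<le> r * K" if "0 < r" for r n
  proof -
    have "r * N1 (a n) \<le> r * K" using that K by (intro mult_left_mono) auto
    with N1_id_minus_res[OF m a(2) less_imp_le[OF that], of n] show "N1 (id_blinfun - s r n) \<le> r * K"
      unfolding s_def by (rule order_trans)
  qed (use that res[OF m a(2), of r n] res_commute[OF m a(2), of r n] in \<open>simp_all add: s_def\<close>)
  have gA: "g r n \<in> A" and adjg: "adj (g r n) = g r n" if "0 < r" for r n
    using s[OF that, of n] m[of n] a(2)[of n] by (auto simp: g_def adj_compose)
  have ng: "norm (g r n) \<le> 1 / r" if "0 < r" for r n
    using res(4)[OF m a(2), of r n] that by (simp add: g_def s_def field_simps)
  have s_C1: "s r \<in> C1" if "0 < r" for r
  proof (rule Lp_cauchy_dominated[OF _ a(1) a(1), where k = r])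
    show "N1 (s r i - s r j) \<le> r * (N1 (a i - a j) + N1 (a i - a j))" for i j
      using N1_res_diff(1)[OF m a(2) m a(2), of r i j] that by (simp add: s_def)
  qed (use s(1) that in auto)
  have g_C1: "g r \<in> C1" if "0 < r" for r
  proof (rule Lp_cauchy_dominated[OF _ a(1) a(1), where k = 1])
    show "N1 (g r i - g r j) \<le> 1 * (N1 (a i - a j) + N1 (a i - a j))" for i j
      using N1_res_diff(2)[OF m a(2) m a(2), of r i j] that by (simp add: s_def g_def)
  qed (use gA that in auto)
  \<comment> \<open>At a fixed level the norms are at most 1/r, so \<open>N2_square_le\<close>
    upgrades the 1-Cauchy property.\<close>
  have g_C2: "g r \<in> C2" if r: "0 < r" for r
  proof (rule Lp_cauchyI)
    fix e :: real assume e: "0 < e"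
    then have "0 < e\<^sup>2 * r / 2" using r by simp
    then obtain L where L: "\<And>m n. L \<le> m \<Longrightarrow> L \<le> n \<Longrightarrow> N1 (g r m - g r n) < e\<^sup>2 * r / 2"
      using Lp_cauchyD[OF g_C1[OF r]] by blast
    have "N2 (g r i - g r j) < e" if "L \<le> i" "L \<le> j" for i j
    proof -
      have "norm (g r i - g r j) \<le> 2 / r"
        using norm_triangle_ineq4[of "g r i" "g r j"] ng[OF r, of i] ng[OF r, of j] by simp
      then have "(N2 (g r i - g r j))\<^sup>2 \<le> 2 / r * N1 (g r i - g r j)"
        using gA[OF r] by (intro N2_square_le diff_mem)
      also have "\<dots> < 2 / r * (e\<^sup>2 * r / 2)"
        using r L[OF that] by (intro mult_strict_left_mono) auto
      also have "\<dots> = e\<^sup>2" using r by simp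
      finally show ?thesis using e by (simp add: power2_less_imp_less)
    qed
    then show "\<exists>K. \<forall>m\<ge>K. \<forall>n\<ge>K. N2 (g r m - g r n) < e" by blast
  qed (rule gA[OF r])
  \<comment> \<open>Apply \<open>truncation_small\<close> to the difference of two resolvents. Each
    is within p K or q K of 1 in the 1-norm, so levels below \<open>\<eta>\<close> / (2 K)
    suffice.\<close>
  have key: "\<exists>\<eta>>0. \<forall>p q. 0 < p \<longrightarrow> p < \<eta> \<longrightarrow> 0 < q \<longrightarrow> q < \<eta> \<longrightarrow>
      eventually (\<lambda>n. N2 (g p n - g q n) < e) sequentially" if e: "0 < e" for e
  proof (rule truncation_small[OF e])
    fix \<eta> assume \<eta>: "0 < \<eta>" "\<And>t k. t \<in> C1 \<Longrightarrow> (\<And>n. adj (t n) = t n) \<Longrightarrow> (\<And>n. norm (t n) \<le> 2) \<Longrightarrow>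
      (\<And>n. a n \<cdot> t n = t n \<cdot> a n) \<Longrightarrow> (\<lambda>n. a n \<cdot> t n) \<in> C1 \<Longrightarrow> (\<And>n. norm (a n \<cdot> t n) \<le> k) \<Longrightarrow>
      (\<And>n. N1 (t n) \<le> \<eta>) \<Longrightarrow> eventually (\<lambda>n. N2 (a n \<cdot> t n) < e) sequentially"
    have "eventually (\<lambda>n. N2 (g p n - g q n) < e) sequentially"
      if p: "0 < p" "p < \<eta> / (2 * K)" and q: "0 < q" "q < \<eta> / (2 * K)" for p q
    proof -
      let ?t = "\<lambda>n. s p n - s q n"
      have at: "a n \<cdot> ?t n = g p n - g q n" for n by (simp add: g_def op_simps)
      have "eventually (\<lambda>n. N2 (a n \<cdot> ?t n) < e) sequentially"
      proof (rule \<eta>(2)[where k = "1 / p + 1 / q"])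
        show "?t \<in> C1" by (intro C1_diff s_C1 p q)
        show "adj (?t n) = ?t n" for n using s p q by (simp add: adj_diff)
        show "norm (?t n) \<le> 2" for n
          using norm_triangle_ineq4[of "s p n" "s q n"] s(3)[OF p(1), of n] s(3)[OF q(1), of n] by linarith
        show "a n \<cdot> ?t n = ?t n \<cdot> a n" for n using s(4) p q by (simp add: op_simps)
        show "(\<lambda>n. a n \<cdot> ?t n) \<in> C1" unfolding at by (intro C1_diff g_C1 p q)
        show "norm (a n \<cdot> ?t n) \<le> 1 / p + 1 / q" for n
          unfolding at using norm_triangle_ineq4[of "g p n" "g q n"] ng[OF p(1), of n] ng[OF q(1), of n] by linarith
        show "N1 (?t n) \<le> \<eta>" for n
        proof -
          have "p * K < \<eta> / 2" "q * K < \<eta> / 2" using p q K(1) by (simp_all add: field_simps)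
          moreover have "N1 (?t n) \<le> N1 (id_blinfun - s q n) + N1 (id_blinfun - s p n)"
            using N1_triangle_minus[of "id_blinfun - s q n" "id_blinfun - s p n"] s(1)[OF p(1), of n] s(1)[OF q(1), of n]
            by (simp add: diff_mem)
          ultimately show ?thesis
            using s(5)[OF p(1), of n] s(5)[OF q(1), of n] by linarith
        qed
      qed
      then show ?thesis by (simp add: at)
    qed
    then show "\<exists>\<eta>>0. \<forall>p q. 0 < p \<longrightarrow> p < \<eta> \<longrightarrow> 0 < q \<longrightarrow> q < \<eta> \<longrightarrow>
      eventually (\<lambda>n. N2 (g p n - g q n) < e) sequentially"
      using \<eta>(1) K(1) by (intro exI[of _ "\<eta> / (2 * K)"]) auto
  qed
  define r where "r k = 1 / real (Suc k)" for k
  have r: "0 < r k" for k by (simp add: r_def)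
  have r_lim: "r \<longlonglongrightarrow> 0" unfolding r_def by (rule LIMSEQ_Suc[OF lim_1_over_n])
  \<comment> \<open>The diagonal index: beyond it the truncations of level r k no longer vary by r
    k. Taking it at least k lets the diagonal follow a.\<close>
  have "\<exists>L\<ge>k. \<forall>i\<ge>L. \<forall>j\<ge>L. N2 (g (r k) i - g (r k) j) < r k" for k
  proof -
    obtain L where "\<And>i j. L \<le> i \<Longrightarrow> L \<le> j \<Longrightarrow> N2 (g (r k) i - g (r k) j) < r k"
      using Lp_cauchyD[OF g_C2[OF r] r] by blast
    then show ?thesis by (intro exI[of _ "max L k"]) auto
  qed
  then obtain l where l: "\<And>k. k \<le> l k" "\<And>k i j. l k \<le> i \<Longrightarrow> l k \<le> j \<Longrightarrow> N2 (g (r k) i - g (r k) j) < r k"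
    by metis
  define w where "w k = g (r k) (l k)" for k
  have wA: "w k \<in> A" for k by (simp add: w_def gA r)
  show ?thesis
  proof (rule that[of w])
    show "w \<in> C2"
    proof (rule Lp_cauchyI[OF wA])
      fix e :: real assume e: "0 < e"
      obtain \<eta> where \<eta>: "0 < \<eta>" "\<And>p q. 0 < p \<Longrightarrow> p < \<eta> \<Longrightarrow> 0 < q \<Longrightarrow> q < \<eta> \<Longrightarrow>
        eventually (\<lambda>n. N2 (g p n - g q n) < e / 3) sequentially"
        using key[of "e / 3"] e by auto
      have "eventually (\<lambda>k. r k < min \<eta> (e / 3)) sequentially"
        using e \<eta>(1) by (intro order_tendstoD(2)[OF r_lim]) auto
      then obtain J where J: "\<And>k. J \<le> k \<Longrightarrow> r k < \<eta>" "\<And>k. J \<le> k \<Longrightarrow> r k < e / 3"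
        by (auto simp: eventually_sequentially)
      have "N2 (w i - w j) < e" if ij: "J \<le> i" "J \<le> j" for i j
      proof -
        have "eventually (\<lambda>n. N2 (g (r i) n - g (r j) n) < e / 3 \<and> l i \<le> n \<and> l j \<le> n) sequentially"
          using \<eta>(2)[OF r J(1) r J(1), OF ij] eventually_ge_at_top[of "l i"] eventually_ge_at_top[of "l j"]
          by eventually_elim auto
        then obtain n where n: "N2 (g (r i) n - g (r j) n) < e / 3" "l i \<le> n" "l j \<le> n"
          by (auto simp: eventually_sequentially)
        have 1: "N2 (g (r i) (l i) - g (r i) n) < e / 3"
          using l(2)[of i "l i" n] n J(2)[OF ij(1)] by simp
        have 2: "N2 (g (r j) n - g (r j) (l j)) < e / 3"
          using l(2)[of j n "l j"] n J(2)[OF ij(2)] by simp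
        have "N2 (w i - w j) \<le> N2 (w i - g (r i) n) + (N2 (g (r i) n - g (r j) n) + N2 (g (r j) n - w j))"
          by (intro order_trans[OF N2_triangle_diff[of _ "g (r i) n"]] add_mono order_refl
              N2_triangle_diff wA gA r)
        then show ?thesis using 1 2 n(1) by (simp add: w_def)
      qed
      then show "\<exists>K. \<forall>m\<ge>K. \<forall>n\<ge>K. N2 (w m - w n) < e" by blast
    qed
    show "adj (w n) = w n" for n by (simp add: w_def adjg r)
    show "(\<lambda>n. N1 (w n - a n)) \<longlonglongrightarrow> 0"
    proof (rule LIMSEQ_null_leI)
      show "0 \<le> N1 (w n - a n)" for n using wA m by (simp add: diff_mem)
      fix e :: real assume e: "0 < e"
      \<comment> \<open>The Lipschitz constant 2 of truncation turns this into 2 e/3; the last third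
        is for a L - a k.\<close>
      obtain L where L: "\<And>m n. L \<le> m \<Longrightarrow> L \<le> n \<Longrightarrow> N1 (a m - a n) < e / 3"
        using Lp_cauchyD[OF a(1), of "e / 3"] e by auto
      have "N1 (w k - a k) \<le> e + norm (a L) * K * r k" if k: "L \<le> k" for k
      proof -
        have lk: "L \<le> l k" using k l(1)[of k] by simp
        have mem: "w k \<in> A" "g (r k) L \<in> A" "a L \<in> A" "a k \<in> A" "id_blinfun - s (r k) L \<in> A"
          using wA gA r m s(1)[OF r] by auto
        have 1: "N1 (w k - g (r k) L) \<le> 2 * N1 (a (l k) - a L)"
          using N1_res_diff(2)[OF m a(2) m a(2), of "r k" "l k" L] r[of k] by (simp add: w_def g_def s_def)
        have "a L - g (r k) L = a L \<cdot> (id_blinfun - s (r k) L)" by (simp add: g_def op_simps)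
        then have "N1 (a L - g (r k) L) \<le> norm (a L) * N1 (id_blinfun - s (r k) L)"
          using mem by (simp add: N1_mult_left)
        also have "\<dots> \<le> norm (a L) * (r k * K)"
          by (intro mult_left_mono s r) auto
        finally have 2: "N1 (g (r k) L - a L) \<le> norm (a L) * K * r k"
          using N1_minus[OF mem(2,3)] by (simp add: mult_ac)
        have "N1 (w k - a k) \<le> N1 (w k - g (r k) L) + (N1 (g (r k) L - a L) + N1 (a L - a k))"
          by (intro order_trans[OF N1_triangle_diff[of _ "g (r k) L"]] add_mono order_refl
              N1_triangle_diff mem)
        then show ?thesis using 1 2 L[of "l k" L] L[of L k] lk k by simp
      qed
      moreover have "(\<lambda>k. norm (a L) * K * r k) \<longlonglongrightarrow> 0"
        by (rule tendsto_mult_right_zero[OF r_lim])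
      ultimately show "\<exists>g. g \<longlonglongrightarrow> 0 \<and> eventually (\<lambda>n. N1 (w n - a n) \<le> e + g n) sequentially"
        unfolding eventually_sequentially by blast
    qed
  qed
qed

end

end

section \<open>The space of integrable operators\<close>

context tracial_algebra
begin

section \<open>Classes of Cauchy sequences and the operations on them\<close>

abbreviation cls where "cls xs \<equiv> Lp_rel A \<phi> (Suc 0) `` {xs}"

lemma Lp_rel_iff [simp]:
  "(xs, ys) \<in> Lp_rel A \<phi> (Suc 0) \<longleftrightarrow> xs \<in> C1 \<and> ys \<in> C1 \<and> (\<lambda>n. N1 (xs n - ys n)) \<longlonglongrightarrow> 0"
  by (simp add: Lp_rel_def)

lemma mem_cls: "ys \<in> cls xs \<longleftrightarrow> xs \<in> C1 \<and> ys \<in> C1 \<and> (\<lambda>n. N1 (xs n - ys n)) \<longlonglongrightarrow> 0"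
  by simp

lemma cls_self: "xs \<in> C1 \<Longrightarrow> xs \<in> cls xs"
  by (simp add: mem_cls)

lemma null_sym:
  assumes "xs \<in> C1" "ys \<in> C1" "(\<lambda>n. N1 (xs n - ys n)) \<longlonglongrightarrow> 0"
  shows "(\<lambda>n. N1 (ys n - xs n)) \<longlonglongrightarrow> 0"
  using assms(3) N1_minus[OF assms(1,2)[THEN Lp_cauchy_mem]] by simp

lemma null_trans:
  assumes m: "xs \<in> C1" "ys \<in> C1" "zs \<in> C1"
    and null: "(\<lambda>n. N1 (xs n - ys n)) \<longlonglongrightarrow> 0" "(\<lambda>n. N1 (ys n - zs n)) \<longlonglongrightarrow> 0"
  shows "(\<lambda>n. N1 (xs n - zs n)) \<longlonglongrightarrow> 0"
proof (rule LIMSEQ_null_le)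
  note m = m[THEN Lp_cauchy_mem]
  show "(\<lambda>n. N1 (xs n - ys n) + N1 (ys n - zs n)) \<longlonglongrightarrow> 0"
    using tendsto_add[OF null] by simp
  show "N1 (xs n - zs n) \<le> N1 (xs n - ys n) + N1 (ys n - zs n)" for n
    using m by (intro N1_triangle_diff)
  show "0 \<le> N1 (xs n - zs n)" for n
    using m by (intro N1_nonneg diff_mem)
qed

lemma cls_eq:
  assumes "xs \<in> C1" "ys \<in> C1" "(\<lambda>n. N1 (xs n - ys n)) \<longlonglongrightarrow> 0"
  shows "cls xs = cls ys"
proof -
  have "zs \<in> cls ys" if "zs \<in> cls xs" for zs
    using that assms null_trans[of ys xs zs] null_sym[OF assms] by (simp add: mem_cls)
  moreover have "zs \<in> cls xs" if "zs \<in> cls ys" for zs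
    using that assms null_trans[of xs ys zs] by (simp add: mem_cls)
  ultimately show ?thesis by blast
qed

lemma cls_eq_iff:
  assumes "xs \<in> C1" "ys \<in> C1"
  shows "cls xs = cls ys \<longleftrightarrow> (\<lambda>n. N1 (xs n - ys n)) \<longlonglongrightarrow> 0"
proof
  assume "cls xs = cls ys"
  then have "ys \<in> cls xs" using cls_self[OF assms(2)] by (simp only:)
  then show "(\<lambda>n. N1 (xs n - ys n)) \<longlonglongrightarrow> 0" by simp
qed (rule cls_eq[OF assms])

lemma cls_in_Lp: "xs \<in> C1 \<Longrightarrow> cls xs \<in> Lp A \<phi> (Suc 0)"
  unfolding Lp_def by (rule quotientI)

lemma Lp_cases:
  assumes "X \<in> Lp A \<phi> (Suc 0)"
  obtains xs where "xs \<in> C1" "X = cls xs"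
  using assms unfolding Lp_def by (rule quotientE)

lemma Lp_mem:
  assumes "X \<in> Lp A \<phi> (Suc 0)" "xs \<in> X"
  shows "xs \<in> C1" "X = cls xs"
proof -
  obtain ys where ys: "ys \<in> C1" "X = cls ys" using Lp_cases[OF assms(1)] .
  with assms(2) show "xs \<in> C1" by (simp add: mem_cls)
  moreover have "(\<lambda>n. N1 (ys n - xs n)) \<longlonglongrightarrow> 0" using assms(2) ys by simp
  ultimately show "X = cls xs" unfolding ys(2) by (rule cls_eq[OF ys(1)])
qed

lemma phi_null:
  assumes "\<And>n. xs n \<in> A" "\<And>n. ys n \<in> A" "(\<lambda>n. N1 (xs n - ys n)) \<longlonglongrightarrow> 0"
  shows "(\<lambda>n. \<phi> (xs n) - \<phi> (ys n)) \<longlonglongrightarrow> 0"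
proof (rule Lim_null_comparison[OF _ assms(3)])
  show "eventually (\<lambda>n. cmod (\<phi> (xs n) - \<phi> (ys n)) \<le> N1 (xs n - ys n)) sequentially"
    using phi_le_N1[OF diff_mem[OF assms(1,2)]] assms(1,2) by (simp add: phi_diff)
qed

lemma C1_phi_convergent:
  assumes "xs \<in> C1"
  obtains t where "(\<lambda>n. \<phi> (xs n)) \<longlonglongrightarrow> t"
proof (rule Lp_cauchy_convergent[OF assms])
  show "dist (\<phi> x) (\<phi> y) \<le> N1 (x - y)" if "x \<in> A" "y \<in> A" for x y
    using phi_le_N1[OF diff_mem[OF that]] that by (simp add: dist_norm phi_diff)
qed (rule that)

lemma C2_norm_convergent:
  assumes "xs \<in> C2"
  obtains r where "(\<lambda>n. N2 (xs n)) \<longlonglongrightarrow> r"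
proof (rule Lp_cauchy_convergent[OF assms])
  show "dist (N2 x) (N2 y) \<le> N2 (x - y)" if "x \<in> A" "y \<in> A" for x y
    using N2_abs_diff[OF that] by (simp add: dist_real_def)
qed (rule that)

lemma L1_trace_cls:
  assumes "xs \<in> C1" "(\<lambda>n. \<phi> (xs n)) \<longlonglongrightarrow> t"
  shows "L1_trace \<phi> (cls xs) = t"
  unfolding L1_trace_def
proof (rule the_equality)
  show "\<forall>ys\<in>cls xs. (\<lambda>n. \<phi> (ys n)) \<longlonglongrightarrow> t"
  proof
    fix ys assume "ys \<in> cls xs"
    then have "(\<lambda>n. \<phi> (xs n) - \<phi> (ys n)) \<longlonglongrightarrow> 0"
      unfolding mem_cls by (intro phi_null) (auto dest: Lp_cauchy_mem)
    from tendsto_diff[OF assms(2) this] show "(\<lambda>n. \<phi> (ys n)) \<longlonglongrightarrow> t" by simp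
  qed
  show "s = t" if "\<forall>ys\<in>cls xs. (\<lambda>n. \<phi> (ys n)) \<longlonglongrightarrow> s" for s
    using that cls_self[OF assms(1)] assms(2) LIMSEQ_unique by blast
qed

lemma L1_of_cls: "L1_of A \<phi> x = cls (\<lambda>n. x)"
  by (simp add: L1_of_def)

text \<open>The definition is a union over all pairs of representatives; every pair yields the same
  class, so the union collapses to it. The other operations on classes are handled in the same
  way.\<close>

lemma L1_diff_cls:
  assumes "xs \<in> C1" "ys \<in> C1"
  shows "L1_diff A \<phi> (cls xs) (cls ys) = cls (\<lambda>n. xs n - ys n)"
proof -
  have "cls (\<lambda>n. xs' n - ys' n) = cls (\<lambda>n. xs n - ys n)" if "xs' \<in> cls xs" "ys' \<in> cls ys" for xs' ys'
  proof (rule cls_eq)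
    have C: "xs' \<in> C1" "ys' \<in> C1" using that by (simp_all add: mem_cls)
    note m = assms[THEN Lp_cauchy_mem] C[THEN Lp_cauchy_mem]
    show "(\<lambda>n. xs' n - ys' n) \<in> C1" "(\<lambda>n. xs n - ys n) \<in> C1" by (intro C1_diff C assms)+
    show "(\<lambda>n. N1 (xs' n - ys' n - (xs n - ys n))) \<longlonglongrightarrow> 0"
    proof (rule LIMSEQ_null_le)
      show "(\<lambda>n. N1 (xs n - xs' n) + N1 (ys n - ys' n)) \<longlonglongrightarrow> 0"
        using that tendsto_add[of "\<lambda>n. N1 (xs n - xs' n)" 0 _ "\<lambda>n. N1 (ys n - ys' n)" 0] by (simp add: mem_cls)
      show "N1 (xs' n - ys' n - (xs n - ys n)) \<le> N1 (xs n - xs' n) + N1 (ys n - ys' n)" for n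
        using N1_triangle_minus[of "ys n - ys' n" "xs n - xs' n"] m by (simp add: diff_mem algebra_simps)
      show "0 \<le> N1 (xs' n - ys' n - (xs n - ys n))" for n using m by (intro N1_nonneg diff_mem)
    qed
  qed
  then show ?thesis
    unfolding L1_diff_def One_nat_def
    by (intro UN_constant_eq[OF cls_self[OF assms(1)]] UN_constant_eq[OF cls_self[OF assms(2)]] ballI)
qed

lemma C1_sum: "(\<And>i. i \<in> I \<Longrightarrow> x i \<in> C1) \<Longrightarrow> (\<lambda>n. \<Sum>i\<in>I. x i n) \<in> C1"
  by (induction I rule: infinite_finite_induct) (auto intro!: C1_const C1_add)

lemma L1_sum_cls:
  assumes x: "\<And>i. i \<in> I \<Longrightarrow> x i \<in> C1"
  shows "L1_sum A \<phi> I (\<lambda>i. cls (x i)) = cls (\<lambda>n. \<Sum>i\<in>I. x i n)"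
proof -
  have "cls (\<lambda>n. \<Sum>i\<in>I. y i n) = cls (\<lambda>n. \<Sum>i\<in>I. x i n)" if y: "\<forall>i\<in>I. y i \<in> cls (x i)" for y
  proof (rule cls_eq)
    have C: "y i \<in> C1" if "i \<in> I" for i using that y by (simp add: mem_cls)
    show "(\<lambda>n. \<Sum>i\<in>I. y i n) \<in> C1" "(\<lambda>n. \<Sum>i\<in>I. x i n) \<in> C1" by (intro C1_sum C x; assumption)+
    have N1_sum: "N1 (\<Sum>i\<in>I. f i) \<le> (\<Sum>i\<in>I. N1 (f i))" if "\<And>i. i \<in> I \<Longrightarrow> f i \<in> A" for f
      using that
    proof (induction I rule: infinite_finite_induct)
      case (insert i I)
      then show ?case using N1_triangle[of "f i" "sum f I"] by (simp add: sum_mem)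
    qed auto
    show "(\<lambda>n. N1 ((\<Sum>i\<in>I. y i n) - (\<Sum>i\<in>I. x i n))) \<longlonglongrightarrow> 0"
    proof (rule LIMSEQ_null_le)
      have "(\<lambda>n. \<Sum>i\<in>I. N1 (x i n - y i n)) \<longlonglongrightarrow> (\<Sum>i\<in>I. 0)"
        using y by (intro tendsto_sum) (simp add: mem_cls)
      then show "(\<lambda>n. \<Sum>i\<in>I. N1 (x i n - y i n)) \<longlonglongrightarrow> 0" by simp
      show "N1 ((\<Sum>i\<in>I. y i n) - (\<Sum>i\<in>I. x i n)) \<le> (\<Sum>i\<in>I. N1 (x i n - y i n))" for n
      proof -
        have "N1 ((\<Sum>i\<in>I. y i n) - (\<Sum>i\<in>I. x i n)) \<le> (\<Sum>i\<in>I. N1 (y i n - x i n))"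
          unfolding sum_subtractf[symmetric]
          by (rule N1_sum) (auto intro: Lp_cauchy_mem C x)
        also have "\<dots> = (\<Sum>i\<in>I. N1 (x i n - y i n))"
          by (intro sum.cong refl N1_minus) (auto intro: Lp_cauchy_mem C x)
        finally show ?thesis .
      qed
      show "0 \<le> N1 ((\<Sum>i\<in>I. y i n) - (\<Sum>i\<in>I. x i n))" for n
        by (intro N1_nonneg diff_mem sum_mem) (auto intro: Lp_cauchy_mem C x)
    qed
  qed
  moreover have "x \<in> {y. \<forall>i\<in>I. y i \<in> cls (x i)}" using x by simp
  ultimately show ?thesis
    unfolding L1_sum_def One_nat_def by (intro UN_constant_eq[where a = x] ballI) blast+
qed

lemma L1_prod_cls_iff:
  assumes v: "v \<in> C2" and w: "w \<in> C2"
  shows "L1_prod A \<phi> (cls v) (cls w) Z \<longleftrightarrow> Z = cls (\<lambda>n. v n \<cdot> w n)"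
proof
  have vw: "(\<lambda>n. v n \<cdot> w n) \<in> C1" by (rule C2_mult[OF v w])
  have C: "v \<in> C1" "w \<in> C1" using v w by (auto intro: C2_subset_C1)
  assume "L1_prod A \<phi> (cls v) (cls w) Z"
  then obtain x y where Z: "Z \<in> Lp A \<phi> (Suc 0)" and xy: "x \<in> cls v" "y \<in> cls w" "(\<lambda>n. x n \<cdot> y n) \<in> Z"
    unfolding L1_prod_def by auto
  note z = Lp_mem[OF Z xy(3)]
  have C': "x \<in> C1" "y \<in> C1" and null: "(\<lambda>n. N1 (v n - x n)) \<longlonglongrightarrow> 0" "(\<lambda>n. N1 (w n - y n)) \<longlonglongrightarrow> 0"
    using xy by (simp_all add: mem_cls)
  note m = C[THEN Lp_cauchy_mem] C'[THEN Lp_cauchy_mem]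
  obtain K where K: "0 \<le> K" "\<And>n. N1 (y n) \<le> K" using C1_bounded[OF C'(2)] by blast
  obtain L where L: "0 \<le> L" "\<And>n. N1 (v n) \<le> L" using C1_bounded[OF C(1)] by blast
  have "(\<lambda>n. N1 (x n \<cdot> y n - v n \<cdot> w n)) \<longlonglongrightarrow> 0"
  proof (rule product_limit_unique[where K = "K + L"])
    show "N1 (y n) \<le> K + L" "N1 (v n) \<le> K + L" for n using K(2)[of n] L(2)[of n] K(1) L(1) by linarith+
    show "(\<lambda>n. N1 (x n - v n)) \<longlonglongrightarrow> 0" "(\<lambda>n. N1 (y n - w n)) \<longlonglongrightarrow> 0"
      by (rule null_sym[OF C(1) C'(1) null(1)], rule null_sym[OF C(2) C'(2) null(2)])
    show "(\<lambda>n. x n \<cdot> y n - v n \<cdot> w n) \<in> C1" by (rule C1_diff[OF z(1) vw])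
  qed (rule m)+
  then show "Z = cls (\<lambda>n. v n \<cdot> w n)" unfolding z(2) by (rule cls_eq[OF z(1) vw])
next
  have vw: "(\<lambda>n. v n \<cdot> w n) \<in> C1" by (rule C2_mult[OF v w])
  have C: "v \<in> C1" "w \<in> C1" using v w by (auto intro: C2_subset_C1)
  assume "Z = cls (\<lambda>n. v n \<cdot> w n)"
  then show "L1_prod A \<phi> (cls v) (cls w) Z"
    using cls_in_Lp[OF vw] cls_self[OF vw] cls_self[OF C(1)] cls_self[OF C(2)]
    unfolding L1_prod_def One_nat_def by (metis (no_types, lifting))
qed

lemma prod_in_L1_cls: "v \<in> C2 \<Longrightarrow> w \<in> C2 \<Longrightarrow> prod_in_L1 A \<phi> (cls v) (cls w)"
  by (simp add: prod_in_L1_def L1_prod_cls_iff)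

lemma L1_mult_cls: "v \<in> C2 \<Longrightarrow> w \<in> C2 \<Longrightarrow> L1_mult A \<phi> (cls v) (cls w) = cls (\<lambda>n. v n \<cdot> w n)"
  by (simp add: L1_mult_def L1_prod_cls_iff)

text \<open>Two 2-Cauchy representatives of one class differ by a 2-null sequence, by
  \<open>C2_null\<close>, so their norms have the same limit.\<close>

lemma Lp_norm_cls:
  assumes v: "v \<in> C2" and r: "(\<lambda>n. N2 (v n)) \<longlonglongrightarrow> r"
  shows "Lp_norm A \<phi> 2 (cls v) = ereal r"
proof -
  have C: "v \<in> C1" by (rule C2_subset_C1[OF v])
  have vv: "v \<in> cls v \<inter> C2" using v cls_self[OF C] by simp
  have "(THE r. \<forall>xs \<in> cls v \<inter> C2. (\<lambda>n. N2 (xs n)) \<longlonglongrightarrow> r) = r"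
  proof (rule the_equality)
    show "\<forall>xs \<in> cls v \<inter> C2. (\<lambda>n. N2 (xs n)) \<longlonglongrightarrow> r"
    proof
      fix x assume "x \<in> cls v \<inter> C2"
      then have x: "x \<in> C2" and null: "(\<lambda>n. N1 (v n - x n)) \<longlonglongrightarrow> 0" by (auto simp: mem_cls)
      note m = v[THEN Lp_cauchy_mem] x[THEN Lp_cauchy_mem]
      have "(\<lambda>n. N2 (v n - x n)) \<longlonglongrightarrow> 0" by (rule C2_null[OF C2_diff[OF v x] null])
      then have "(\<lambda>n. N2 (v n) - N2 (x n)) \<longlonglongrightarrow> 0"
        by (rule Lim_null_comparison[rotated]) (use N2_abs_diff[OF m] in simp)
      from tendsto_diff[OF r this] show "(\<lambda>n. N2 (x n)) \<longlonglongrightarrow> r" by simp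
    qed
    show "s = r" if "\<forall>xs \<in> cls v \<inter> C2. (\<lambda>n. N2 (xs n)) \<longlonglongrightarrow> s" for s
      using that vv r LIMSEQ_unique by blast
  qed
  moreover have "cls v \<inter> C2 \<noteq> {}" using vv by blast
  ultimately show ?thesis unfolding Lp_norm_def by (simp only: if_False)
qed

end

text \<open>Stated for two algebras because taking a matrix entry leads from matrices over M to
  M.\<close>

lemma L1_map_cls:
  assumes "tracial_algebra A \<phi>" "tracial_algebra B \<psi>"
    and T: "\<And>x. x \<in> B \<Longrightarrow> T x \<in> A"
    and lip: "\<And>x y. x \<in> B \<Longrightarrow> y \<in> B \<Longrightarrow> pnorm \<phi> (Suc 0) (T x - T y) \<le> k * pnorm \<psi> (Suc 0) (x - y)"
    and k: "0 \<le> k" and xs: "xs \<in> Lp_cauchy B \<psi> (Suc 0)"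
  shows "(\<lambda>n. T (xs n)) \<in> Lp_cauchy A \<phi> (Suc 0)"
    and "L1_map A \<phi> T (Lp_rel B \<psi> (Suc 0) `` {xs}) = Lp_rel A \<phi> (Suc 0) `` {\<lambda>n. T (xs n)}"
proof -
  interpret A: tracial_algebra A \<phi> by fact
  interpret B: tracial_algebra B \<psi> by fact
  have C: "(\<lambda>n. T (ys n)) \<in> A.C1" if ys: "ys \<in> B.C1" for ys
  proof (rule Lp_cauchy_dominated[OF _ ys ys k])
    note m = ys[THEN Lp_cauchy_mem]
    show "A.N1 (T (ys i) - T (ys j)) \<le> k * (B.N1 (ys i - ys j) + B.N1 (ys i - ys j))" for i j
      by (rule order_trans[OF lip[OF m m] mult_left_mono[OF add_increasing k]])
        (intro order_refl B.N1_nonneg B.diff_mem m)+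
  qed (rule T[OF Lp_cauchy_mem[OF ys]])
  show "(\<lambda>n. T (xs n)) \<in> A.C1" by (rule C[OF xs])
  have "A.cls (\<lambda>n. T (ys n)) = A.cls (\<lambda>n. T (xs n))" if "ys \<in> B.cls xs" for ys
  proof -
    have ys: "ys \<in> B.C1" and null: "(\<lambda>n. B.N1 (xs n - ys n)) \<longlonglongrightarrow> 0" using that by (auto simp: B.mem_cls)
    note m = xs[THEN Lp_cauchy_mem] ys[THEN Lp_cauchy_mem]
    have "(\<lambda>n. A.N1 (T (xs n) - T (ys n))) \<longlonglongrightarrow> 0"
      by (rule LIMSEQ_null_le[OF _ lip[OF m] tendsto_mult_right_zero[OF null]])
        (intro A.N1_nonneg A.diff_mem T m)
    then show ?thesis using A.cls_eq[OF C[OF xs] C[OF ys]] by simp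
  qed
  then show "L1_map A \<phi> T (B.cls xs) = A.cls (\<lambda>n. T (xs n))"
    unfolding L1_map_def One_nat_def by (intro UN_constant_eq[OF B.cls_self[OF xs]] ballI)
qed

section \<open>Self-adjoint classes and square-integrability\<close>

context tracial_algebra
begin

lemma L1_map_adj_cls:
  assumes "xs \<in> C1"
  shows "L1_map A \<phi> adj (cls xs) = cls (\<lambda>n. adj (xs n))"
proof (rule L1_map_cls(2)[where k = 1])
  show "N1 (adj x - adj y) \<le> 1 * N1 (x - y)" if "x \<in> A" "y \<in> A" for x y
    using that N1_adj[OF diff_mem[OF that]] by (simp add: adj_diff)
qed (use assms tracial_algebra_axioms in auto)

lemma L1_sa_Lp: "X \<in> L1_sa A \<phi> \<Longrightarrow> X \<in> Lp A \<phi> (Suc 0)"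
  by (simp add: L1_sa_def)

text \<open>Symmetrize: a = (x + adj x) / 2 differs from x by half of adj x - x up to sign, which is
  null because the class is invariant under the adjoint.\<close>

lemma L1_sa_representative:
  assumes X: "X \<in> L1_sa A \<phi>"
  obtains a where "a \<in> C1" "\<And>n. adj (a n) = a n" "X = cls a"
proof -
  obtain x where x: "x \<in> C1" "X = cls x" using Lp_cases[OF L1_sa_Lp[OF X]] .
  note m = x(1)[THEN Lp_cauchy_mem]
  have "cls (\<lambda>n. adj (x n)) = cls x"
    using X x L1_map_adj_cls[OF x(1)] by (simp add: L1_sa_def)
  then have null: "(\<lambda>n. N1 (adj (x n) - x n)) \<longlonglongrightarrow> 0"
    by (simp only: cls_eq_iff[OF C1_adj[OF x(1)] x(1)])
  define a where "a n = (1/2) *\<^sub>R (x n + adj (x n))" for n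
  have aA: "a n \<in> A" for n unfolding a_def using m by blast
  have null': "(\<lambda>n. N1 (x n - a n)) \<longlonglongrightarrow> 0"
  proof (rule LIMSEQ_null_le[OF _ _ null])
    show "N1 (x n - a n) \<le> N1 (adj (x n) - x n)" for n
    proof -
      have "x n - a n = (- (1/2)) *\<^sub>R (adj (x n) - x n)"
        using scaleR_half_double[of "x n"] unfolding scaleR_add_right
        by (simp add: a_def scaleR_add_right scaleR_diff_right diff_eq_eq)
      then have "N1 (x n - a n) \<le> \<bar>- (1/2)\<bar> * N1 (adj (x n) - x n)"
        using N1_scaleR_le[of "adj (x n) - x n" "- (1/2)"] m by (simp add: diff_mem adj_mem)
      also have "\<dots> \<le> N1 (adj (x n) - x n)" using N1_nonneg[of "adj (x n) - x n"] m
        by (simp add: diff_mem adj_mem)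
      finally show ?thesis .
    qed
    show "0 \<le> N1 (x n - a n)" for n using m aA by (simp add: diff_mem)
  qed
  have aC: "a \<in> C1" by (rule C1_null_equiv[OF x(1) aA null'])
  show ?thesis
  proof (rule that[OF aC])
    show "adj (a n) = a n" for n
      using m by (simp add: a_def adj_scaleR adj_add add_mem adj_mem add.commute)
    show "X = cls a" unfolding x(2) by (rule cls_eq[OF x(1) aC null'])
  qed
qed

lemma L1_sa_diff:
  assumes "X \<in> L1_sa A \<phi>" "Y \<in> L1_sa A \<phi>"
  shows "L1_diff A \<phi> X Y \<in> L1_sa A \<phi>"
proof -
  obtain a where a: "a \<in> C1" "\<And>n. adj (a n) = a n" "X = cls a" using L1_sa_representative[OF assms(1)] by blast
  obtain b where b: "b \<in> C1" "\<And>n. adj (b n) = b n" "Y = cls b" using L1_sa_representative[OF assms(2)] by blast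
  note m = a(1)[THEN Lp_cauchy_mem] b(1)[THEN Lp_cauchy_mem]
  have C: "(\<lambda>n. a n - b n) \<in> C1" by (rule C1_diff[OF a(1) b(1)])
  have "L1_diff A \<phi> X Y = cls (\<lambda>n. a n - b n)" unfolding a(3) b(3) by (rule L1_diff_cls[OF a(1) b(1)])
  then show ?thesis
    using m C by (simp add: L1_sa_def L1_map_adj_cls cls_in_Lp adj_diff a(2) b(2))
qed

lemma square_integrable_if_product:
  assumes V: "V \<in> L1_sa A \<phi>" and W: "W \<in> Lp A \<phi> (Suc 0)" and VW: "prod_in_L1 A \<phi> V W"
    and d: "d \<in> C2" "L1_diff A \<phi> V W = cls d"
  obtains v where "v \<in> C2" "\<And>n. adj (v n) = v n" "V = cls v"
proof -
  obtain a where a: "a \<in> C1" "\<And>n. adj (a n) = a n" "V = cls a" using L1_sa_representative[OF V] by blast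
  obtain Z x y where Z: "Z \<in> Lp A \<phi> (Suc 0)" and xy: "x \<in> V" "y \<in> W" "(\<lambda>n. x n \<cdot> y n) \<in> Z"
    using VW unfolding prod_in_L1_def L1_prod_def by auto
  note y = Lp_mem[OF W xy(2)]
  have x: "x \<in> C1" "(\<lambda>n. N1 (a n - x n)) \<longlonglongrightarrow> 0" using xy(1) a by (simp_all add: mem_cls)
  have dC: "d \<in> C1" by (rule C2_subset_C1[OF d(1)])
  have "cls (\<lambda>n. a n - y n) = cls d"
    using d(2) unfolding a(3) y(2) L1_diff_cls[OF a(1) y(1)] .
  then have ayd: "(\<lambda>n. N1 (a n - y n - d n)) \<longlonglongrightarrow> 0"
    by (simp only: cls_eq_iff[OF C1_diff[OF a(1) y(1)] dC])
  obtain w where w: "w \<in> C2" "\<And>n. adj (w n) = w n" "(\<lambda>n. N1 (w n - a n)) \<longlonglongrightarrow> 0"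
    using square_integrable_representative[OF a(1,2) Lp_cauchy_mem[OF x(1)] null_sym[OF a(1) x] y(1) d(1) ayd
        Lp_mem(1)[OF Z xy(3)]] by blast
  have "V = cls w" unfolding a(3) using cls_eq[OF C2_subset_C1[OF w(1)] a(1) w(3)] by simp
  then show ?thesis using that w by blast
qed

text \<open>The case W = V of \<open>square_integrable_if_product\<close>, with difference
  0.\<close>

lemma square_integrable_if_square:
  assumes V: "V \<in> L1_sa A \<phi>" and VV: "prod_in_L1 A \<phi> V V"
  obtains v where "v \<in> C2" "\<And>n. adj (v n) = v n" "V = cls v"
proof -
  obtain a where a: "a \<in> C1" "V = cls a" using Lp_cases[OF L1_sa_Lp[OF V]] .
  have "L1_diff A \<phi> V V = cls (\<lambda>n. 0)"
    unfolding a(2) using L1_diff_cls[OF a(1) a(1)] by simp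
  then show ?thesis
    using square_integrable_if_product[OF V L1_sa_Lp[OF V] VV C2_const[OF zero_mem]] that by blast
qed

end

section \<open>Matrix algebras\<close>

lemma bounded_linear_axis: "bounded_linear (axis i :: 'h::real_inner \<Rightarrow> 'h ^ 'd::finite)"
proof (rule bounded_linear_intro[where K = 1])
  show "norm (axis i x :: 'h ^ 'd) \<le> norm x * 1" for x :: 'h
    by (simp add: norm_eq_sqrt_inner inner_axis)
qed (simp_all add: vec_eq_iff axis_def)

lemma norm_axis [simp]: "norm (axis i x :: 'h::real_inner ^ 'd::finite) = norm x"
  by (simp add: norm_eq_sqrt_inner inner_axis)

lemma sum_axis: "(\<Sum>k\<in>UNIV. axis k (v $ k)) = (v :: 'h::real_inner ^ 'd::finite)"
  by (simp add: vec_eq_iff axis_def if_distrib cong: if_cong)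

lemma entry_apply [simp]: "blinfun_apply (entry i j X) v = blinfun_apply X (axis j v) $ i"
proof -
  have "bounded_linear (\<lambda>v. blinfun_apply X (axis j v) $ i)"
    by (intro bounded_linear_compose[OF bounded_linear_vec_nth]
        bounded_linear_compose[OF blinfun.bounded_linear_right bounded_linear_axis])
  then show ?thesis by (simp add: entry_def bounded_linear_Blinfun_apply)
qed

lemma apply_nth_eq_sum_entry:
  "blinfun_apply X v $ i = (\<Sum>j\<in>UNIV. entry i j X (v $ j))"
proof -
  have "X v = (\<Sum>j\<in>UNIV. X (axis j (v $ j)))"
    by (metis sum_axis blinfun.sum_right)
  then show ?thesis by (simp add: sum_component)
qed

lemma entry_add: "entry i j (X + Y) = entry i j X + entry i j Y"
  by (rule blinfun_eqI) (simp add: blinfun.add_left)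

lemma entry_diff: "entry i j (X - Y) = entry i j X - entry i j Y"
  by (rule blinfun_eqI) (simp add: blinfun.diff_left)

lemma entry_scale: "entry i j (op_scale c X) = op_scale c (entry i j X)"
  by (rule blinfun_eqI) (simp add: scaleC_vec_def)

lemma entry_scaleR: "entry i j (r *\<^sub>R X) = r *\<^sub>R entry i j X"
  by (rule blinfun_eqI) (simp add: blinfun.scaleR_left)

lemma entry_id: "entry i j id_blinfun = (if i = j then id_blinfun else 0)"
  by (rule blinfun_eqI) (auto simp: axis_def)

lemma entry_compose: "entry i j (X \<cdot> Y) = (\<Sum>k\<in>UNIV. entry i k X \<cdot> entry k j Y)"
  by (rule blinfun_eqI) (simp add: blinfun.sum_left apply_nth_eq_sum_entry[of X "Y (axis j _)"])

lemma norm_entry_le: "norm (entry i j X) \<le> norm X"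
proof (rule norm_blinfun_bound)
  show "norm (entry i j X v) \<le> norm X * norm v" for v
    using order_trans[OF Finite_Cartesian_Product.norm_nth_le norm_blinfun, of X "axis j v" i] by simp
qed simp

lemma scaleC_axis: "axis j (c *\<^sub>C x) = c *\<^sub>C axis j x" for x :: "'h::complex_hilbert"
  by (simp add: vec_eq_iff axis_def scaleC_vec_def)

lemma entry_in_BH: "X \<in> BH \<Longrightarrow> entry i j X \<in> BH"
  by (simp add: BH_def scaleC_axis) (simp add: scaleC_vec_def)

lemma cinner_axis: "cinner v (axis i y) = cinner (v $ i) y" for y :: "'h::complex_hilbert"
  by (rule cinner_eqI) (simp_all add: inner_axis flip: scaleC_axis)

lemma cinner_axis_left: "cinner (axis i y) v = cinner y (v $ i)" for y :: "'h::complex_hilbert"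
  by (metis cinner_axis cinner_commute)

lemma is_adjoint_entry: "is_adjoint X Y \<Longrightarrow> is_adjoint (entry i j X) (entry j i Y)"
  unfolding is_adjoint_def by (simp flip: cinner_axis cinner_axis_left)

lemma is_adjointI_entry:
  fixes X Y :: "('h::complex_hilbert ^ 'd::finite) bop"
  assumes "X \<in> BH" "Y \<in> BH" "\<And>i j. is_adjoint (entry i j X) (entry j i Y)"
  shows "is_adjoint X Y"
proof (rule is_adjointI[OF assms(1,2)])
  fix v w
  have "X v \<bullet> w = (\<Sum>i\<in>UNIV. \<Sum>j\<in>UNIV. entry i j X (v $ j) \<bullet> (w $ i))"
    by (simp add: inner_vec_def apply_nth_eq_sum_entry[of X] inner_sum_left del: entry_apply)
  also have "\<dots> = (\<Sum>i\<in>UNIV. \<Sum>j\<in>UNIV. v $ j \<bullet> entry j i Y (w $ i))"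
    by (intro sum.cong refl is_adjointD assms)
  also have "\<dots> = (\<Sum>j\<in>UNIV. \<Sum>i\<in>UNIV. v $ j \<bullet> entry j i Y (w $ i))"
    by (rule sum.swap)
  also have "\<dots> = v \<bullet> Y w"
    by (simp add: inner_vec_def apply_nth_eq_sum_entry[of Y] inner_sum_right del: entry_apply)
  finally show "X v \<bullet> w = v \<bullet> Y w" .
qed

lemma positive_op_entry: "positive_op X \<Longrightarrow> positive_op (entry i i X)"
proof (rule positive_opI)
  assume X: "positive_op X"
  show "entry i i X \<in> BH" "is_adjoint (entry i i X) (entry i i X)"
    using X by (simp_all add: positive_opD entry_in_BH is_adjoint_entry)
  show "0 \<le> x \<bullet> entry i i X x" for x
    using positive_opD(3)[OF X, of "axis i x"] by (simp add: inner_axis')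
qed

text \<open>Composing each entry with a coordinate projection and an embedding makes boundedness
  automatic.\<close>

definition matrix_of :: "('d::finite \<Rightarrow> 'd \<Rightarrow> 'h::complex_hilbert bop) \<Rightarrow> ('h ^ 'd) bop" where
  "matrix_of e = (\<Sum>i\<in>UNIV. \<Sum>j\<in>UNIV. Blinfun (axis i) o\<^sub>L (e i j o\<^sub>L Blinfun (\<lambda>v. v $ j)))"

lemma matrix_of_apply: "matrix_of e v $ i = (\<Sum>j\<in>UNIV. blinfun_apply (e i j) (v $ j))"
proof -
  have "matrix_of e v $ i
      = (\<Sum>k\<in>UNIV. \<Sum>j\<in>UNIV. axis k (blinfun_apply (e k j) (v $ j)) $ i)"
    by (simp add: matrix_of_def blinfun.sum_left sum_component bounded_linear_Blinfun_apply
        bounded_linear_axis bounded_linear_vec_nth)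
  also have "\<dots> = (\<Sum>k\<in>UNIV. if k = i then \<Sum>j\<in>UNIV. blinfun_apply (e i j) (v $ j) else 0)"
    by (intro sum.cong refl) (auto simp: axis_def)
  finally show ?thesis by simp
qed

lemma entry_matrix_of [simp]: "entry i j (matrix_of e) = e i j"
proof (rule blinfun_eqI)
  fix x
  have "entry i j (matrix_of e) x = (\<Sum>k\<in>UNIV. if k = j then blinfun_apply (e i k) x else 0)"
    unfolding entry_apply matrix_of_apply by (intro sum.cong refl) (auto simp: axis_def)
  then show "entry i j (matrix_of e) x = blinfun_apply (e i j) x" by simp
qed

lemma matrix_of_in_BH: "(\<And>i j. e i j \<in> BH) \<Longrightarrow> matrix_of e \<in> BH"
  by (simp add: BH_def vec_eq_iff matrix_of_apply scaleC_vec_def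
      linear_sum[OF bounded_linear.linear[OF bounded_linear_scaleC]])

lemma scalar_matrix_eq:
  "scalar_matrix C = (matrix_of (\<lambda>i j. op_scale (C $ i $ j) id_blinfun) :: ('h::complex_hilbert ^ 'd::finite) bop)"
proof -
  have "(\<lambda>v :: 'h ^ 'd. \<chi> i. \<Sum>j\<in>UNIV. (C $ i $ j) *\<^sub>C (v $ j))
    = blinfun_apply (matrix_of (\<lambda>i j. op_scale (C $ i $ j) id_blinfun))"
    by (simp add: fun_eq_iff vec_eq_iff matrix_of_apply)
  then show ?thesis unfolding scalar_matrix_def by (simp only: blinfun_apply_inverse)
qed

text \<open>The elementary matrix e_ji tensored with u. Multiplying by it isolates a single entry
  under the trace.\<close>

definition matrix_unit :: "'d::finite \<Rightarrow> 'd \<Rightarrow> 'h::complex_hilbert bop \<Rightarrow> ('h ^ 'd) bop" where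
  "matrix_unit j i u = matrix_of (\<lambda>k l. if k = j \<and> l = i then u else 0)"

lemma norm_matrix_unit_le: "norm (matrix_unit j i u) \<le> norm u"
proof (rule norm_blinfun_bound)
  fix v
  have "matrix_unit j i u v = axis j (u (v $ i))"
    by (auto simp: vec_eq_iff matrix_unit_def matrix_of_apply axis_def if_distrib[of blinfun_apply]
        if_distrib[of "\<lambda>f. f _"] cong: if_cong)
  then have "norm (matrix_unit j i u v) \<le> norm u * norm (v $ i)"
    by (simp add: norm_blinfun)
  also have "\<dots> \<le> norm u * norm v"
    by (intro mult_left_mono Finite_Cartesian_Product.norm_nth_le) simp
  finally show "norm (matrix_unit j i u v) \<le> norm u * norm v" .
qed simp

locale matrix_algebra = M: tracial_algebra M \<tau>
  for M :: "'h::complex_hilbert bop set" and \<tau> :: "'h bop \<Rightarrow> complex" +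
  fixes A :: "('h ^ 'd::finite) bop set" and \<phi> :: "('h ^ 'd) bop \<Rightarrow> complex"
  assumes A_def: "A = matrices M" and phi_def: "\<phi> = tau_bar \<tau>"
begin

lemma in_A_iff: "X \<in> A \<longleftrightarrow> X \<in> BH \<and> (\<forall>i j. entry i j X \<in> M)"
  by (simp add: A_def matrices_def)

lemma entry_in_M: "X \<in> A \<Longrightarrow> entry i j X \<in> M"
  by (simp add: in_A_iff)

lemma matrix_of_in_A: "(\<And>i j. e i j \<in> M) \<Longrightarrow> matrix_of e \<in> A"
  by (simp add: in_A_iff matrix_of_in_BH M.mem_BH)

lemma phi_eq: "X \<in> A \<Longrightarrow> \<phi> X = (\<Sum>i\<in>UNIV. \<tau> (entry i i X)) / of_nat CARD('d)"
  by (simp add: phi_def tau_bar_def mat_tr_def M.phi_scaleR M.sum_mem entry_in_M M.phi_sum)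

lemma op_algebra_A: "op_algebra A"
proof
  show "A \<subseteq> BH" by (auto simp: in_A_iff)
  show "id_blinfun \<in> A" by (simp add: in_A_iff entry_id)
  show "a + b \<in> A" if "a \<in> A" "b \<in> A" for a b
    using that by (auto simp: in_A_iff entry_add BH_add)
  show "op_scale c a \<in> A" if "a \<in> A" for c a
    using that by (auto simp: in_A_iff entry_scale BH_scale)
  show "a \<cdot> b \<in> A" if "a \<in> A" "b \<in> A" for a b
    using that by (simp add: in_A_iff entry_compose BH_compose M.sum_mem M.comp_mem)
  show "\<exists>b\<in>A. is_adjoint a b" if a: "a \<in> A" for a
  proof
    let ?b = "matrix_of (\<lambda>j i. adj (entry i j a))"
    show b: "?b \<in> A" using a by (intro matrix_of_in_A M.adj_mem entry_in_M)
    show "is_adjoint a ?b"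
      using a b by (intro is_adjointI_entry) (simp_all add: in_A_iff M.is_adjoint_adj)
  qed
  have cont: "continuous_on UNIV (entry i j :: ('h ^ 'd) bop \<Rightarrow> 'h bop)" for i j
  proof (intro linear_continuous_on bounded_linear_intro[where K = 1])
    show "norm (entry i j X :: 'h bop) \<le> norm X * 1" for X :: "('h ^ 'd) bop"
      using norm_entry_le by simp
  qed (simp_all add: entry_add entry_scaleR)
  have "A = BH \<inter> (\<Inter>i j. entry i j -` M)" by (auto simp: in_A_iff)
  moreover have "closed (entry i j -` M :: ('h ^ 'd) bop set)" for i j
    by (rule closed_vimage[OF M.closed_A cont])
  ultimately show "closed A"
    by (simp add: closed_Int closed_BH closed_INT)
qed

sublocale tracial_algebra A \<phi>
proof (intro tracial_algebra.intro tracial_algebra_axioms.intro op_algebra_A)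
  interpret op_algebra A by (rule op_algebra_A)
  show "\<phi> (a + b) = \<phi> a + \<phi> b" if "a \<in> A" "b \<in> A" for a b
    using that by (simp add: phi_eq add_mem entry_add M.phi_add entry_in_M sum.distrib add_divide_distrib)
  show "\<phi> (op_scale c a) = c * \<phi> a" if "a \<in> A" for c a
    using that by (simp add: phi_eq scale_mem entry_scale M.phi_scale entry_in_M sum_distrib_left)
  show "\<phi> a \<in> \<real> \<and> 0 \<le> Re (\<phi> a)" if a: "a \<in> A" "positive_op a" for a
  proof -
    have "\<tau> (entry i i a) \<in> \<real> \<and> 0 \<le> Re (\<tau> (entry i i a))" for i
      using a by (intro M.phi_positive entry_in_M positive_op_entry)
    then show ?thesis
      using a by (auto simp: phi_eq Re_divide_of_nat intro!: sum_nonneg divide_nonneg_nonneg)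
  qed
  show "\<phi> (a \<cdot> b) = \<phi> (b \<cdot> a)" if a: "a \<in> A" and b: "b \<in> A" for a b
  proof -
    have "(\<Sum>i\<in>UNIV. \<tau> (entry i i (a \<cdot> b))) = (\<Sum>i\<in>UNIV. \<Sum>k\<in>UNIV. \<tau> (entry i k a \<cdot> entry k i b))"
      using a b by (simp add: entry_compose M.phi_sum M.comp_mem entry_in_M)
    also have "\<dots> = (\<Sum>i\<in>UNIV. \<Sum>k\<in>UNIV. \<tau> (entry k i b \<cdot> entry i k a))"
      using a b by (intro sum.cong refl M.phi_commute entry_in_M)
    also have "\<dots> = (\<Sum>k\<in>UNIV. \<Sum>i\<in>UNIV. \<tau> (entry k i b \<cdot> entry i k a))"
      by (rule sum.swap)
    also have "\<dots> = (\<Sum>k\<in>UNIV. \<tau> (entry k k (b \<cdot> a)))"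
      using a b by (simp add: entry_compose M.phi_sum M.comp_mem entry_in_M)
    finally show ?thesis using a b by (simp add: phi_eq comp_mem)
  qed
  show "\<phi> id_blinfun = 1"
    by (simp add: phi_eq entry_id)
qed

text \<open>Duality in M tests the entry against u; the matrix unit carrying u at position (j, i)
  does the same test on X, and the normalization of the trace costs the factor d.\<close>

lemma N1_entry_le:
  assumes X: "X \<in> A"
  shows "M.N1 (entry i j X) \<le> real CARD('d) * N1 X"
proof (rule M.N1_leI[OF entry_in_M[OF X]])
  fix u assume u: "u \<in> M" "norm u \<le> 1"
  let ?U = "matrix_unit j i u"
  have U: "?U \<in> A" unfolding matrix_unit_def using u by (intro matrix_of_in_A) auto
  have "entry k k (?U \<cdot> X) = (if k = j then u \<cdot> entry i j X else 0)" for k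
  proof -
    have "entry k k (?U \<cdot> X) = (\<Sum>l\<in>UNIV. if l = i then (if k = j then u \<cdot> entry i j X else 0) else 0)"
      unfolding entry_compose by (intro sum.cong refl) (auto simp: matrix_unit_def)
    then show ?thesis by simp
  qed
  then have "\<phi> (?U \<cdot> X) = \<tau> (u \<cdot> entry i j X) / of_nat CARD('d)"
    using U X by (simp add: phi_eq comp_mem if_distrib[of \<tau>] cong: if_cong)
  then have "cmod (\<tau> (u \<cdot> entry i j X)) = real CARD('d) * cmod (\<phi> (?U \<cdot> X))"
    by (simp add: norm_divide)
  also have "\<dots> \<le> real CARD('d) * N1 X"
    using U X u norm_matrix_unit_le[of j i u] by (intro mult_left_mono phi_compose_le_N1) auto
  finally show "cmod (\<tau> (u \<cdot> entry i j X)) \<le> real CARD('d) * N1 X" .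
qed

lemma adj_entry: "X \<in> A \<Longrightarrow> entry i j (adj X) = adj (entry j i X)"
  by (intro adj_eqI[symmetric] is_adjoint_entry is_adjoint_adj)

lemma N2_square_entries:
  assumes X: "X \<in> A"
  shows "(N2 X)\<^sup>2 = (\<Sum>i\<in>UNIV. \<Sum>j\<in>UNIV. (M.N2 (entry i j X))\<^sup>2) / real CARD('d)"
proof -
  have "\<tau> (entry i i (adj X \<cdot> X)) = (\<Sum>j\<in>UNIV. complex_of_real ((M.N2 (entry j i X))\<^sup>2))" for i
    using X by (simp add: entry_compose adj_entry M.phi_sum M.comp_mem M.adj_mem entry_in_M M.phi_adj_compose)
  then have "\<phi> (adj X \<cdot> X)
      = complex_of_real ((\<Sum>i\<in>UNIV. \<Sum>j\<in>UNIV. (M.N2 (entry j i X))\<^sup>2) / real CARD('d))"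
    using X by (simp add: phi_eq comp_mem adj_mem)
  then have "(N2 X)\<^sup>2 = (\<Sum>i\<in>UNIV. \<Sum>j\<in>UNIV. (M.N2 (entry j i X))\<^sup>2) / real CARD('d)"
    unfolding N2_square[OF X] by (simp only: Re_complex_of_real)
  then show ?thesis by (subst sum.swap)
qed

lemma L1_entry_cls:
  assumes "xs \<in> C1"
  shows "(\<lambda>n. entry i j (xs n)) \<in> M.C1" "L1_entry M \<tau> i j (cls xs) = M.cls (\<lambda>n. entry i j (xs n))"
proof -
  have lip: "M.N1 (entry i j x - entry i j y) \<le> real CARD('d) * N1 (x - y)" if "x \<in> A" "y \<in> A" for x y
    using N1_entry_le[OF diff_mem[OF that]] by (simp add: entry_diff)
  show "(\<lambda>n. entry i j (xs n)) \<in> M.C1" "L1_entry M \<tau> i j (cls xs) = M.cls (\<lambda>n. entry i j (xs n))"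
    unfolding L1_entry_def
    using L1_map_cls[where T = "entry i j" and k = "real CARD('d)",
        OF M.tracial_algebra_axioms tracial_algebra_axioms entry_in_M lip of_nat_0_le_iff assms]
    by blast+
qed

lemma L1_trace_tr_cls:
  assumes xs: "xs \<in> C1" and t: "(\<lambda>n. \<phi> (xs n)) \<longlonglongrightarrow> t"
  shows "L1_trace \<tau> (L1_tr M \<tau> (cls xs)) = of_nat CARD('d) * t"
proof -
  note m = xs[THEN Lp_cauchy_mem]
  have "L1_tr M \<tau> (cls xs) = M.cls (\<lambda>n. \<Sum>i\<in>UNIV. entry i i (xs n))"
    unfolding L1_tr_def L1_entry_cls(2)[OF xs] by (rule M.L1_sum_cls[OF L1_entry_cls(1)[OF xs]])
  moreover have "\<tau> (\<Sum>i\<in>UNIV. entry i i (xs n)) = of_nat CARD('d) * \<phi> (xs n)" for n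
    using m by (simp add: phi_eq M.phi_sum entry_in_M)
  then have "(\<lambda>n. \<tau> (\<Sum>i\<in>UNIV. entry i i (xs n))) \<longlonglongrightarrow> of_nat CARD('d) * t"
    using tendsto_mult[OF tendsto_const t] by simp
  ultimately show ?thesis
    using M.L1_trace_cls[OF M.C1_sum[OF L1_entry_cls(1)[OF xs]]] by simp
qed

text \<open>The bias-variance decomposition around the mean \<open>\<phi> x\<close>; it is applied
  to whole matrices and to their entries.\<close>

lemma (in tracial_algebra) N2_diff_scalar:
  assumes x: "x \<in> A"
  shows "(N2 (x - op_scale c id_blinfun))\<^sup>2 = (N2 x)\<^sup>2 - (cmod (\<phi> x))\<^sup>2 + (cmod (\<phi> x - c))\<^sup>2"
proof -
  let ?c = "op_scale c id_blinfun :: 'h bop"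
  have c: "?c \<in> A" by blast
  have m: "adj x \<in> A" "adj ?c \<in> A" "adj x \<cdot> x \<in> A" "adj x \<cdot> ?c \<in> A" "adj ?c \<cdot> x \<in> A" "adj ?c \<cdot> ?c \<in> A"
    using x c by blast+
  have "adj (x - ?c) \<cdot> (x - ?c) = (adj x \<cdot> x - adj x \<cdot> ?c) - (adj ?c \<cdot> x - adj ?c \<cdot> ?c)"
    using x c by (simp add: adj_diff op_simps)
  moreover have "\<phi> (adj x \<cdot> ?c) = c * cnj (\<phi> x)" "\<phi> (adj ?c \<cdot> x) = cnj c * \<phi> x" "\<phi> (adj ?c \<cdot> ?c) = cnj c * c"
    using x m by (simp_all add: adj_scale op_scale_compose mem_BH phi_scale phi_adj scale_mem)
  ultimately have "\<phi> (adj (x - ?c) \<cdot> (x - ?c))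
      = \<phi> (adj x \<cdot> x) - c * cnj (\<phi> x) - (cnj c * \<phi> x - cnj c * c)"
    using m by (simp only: phi_diff diff_mem)
  then show ?thesis
    unfolding N2_square[OF diff_mem[OF x c]] N2_square[OF x]
    by (simp add: cmod_power2) (simp add: power2_eq_square algebra_simps)
qed

lemma entry_scalar_diff:
  "entry i j (X - scalar_matrix C) = entry i j X - op_scale (C $ i $ j) id_blinfun"
  by (simp add: scalar_matrix_eq entry_diff)

lemma scalar_matrix_in_A: "scalar_matrix C \<in> A"
  unfolding scalar_matrix_eq by (intro matrix_of_in_A) blast

text \<open>The entrywise traces are the best approximation of \<open>X\<close> by scalar matrices.\<close>

lemma N2_diff_scalar_matrix_le:
  assumes X: "X \<in> A"
  shows "(N2 (X - scalar_matrix C))\<^sup>2 \<le> (N2 (X - op_scale c id_blinfun))\<^sup>2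
    + (\<Sum>i\<in>UNIV. \<Sum>j\<in>UNIV. (cmod (\<tau> (entry i j X) - C $ i $ j))\<^sup>2) / real CARD('d)"
proof -
  let ?v = "\<lambda>i j. (M.N2 (entry i j X))\<^sup>2 - (cmod (\<tau> (entry i j X)))\<^sup>2"
  \<comment> \<open>C will hold the traces of a limit rather than those of X itself. This excess
    vanishes along the approximating sequence.\<close>
  let ?e = "\<lambda>i j. (cmod (\<tau> (entry i j X) - C $ i $ j))\<^sup>2"
  have 1: "(N2 (X - scalar_matrix C))\<^sup>2 = (\<Sum>i\<in>UNIV. \<Sum>j\<in>UNIV. ?v i j + ?e i j) / real CARD('d)"
    using X by (simp add: N2_square_entries diff_mem scalar_matrix_in_A entry_scalar_diff
        M.N2_diff_scalar entry_in_M)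
  have "entry i j (X - op_scale c id_blinfun) = entry i j X - op_scale (if i = j then c else 0) id_blinfun" for i j
  proof -
    have "op_scale c (0 :: 'h bop) = 0" "op_scale 0 id_blinfun = (0 :: 'h bop)"
      by (rule blinfun_eqI, simp, simp only: op_scale_of_real[of 0, simplified] scaleR_zero_left)
    then show ?thesis by (simp add: entry_diff entry_scale entry_id)
  qed
  then have 2: "(N2 (X - op_scale c id_blinfun))\<^sup>2
      = (\<Sum>i\<in>UNIV. \<Sum>j\<in>UNIV. ?v i j + (cmod (\<tau> (entry i j X) - (if i = j then c else 0)))\<^sup>2) / real CARD('d)"
    using X by (simp add: N2_square_entries diff_mem scale_mem M.N2_diff_scalar entry_in_M cong: if_cong)
  have "(\<Sum>i\<in>UNIV. \<Sum>j\<in>UNIV. ?v i j) / real CARD('d) \<le> (N2 (X - op_scale c id_blinfun))\<^sup>2"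
    unfolding 2 by (intro divide_right_mono sum_mono) auto
  then show ?thesis
    unfolding 1 by (simp add: sum.distrib add_divide_distrib)
qed

end

section \<open>Von Neumann subalgebras and conditional expectations\<close>

text \<open>N is the commutant of S, hence an intersection of closed sets defined by commutation
  relations; adjoints come from the definition.\<close>

lemma von_neumann_op_algebra:
  assumes "von_neumann_algebra N"
  shows "op_algebra N"
proof -
  define S where "S = commutant N"
  have N: "N = commutant S" and adj: "\<And>a. a \<in> N \<Longrightarrow> \<exists>b\<in>N. is_adjoint a b"
    using assms by (simp_all add: von_neumann_algebra_def S_def)
  have S: "a \<in> BH" if "a \<in> S" for a using that by (simp add: S_def commutant_def)
  have mem: "b \<in> N \<longleftrightarrow> b \<in> BH \<and> (\<forall>a\<in>S. a \<cdot> b = b \<cdot> a)" for b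
    by (simp add: N commutant_def)
  show ?thesis
  proof
    show "N \<subseteq> BH" by (auto simp: mem)
    show "id_blinfun \<in> N" by (simp add: mem)
    show "a + b \<in> N" if "a \<in> N" "b \<in> N" for a b
      using that by (simp add: mem BH_add op_simps)
    show "op_scale c a \<in> N" if "a \<in> N" for c a
      using that S by (simp add: mem BH_scale op_scale_compose)
    show "a \<cdot> b \<in> N" if "a \<in> N" "b \<in> N" for a b
      using that by (simp add: mem BH_compose) (metis blinfun_compose_assoc)
    show "\<exists>b\<in>N. is_adjoint a b" if "a \<in> N" for a by (rule adj[OF that])
    have "closed {b. a \<cdot> b = b \<cdot> a}" for a :: "'a bop"
      by (intro closed_Collect_eq linear_continuous_on
          bounded_bilinear.bounded_linear_left[OF bounded_bilinear_blinfun_compose]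
          bounded_bilinear.bounded_linear_right[OF bounded_bilinear_blinfun_compose])
    then have "closed (BH \<inter> (\<Inter>a\<in>S. {b. a \<cdot> b = b \<cdot> a}))"
      by (intro closed_Int closed_BH closed_INT) blast
    moreover have "BH \<inter> (\<Inter>a\<in>S. {b. a \<cdot> b = b \<cdot> a}) = N" by (auto simp: mem)
    ultimately show "closed N" by simp
  qed
qed

lemma nc_prob_space_tracial_algebra:
  assumes "nc_prob_space M \<tau>"
  shows "tracial_algebra M \<tau>"
  using assms von_neumann_op_algebra
  by (auto simp: nc_prob_space_def tracial_algebra_def tracial_algebra_axioms_def)

locale conditional_expectation = tracial_algebra A \<phi> + sub: op_algebra N
  for A :: "'h::complex_hilbert bop set" and \<phi> and N :: "'h bop set" +
  fixes E :: "'h bop \<Rightarrow> 'h bop"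
  assumes N_sub: "N \<subseteq> A" and E: "cond_expectation A \<phi> N E"
begin

lemma sub_mem: "a \<in> N \<Longrightarrow> a \<in> A"
  using N_sub by blast

lemma E_mem: "x \<in> A \<Longrightarrow> E x \<in> N"
  using E by (simp add: cond_expectation_def)

lemma E_id: "x \<in> N \<Longrightarrow> E x = x"
  using E by (simp add: cond_expectation_def)

lemma E_add: "x \<in> A \<Longrightarrow> y \<in> A \<Longrightarrow> E (x + y) = E x + E y"
  using E by (simp add: cond_expectation_def)

lemma phi_E: "x \<in> A \<Longrightarrow> \<phi> (E x) = \<phi> x"
  using E by (simp add: cond_expectation_def)

lemma E_module:
  assumes "a \<in> N" "x \<in> A"
  shows "E (a \<cdot> x) = a \<cdot> E x"
proof -
  have "E (a \<cdot> x \<cdot> id_blinfun) = a \<cdot> E x \<cdot> id_blinfun"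
    using E assms sub.id_mem unfolding cond_expectation_def by blast
  then show ?thesis by simp
qed

lemma E_diff: "x \<in> A \<Longrightarrow> y \<in> A \<Longrightarrow> E (x - y) = E x - E y"
  using E_add[of "x - y" y] diff_mem[of x y] by simp

text \<open>The module property moves a inside E and the trace removes E: E acts as the orthogonal
  projection onto N.\<close>

lemma phi_compose_E: "a \<in> N \<Longrightarrow> x \<in> A \<Longrightarrow> \<phi> (a \<cdot> E x) = \<phi> (a \<cdot> x)"
  using phi_E[of "a \<cdot> x"] by (simp add: E_module comp_mem sub_mem)

lemma N1_E_le:
  assumes x: "x \<in> A"
  shows "N1 (E x) \<le> N1 x"
proof -
  interpret N: tracial_algebra N \<phi>
    by unfold_locales (use phi_add phi_scale phi_positive phi_commute sub_mem in \<open>simp_all\<close>)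
  show ?thesis
  proof (rule N.N1_leI[OF E_mem[OF x]])
    fix u assume u: "u \<in> N" "norm u \<le> 1"
    show "cmod (\<phi> (u \<cdot> E x)) \<le> N1 x"
      unfolding phi_compose_E[OF u(1) x] using u x sub_mem by (intro phi_compose_le_N1)
  qed
qed

lemma N2_E_le:
  assumes x: "x \<in> A"
  shows "N2 (E x) \<le> N2 x"
proof -
  have m: "E x \<in> A" "adj (E x) \<in> N" using E_mem[OF x] by (auto intro: sub_mem)
  have "(N2 (E x))\<^sup>2 = Re (\<phi> (adj (E x) \<cdot> x))"
    unfolding N2_square[OF m(1)] phi_compose_E[OF m(2) x] ..
  also have "\<dots> \<le> N2 (E x) * N2 x"
    using Re_phi_cauchy_schwarz[OF m(1) x] by linarith
  finally show ?thesis
    using m x by (cases "N2 (E x) = 0") (simp_all add: power2_eq_square order_less_le)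
qed

end

section \<open>Bessel's inequality and independence\<close>

context tracial_algebra
begin

text \<open>The e j are not normalized; \<open>proj\<close> says that each is the component of y
  along itself. Hence y minus their sum has squared norm \<open>(N2 y)\<^sup>2\<close> minus the sum
  of the squares.\<close>

lemma bessel_inequality:
  assumes y: "y \<in> A" and e: "\<And>j. j \<in> J \<Longrightarrow> e j \<in> A" and J: "finite J"
    and orth: "\<And>i j. i \<in> J \<Longrightarrow> j \<in> J \<Longrightarrow> i \<noteq> j \<Longrightarrow> \<phi> (adj (e i) \<cdot> e j) = 0"
    and proj: "\<And>j. j \<in> J \<Longrightarrow> Re (\<phi> (adj (e j) \<cdot> y)) = (N2 (e j))\<^sup>2"
  shows "(\<Sum>j\<in>J. (N2 (e j))\<^sup>2) \<le> (N2 y)\<^sup>2"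
proof -
  have phi_mult_sum: "\<phi> (a \<cdot> sum e I) = (\<Sum>j\<in>I. \<phi> (a \<cdot> e j))" if "a \<in> A" "I \<subseteq> J" for a I
  proof -
    have "a \<cdot> sum e I = (\<Sum>j\<in>I. a \<cdot> e j)"
      by (rule bounded_bilinear.sum_right[OF bounded_bilinear_blinfun_compose])
    then show ?thesis using that e by (simp add: phi_sum comp_mem subset_iff)
  qed
  have pyth: "(N2 (sum e I))\<^sup>2 = (\<Sum>j\<in>I. (N2 (e j))\<^sup>2)" if "I \<subseteq> J" for I
    using finite_subset[OF that J] that
  proof (induction I)
    case (insert i I)
    have m: "e i \<in> A" "sum e I \<in> A" using insert.prems e by auto
    have "\<phi> (adj (e i) \<cdot> sum e I) = (\<Sum>j\<in>I. \<phi> (adj (e i) \<cdot> e j))"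
      using insert.prems m by (intro phi_mult_sum adj_mem) auto
    also have "\<dots> = 0" using insert.prems insert.hyps by (intro sum.neutral ballI orth) auto
    finally show ?case
      using insert N2_add_square[OF m] by simp
  qed simp
  let ?s = "sum e J"
  have s: "?s \<in> A" using e by blast
  have m: "(-1) *\<^sub>R ?s \<in> A" using s by blast
  have "\<phi> (adj y \<cdot> ?s) = (\<Sum>j\<in>J. \<phi> (adj y \<cdot> e j))"
    using y by (intro phi_mult_sum adj_mem) auto
  moreover have "Re (\<phi> (adj y \<cdot> e j)) = (N2 (e j))\<^sup>2" if "j \<in> J" for j
  proof -
    have "adj y \<cdot> e j = adj (adj (e j) \<cdot> y)" using e[OF that] y by (simp add: adj_compose adj_mem)
    then show ?thesis using proj[OF that] e[OF that] y by (simp add: phi_adj comp_mem adj_mem)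
  qed
  ultimately have "Re (\<phi> (adj y \<cdot> ?s)) = (\<Sum>j\<in>J. (N2 (e j))\<^sup>2)" by simp
  moreover have "\<phi> (adj y \<cdot> ((-1) *\<^sub>R ?s)) = - \<phi> (adj y \<cdot> ?s)"
  proof -
    have "adj y \<cdot> ((-1) *\<^sub>R ?s) = (-1) *\<^sub>R (adj y \<cdot> ?s)" by (simp only: op_simps)
    then show ?thesis using phi_scaleR[of "adj y \<cdot> ?s" "-1"] s y by (simp add: comp_mem adj_mem)
  qed
  moreover have "N2 ((-1) *\<^sub>R ?s) = N2 ?s" using N2_scaleR[OF s, of "-1"] by simp
  ultimately have "(N2 (y + (-1) *\<^sub>R ?s))\<^sup>2 = (N2 y)\<^sup>2 - (\<Sum>j\<in>J. (N2 (e j))\<^sup>2)"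
    using N2_add_square[OF y m] pyth[OF order_refl] by simp
  then show ?thesis using zero_le_power2[of "N2 (y + (-1) *\<^sub>R ?s)"] by linarith
qed

lemma variance_le_sum_conditional:
  assumes n: "2 \<le> n"
    and CE: "\<And>j. j \<in> {1..n} \<Longrightarrow> conditional_expectation A \<phi> (N j) (E j)"
    and indep: "\<And>i j a b. i \<in> {1..n} \<Longrightarrow> j \<in> {1..n} \<Longrightarrow> i \<noteq> j \<Longrightarrow> a \<in> N i \<Longrightarrow> b \<in> N j \<Longrightarrow>
      \<phi> (a \<cdot> b) = \<phi> a * \<phi> b"
    and x: "x \<in> A"
  shows "(N2 (x - op_scale (\<phi> x) id_blinfun))\<^sup>2 \<le> (\<Sum>j\<in>{1..n::nat}. (N2 x)\<^sup>2 - (N2 (E j x))\<^sup>2)"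
proof -
  let ?c = "op_scale (\<phi> x) id_blinfun :: 'h bop"
  define y where "y = x - ?c"
  define e where "e j = E j x - ?c" for j
  have y: "y \<in> A" unfolding y_def using x by blast
  have c0: "\<phi> y = 0" using x by (simp add: y_def phi_diff scale_mem phi_scale)
  have eN: "e j \<in> N j" "adj (e j) \<in> N j" "e j \<in> A" and phi_e: "\<phi> (e j) = 0"
    and proj: "Re (\<phi> (adj (e j) \<cdot> y)) = (N2 (e j))\<^sup>2"
    and norm_e: "(N2 (e j))\<^sup>2 = (N2 (E j x))\<^sup>2 - (cmod (\<phi> x))\<^sup>2" if j: "j \<in> {1..n}" for j
  proof -
    interpret C: conditional_expectation A \<phi> "N j" "E j" by (rule CE[OF j])
    show e: "e j \<in> N j" unfolding e_def using C.E_mem[OF x] by blast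
    then show ae: "adj (e j) \<in> N j" by blast
    show eA: "e j \<in> A" by (rule C.sub_mem[OF e])
    have Ex: "E j x \<in> A" by (rule C.sub_mem[OF C.E_mem[OF x]])
    show "\<phi> (e j) = 0" using x Ex by (simp add: e_def phi_diff scale_mem phi_scale C.phi_E)
    have cN: "?c \<in> N j" by blast
    have "E j y = e j"
      using C.E_diff[OF x C.sub_mem[OF cN]] C.E_id[OF cN] by (simp add: y_def e_def)
    then show "Re (\<phi> (adj (e j) \<cdot> y)) = (N2 (e j))\<^sup>2"
      using C.phi_compose_E[OF ae y] by (simp add: N2_square[OF eA])
    show "(N2 (e j))\<^sup>2 = (N2 (E j x))\<^sup>2 - (cmod (\<phi> x))\<^sup>2"
      using N2_diff_scalar[OF Ex, of "\<phi> x"] x by (simp add: e_def C.phi_E)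
  qed
  have "(\<Sum>j\<in>{1..n}. (N2 (e j))\<^sup>2) \<le> (N2 y)\<^sup>2"
  proof (rule bessel_inequality[OF y eN(3)])
    show "\<phi> (adj (e i) \<cdot> e j) = 0" if "i \<in> {1..n}" "j \<in> {1..n}" "i \<noteq> j" for i j
      using indep[OF that eN(2)[OF that(1)] eN(1)[OF that(2)]] phi_e[OF that(2)] by simp
  qed (use proj in auto)
  \<comment> \<open>The same squared mean is split off from x and from each E j x, so it cancels in
    every summand.\<close>
  moreover have "(N2 x)\<^sup>2 = (N2 y)\<^sup>2 + (cmod (\<phi> x))\<^sup>2"
    using N2_diff_scalar[OF x, of "\<phi> x"] by (simp add: y_def)
  then have "(\<Sum>j\<in>{1..n}. (N2 x)\<^sup>2 - (N2 (E j x))\<^sup>2) = (\<Sum>j\<in>{1..n}. (N2 y)\<^sup>2 - (N2 (e j))\<^sup>2)"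
    by (intro sum.cong refl) (simp add: norm_e)
  then have "(\<Sum>j\<in>{1..n}. (N2 x)\<^sup>2 - (N2 (E j x))\<^sup>2) = real n * (N2 y)\<^sup>2 - (\<Sum>j\<in>{1..n}. (N2 (e j))\<^sup>2)"
    by (simp add: sum_subtractf)
  \<comment> \<open>One copy of the squared norm of y pays for Bessel's inequality; the bound needs
    a second one.\<close>
  moreover have "2 * (N2 y)\<^sup>2 \<le> real n * (N2 y)\<^sup>2"
    using n by (intro mult_right_mono) auto
  ultimately show ?thesis by (simp add: y_def)
qed

text \<open>The centered elements form an alternating word of length two, whose trace vanishes;
  expanding it gives the product rule.\<close>

lemma freely_independent_product:
  assumes free: "freely_independent \<phi> n N" and ij: "i \<in> {1..n}" "j \<in> {1..n}" "i \<noteq> j"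
    and op: "op_algebra (N i)" "op_algebra (N j)" and sub: "N i \<subseteq> A" "N j \<subseteq> A"
    and a: "a \<in> N i" and b: "b \<in> N j"
  shows "\<phi> (a \<cdot> b) = \<phi> a * \<phi> b"
proof -
  let ?a = "op_scale (\<phi> a) id_blinfun :: 'h bop" and ?b = "op_scale (\<phi> b) id_blinfun :: 'h bop"
  have m: "a \<in> A" "b \<in> A" "?a \<in> A" "?b \<in> A" using a b sub by blast+
  have ab: "a - ?a \<in> N i" "b - ?b \<in> N j"
    using op a b by (auto intro!: op_algebra.diff_mem op_algebra.scale_mem op_algebra.id_mem)
  have 0: "\<phi> (a - ?a) = 0" "\<phi> (b - ?b) = 0" using m by (simp_all add: phi_diff phi_scale)
  have "\<phi> (op_prod (map (\<lambda>k. if k = 1 then a - ?a else b - ?b) [1..<2 + 1])) = 0"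
    using free[unfolded freely_independent_def, rule_format, of 2 "\<lambda>k. if k = 1 then i else j"
        "\<lambda>k. if k = 1 then a - ?a else b - ?b"] ij ab 0 by auto
  then have "\<phi> ((a - ?a) \<cdot> (b - ?b)) = 0"
    by (simp add: op_prod_def upt_rec[of "Suc 0"] numeral_3_eq_3)
  moreover have "(a - ?a) \<cdot> (b - ?b) = (a \<cdot> b - op_scale (\<phi> b) a) - op_scale (\<phi> a) (b - ?b)"
  proof -
    have "a \<cdot> ?b = op_scale (\<phi> b) a" "?a \<cdot> (b - ?b) = op_scale (\<phi> a) (b - ?b)"
      using m by (simp_all add: op_scale_compose mem_BH)
    moreover have "(a - ?a) \<cdot> (b - ?b) = (a \<cdot> b - a \<cdot> ?b) - ?a \<cdot> (b - ?b)"
      by (simp add: op_simps)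
    ultimately show ?thesis by simp
  qed
  moreover have "a \<cdot> b \<in> A" "op_scale (\<phi> b) a \<in> A" "b - ?b \<in> A" "op_scale (\<phi> a) (b - ?b) \<in> A" using m by blast+
  ultimately show ?thesis using m 0 by (simp add: phi_diff phi_scale diff_mem mult.commute)
qed

text \<open>Take m = 1 with a in slot i, b in slot j and the identity elsewhere. The inner product
  is ordered by index, so i < j produces a b and not b a.\<close>

lemma tensor_independent_product_less:
  assumes tens: "tensor_independent \<phi> n N" and ij: "i \<in> {1..n}" "j \<in> {1..n}" "i < j"
    and id: "\<And>k. k \<in> {1..n} \<Longrightarrow> id_blinfun \<in> N k"
    and a: "a \<in> N i" and b: "b \<in> N j"
  shows "\<phi> (a \<cdot> b) = \<phi> a * \<phi> b"
proof -
  define f where "f k = (if k = i then a else if k = j then b else id_blinfun)" for k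
  have snoc: "foldr (o\<^sub>L) xs (id_blinfun :: 'h bop) \<cdot> x = foldr (o\<^sub>L) xs x" for xs :: "'h bop list" and x
    by (induction xs) (simp_all add: blinfun_compose_assoc)
  have prod: "op_prod (map f [1..<m + 1]) = (if m < i then id_blinfun else if m < j then a else a \<cdot> b)" for m
  proof (induction m)
    case 0
    then show ?case using ij by (simp add: op_prod_def)
  next
    case (Suc m)
    have "op_prod (map f [1..<Suc m + 1]) = op_prod (map f [1..<m + 1]) \<cdot> f (Suc m)"
      by (simp add: op_prod_def snoc)
    also have "\<dots> = (if Suc m < i then id_blinfun else if Suc m < j then a else a \<cdot> b)"
      unfolding Suc f_def using ij by auto
    finally show ?case .
  qed
  have "\<phi> (op_prod (map (\<lambda>i. op_prod (map (\<lambda>k. f k) [1..<n + 1])) [1..<1 + 1]))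
      = (\<Prod>k=1..n. \<phi> (op_prod (map (\<lambda>i. f k) [1..<1 + 1])))"
    using tens[unfolded tensor_independent_def, rule_format, of 1 "\<lambda>k _. f k"] id a b by (auto simp: f_def)
  note eq = this
  have "\<phi> (op_prod (map f [1..<n + 1])) = (\<Prod>k=1..n. \<phi> (f k))"
  proof -
    have "[1..<1 + 1] = [1::nat]" by simp
    then have "op_prod (map g [1..<1 + 1]) = g 1" for g :: "nat \<Rightarrow> 'h bop" by (simp only: op_prod_def) simp
    with eq show ?thesis by (simp only:)
  qed
  also have "\<dots> = (\<Prod>k=1..n. (if k = i then \<phi> a else 1) * (if k = j then \<phi> b else 1))"
    using ij by (intro prod.cong) (auto simp: f_def)
  also have "\<dots> = \<phi> a * \<phi> b"
    using ij by (simp add: prod.distrib)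
  finally show ?thesis using ij unfolding prod by simp
qed

lemma independent_product:
  assumes indep: "freely_independent \<phi> n N \<or> tensor_independent \<phi> n N"
    and N: "\<And>k. k \<in> {1..n} \<Longrightarrow> op_algebra (N k)" "\<And>k. k \<in> {1..n} \<Longrightarrow> N k \<subseteq> A"
    and ij: "i \<in> {1..n}" "j \<in> {1..n}" "i \<noteq> j" and a: "a \<in> N i" and b: "b \<in> N j"
  shows "\<phi> (a \<cdot> b) = \<phi> a * \<phi> b"
  using indep
proof
  assume "freely_independent \<phi> n N"
  then show ?thesis using N ij a b by (intro freely_independent_product)
next
  assume t: "tensor_independent \<phi> n N"
  have id: "id_blinfun \<in> N k" if "k \<in> {1..n}" for k by (rule op_algebra.id_mem[OF N(1)[OF that]])
  show ?thesis
  proof (cases "i < j")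
    case True
    show ?thesis by (rule tensor_independent_product_less[OF t ij(1,2) True id a b])
  next
    \<comment> \<open>The index order now yields the rule for b a; the trace property transfers it
      to a b.\<close>
    case False
    with ij have "j < i" by simp
    then have "\<phi> (b \<cdot> a) = \<phi> b * \<phi> a" by (rule tensor_independent_product_less[OF t ij(2,1) _ id b a])
    moreover have "a \<in> A" "b \<in> A" using N(2)[OF ij(1)] N(2)[OF ij(2)] a b by blast+
    ultimately show ?thesis using phi_commute[of a b] by simp
  qed
qed

section \<open>Square traces and conditional expectations on classes\<close>

lemma L1_sum_cong: "(\<And>i. i \<in> I \<Longrightarrow> X i = Y i) \<Longrightarrow> L1_sum A \<phi> I X = L1_sum A \<phi> I Y"
  by (simp add: L1_sum_def cong: ball_cong)

lemma square_trace_cls: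
  "v \<in> C2 \<Longrightarrow> square_trace A \<phi> T (cls v) = ereal (Re (T (cls (\<lambda>n. v n \<cdot> v n))))"
  by (simp add: square_trace_def prod_in_L1_cls L1_mult_cls)

lemma (in conditional_expectation) L1_map_E_cls:
  assumes v: "v \<in> C2"
  shows "(\<lambda>n. E (v n)) \<in> C2" "L1_map A \<phi> E (cls v) = cls (\<lambda>n. E (v n))"
proof -
  note m = v[THEN Lp_cauchy_mem]
  show "(\<lambda>n. E (v n)) \<in> C2"
  proof (rule Lp_cauchy_dominated[OF _ v v, where k = 1])
    show "E (v n) \<in> A" for n by (rule sub_mem[OF E_mem[OF m]])
    show "N2 (E (v i) - E (v j)) \<le> 1 * (N2 (v i - v j) + N2 (v i - v j))" for i j
      using N2_E_le[OF diff_mem[OF m m], of i j] N2_nonneg[OF diff_mem[OF m m], of i j]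
      unfolding mult_1 E_diff[OF m m] by (rule add_increasing[rotated])
  qed simp
  show "L1_map A \<phi> E (cls v) = cls (\<lambda>n. E (v n))"
  proof (rule L1_map_cls(2)[where k = 1])
    show "N1 (E x - E y) \<le> 1 * N1 (x - y)" if "x \<in> A" "y \<in> A" for x y
      using N1_E_le[OF diff_mem[OF that]] that by (simp add: E_diff)
    show "E x \<in> A" if "x \<in> A" for x by (rule sub_mem[OF E_mem[OF that]])
  qed (use C2_subset_C1[OF v] tracial_algebra_axioms in auto)
qed

end

section \<open>The Efron--Stein inequality\<close>

lemma (in matrix_algebra) efron_stein:
  fixes n :: nat
  assumes n: "2 \<le> n"
    and CE: "\<And>j. j \<in> {1..n} \<Longrightarrow> conditional_expectation A \<phi> (N j) (E j)"
    and indep: "\<And>i j a b. i \<in> {1..n} \<Longrightarrow> j \<in> {1..n} \<Longrightarrow> i \<noteq> j \<Longrightarrow> a \<in> N i \<Longrightarrow> b \<in> N j \<Longrightarrow>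
      \<phi> (a \<cdot> b) = \<phi> a * \<phi> b"
    and V: "V \<in> L1_sa A \<phi>" and W: "\<And>j. j \<in> {1..n} \<Longrightarrow> W j \<in> L1_sa A \<phi>"
    and VW: "\<And>j. j \<in> {1..n} \<Longrightarrow> prod_in_L1 A \<phi> V (W j)"
    and tr_le: "\<And>j. j \<in> {1..n} \<Longrightarrow>
      ereal (Re (L1_trace \<phi> (L1_mult A \<phi> V (W j)))) \<le> (Lp_norm A \<phi> 2 (L1_map A \<phi> (E j) V))\<^sup>2"
    and sq_le: "\<And>j. j \<in> {1..n} \<Longrightarrow>
      square_trace A \<phi> (L1_trace \<phi>) V \<le> square_trace A \<phi> (L1_trace \<phi>) (W j)"
  shows "square_trace A \<phi> (\<lambda>X. L1_trace \<tau> (L1_tr M \<tau> X)) (L1_diff A \<phi> V (tau_matrix M \<tau> V))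
    \<le> ereal (1/2) * sum_squares_trace A \<phi> (\<lambda>X. L1_trace \<tau> (L1_tr M \<tau> X))
        {1..n} (\<lambda>j. L1_diff A \<phi> V (W j))"
proof (cases "\<forall>j\<in>{1..n}. prod_in_L1 A \<phi> (L1_diff A \<phi> V (W j)) (L1_diff A \<phi> V (W j))")
  case False
  then have "sum_squares_trace A \<phi> (\<lambda>X. L1_trace \<tau> (L1_tr M \<tau> X)) {1..n} (\<lambda>j. L1_diff A \<phi> V (W j)) = \<infinity>"
    unfolding sum_squares_trace_def by (simp only: if_False)
  then show ?thesis by simp
next
  case True
  let ?I = "{1..n}" and ?d = "real CARD('d)"
  have "\<exists>d. d \<in> C2 \<and> L1_diff A \<phi> V (W j) = cls d" if j: "j \<in> ?I" for j
    using square_integrable_if_square[OF L1_sa_diff[OF V W[OF j]] True[rule_format, OF j]] by metis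
  then obtain d where d: "\<And>j. j \<in> ?I \<Longrightarrow> d j \<in> C2" "\<And>j. j \<in> ?I \<Longrightarrow> L1_diff A \<phi> V (W j) = cls (d j)"
    by metis
  \<comment> \<open>A single index is enough to bring V into L2.\<close>
  have 1: "1 \<in> ?I" using n by simp
  obtain v where v: "v \<in> C2" "\<And>k. adj (v k) = v k" "V = cls v"
    using square_integrable_if_product[OF V L1_sa_Lp[OF W[OF 1]] VW[OF 1] d(1)[OF 1] d(2)[OF 1]] by metis
  have vC: "v \<in> C1" by (rule C2_subset_C1[OF v(1)])
  note mv = v(1)[THEN Lp_cauchy_mem]
  \<comment> \<open>This representative of W j is 2-Cauchy and makes d j = v - w j an identity at
    every stage.\<close>
  define w where "w j k = v k - d j k" for j k
  have w: "w j \<in> C2" "W j = cls (w j)" if j: "j \<in> ?I" for j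
  proof -
    show wC: "w j \<in> C2" unfolding w_def by (rule C2_diff[OF v(1) d(1)[OF j]])
    obtain w' where w': "w' \<in> C1" "W j = cls w'" using Lp_cases[OF L1_sa_Lp[OF W[OF j]]] .
    have dC: "d j \<in> C1" by (rule C2_subset_C1[OF d(1)[OF j]])
    have "cls (\<lambda>k. v k - w' k) = cls (d j)"
      using d(2)[OF j] unfolding v(3) w'(2) L1_diff_cls[OF vC w'(1)] .
    then have "(\<lambda>k. N1 (v k - w' k - d j k)) \<longlonglongrightarrow> 0"
      by (simp only: cls_eq_iff[OF C1_diff[OF vC w'(1)] dC])
    then have "(\<lambda>k. N1 (w j k - w' k)) \<longlonglongrightarrow> 0"
      by (simp only: w_def diff_diff_eq add.commute)
    then show "W j = cls (w j)"
      unfolding w'(2) by (rule cls_eq[OF C2_subset_C1[OF wC] w'(1), symmetric])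
  qed
  obtain ta where ta: "(\<lambda>k. \<phi> (v k \<cdot> v k)) \<longlonglongrightarrow> ta"
    using C1_phi_convergent[OF C2_mult[OF v(1) v(1)]] .
  have v_lim: "(\<lambda>k. (N2 (v k))\<^sup>2) \<longlonglongrightarrow> Re ta"
    using tendsto_Re[OF ta] by (simp add: N2_square mv v(2))
  \<comment> \<open>In the limit, the squared norm of V - W j is ta + b - 2 c. The hypotheses say
    that Re c <= r^2 and Re ta <= Re b, so its real part is at least 2 (Re ta - r^2).\<close>
  have "\<exists>r t. (\<lambda>k. N2 (E j (v k))) \<longlonglongrightarrow> r \<and> (\<lambda>k. \<phi> (d j k \<cdot> d j k)) \<longlonglongrightarrow> t \<and>
      2 * (Re ta - r\<^sup>2) \<le> Re t" if j: "j \<in> ?I" for j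
  proof -
    interpret C: conditional_expectation A \<phi> "N j" "E j" by (rule CE[OF j])
    note md = d(1)[OF j, THEN Lp_cauchy_mem] and mw = w(1)[OF j, THEN Lp_cauchy_mem]
    obtain r where r: "(\<lambda>k. N2 (E j (v k))) \<longlonglongrightarrow> r" using C2_norm_convergent[OF C.L1_map_E_cls(1)[OF v(1)]] .
    obtain c where c: "(\<lambda>k. \<phi> (v k \<cdot> w j k)) \<longlonglongrightarrow> c"
      using C1_phi_convergent[OF C2_mult[OF v(1) w(1)[OF j]]] .
    obtain b where b: "(\<lambda>k. \<phi> (w j k \<cdot> w j k)) \<longlonglongrightarrow> b"
      using C1_phi_convergent[OF C2_mult[OF w(1)[OF j] w(1)[OF j]]] .
    have "Re c \<le> r\<^sup>2"
      using tr_le[OF j] unfolding v(3) w(2)[OF j] L1_mult_cls[OF v(1) w(1)[OF j]]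
        L1_trace_cls[OF C2_mult[OF v(1) w(1)[OF j]] c] C.L1_map_E_cls(2)[OF v(1)]
        Lp_norm_cls[OF C.L1_map_E_cls(1)[OF v(1)] r] by simp
    moreover have "Re ta \<le> Re b"
      using sq_le[OF j] unfolding v(3) w(2)[OF j] square_trace_cls[OF v(1)] square_trace_cls[OF w(1)[OF j]]
        L1_trace_cls[OF C2_mult[OF v(1) v(1)] ta] L1_trace_cls[OF C2_mult[OF w(1)[OF j] w(1)[OF j]] b] by simp
    moreover have "(\<lambda>k. \<phi> (d j k \<cdot> d j k)) \<longlonglongrightarrow> ta + b - 2 * c"
    proof -
      have "\<phi> (d j k \<cdot> d j k) = \<phi> (v k \<cdot> v k) + \<phi> (w j k \<cdot> w j k) - 2 * \<phi> (v k \<cdot> w j k)" for k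
      proof -
        have "d j k \<cdot> d j k = (v k \<cdot> v k - v k \<cdot> w j k) - (w j k \<cdot> v k - w j k \<cdot> w j k)"
          by (simp add: w_def op_simps)
        then show ?thesis
          using phi_commute[OF mw mv, of k k] mv[of k] mw[of k] by (simp add: phi_diff diff_mem comp_mem)
      qed
      then show ?thesis by (simp add: tendsto_intros ta b c)
    qed
    ultimately show ?thesis using r by (intro exI[of _ r] exI[of _ "ta + b - 2 * c"]) simp
  qed
  then have "\<forall>j\<in>?I. \<exists>r t. (\<lambda>k. N2 (E j (v k))) \<longlonglongrightarrow> r \<and> (\<lambda>k. \<phi> (d j k \<cdot> d j k)) \<longlonglongrightarrow> t \<and>
      2 * (Re ta - r\<^sup>2) \<le> Re t" by (rule ballI)
  from bchoice[OF this] obtain r where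
    "\<forall>j\<in>?I. \<exists>t. (\<lambda>k. N2 (E j (v k))) \<longlonglongrightarrow> r j \<and> (\<lambda>k. \<phi> (d j k \<cdot> d j k)) \<longlonglongrightarrow> t \<and>
      2 * (Re ta - (r j)\<^sup>2) \<le> Re t" ..
  from bchoice[OF this] obtain t where
    rt': "\<forall>j\<in>?I. (\<lambda>k. N2 (E j (v k))) \<longlonglongrightarrow> r j \<and> (\<lambda>k. \<phi> (d j k \<cdot> d j k)) \<longlonglongrightarrow> t j \<and>
      2 * (Re ta - (r j)\<^sup>2) \<le> Re (t j)" ..
  then have r: "\<And>j. j \<in> ?I \<Longrightarrow> (\<lambda>k. N2 (E j (v k))) \<longlonglongrightarrow> r j"
    and t: "\<And>j. j \<in> ?I \<Longrightarrow> (\<lambda>k. \<phi> (d j k \<cdot> d j k)) \<longlonglongrightarrow> t j"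
    and rt: "\<And>j. j \<in> ?I \<Longrightarrow> 2 * (Re ta - (r j)\<^sup>2) \<le> Re (t j)" by blast+
  have dd: "(\<lambda>k. d j k \<cdot> d j k) \<in> C1" if "j \<in> ?I" for j by (rule C2_mult[OF d(1)[OF that] d(1)[OF that]])
  have rhs: "sum_squares_trace A \<phi> (\<lambda>X. L1_trace \<tau> (L1_tr M \<tau> X)) ?I (\<lambda>j. L1_diff A \<phi> V (W j))
      = ereal (?d * (\<Sum>j\<in>?I. Re (t j)))"
  proof -
    have "L1_mult A \<phi> (L1_diff A \<phi> V (W j)) (L1_diff A \<phi> V (W j)) = cls (\<lambda>k. d j k \<cdot> d j k)" if "j \<in> ?I" for j
      unfolding d(2)[OF that] by (rule L1_mult_cls[OF d(1)[OF that] d(1)[OF that]])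
    then have "L1_sum A \<phi> ?I (\<lambda>j. L1_mult A \<phi> (L1_diff A \<phi> V (W j)) (L1_diff A \<phi> V (W j)))
        = L1_sum A \<phi> ?I (\<lambda>j. cls (\<lambda>k. d j k \<cdot> d j k))"
      by (rule L1_sum_cong)
    also have "\<dots> = cls (\<lambda>k. \<Sum>j\<in>?I. d j k \<cdot> d j k)"
      by (rule L1_sum_cls[OF dd])
    finally have eq: "L1_sum A \<phi> ?I (\<lambda>j. L1_mult A \<phi> (L1_diff A \<phi> V (W j)) (L1_diff A \<phi> V (W j)))
        = cls (\<lambda>k. \<Sum>j\<in>?I. d j k \<cdot> d j k)" .
    have "(\<lambda>k. \<phi> (\<Sum>j\<in>?I. d j k \<cdot> d j k)) \<longlonglongrightarrow> (\<Sum>j\<in>?I. t j)"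
    proof -
      have phi_dd: "\<phi> (\<Sum>j\<in>?I. d j k \<cdot> d j k) = (\<Sum>j\<in>?I. \<phi> (d j k \<cdot> d j k))" for k
        by (rule phi_sum) (rule Lp_cauchy_mem[OF dd])
      show ?thesis unfolding phi_dd by (intro tendsto_sum t)
    qed
    from L1_trace_tr_cls[OF C1_sum[OF dd] this]
    have "L1_trace \<tau> (L1_tr M \<tau> (cls (\<lambda>k. \<Sum>j\<in>?I. d j k \<cdot> d j k))) = of_nat CARD('d) * (\<Sum>j\<in>?I. t j)" .
    then show ?thesis
      unfolding sum_squares_trace_def eq using True by simp
  qed
  define C where "C = (\<chi> i j. L1_trace \<tau> (L1_entry M \<tau> i j V))"
  have C_lim: "(\<lambda>k. \<tau> (entry i j (v k))) \<longlonglongrightarrow> C $ i $ j" for i j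
  proof -
    obtain s where s: "(\<lambda>k. \<tau> (entry i j (v k))) \<longlonglongrightarrow> s"
      using M.C1_phi_convergent[OF L1_entry_cls(1)[OF vC]] .
    then show ?thesis
      using M.L1_trace_cls[OF L1_entry_cls(1)[OF vC] s] by (simp add: C_def v(3) L1_entry_cls(2)[OF vC])
  qed
  define y where "y k = v k - scalar_matrix C" for k
  have yC: "y \<in> C2" unfolding y_def by (rule C2_diff[OF v(1) C2_const[OF scalar_matrix_in_A]])
  note my = yC[THEN Lp_cauchy_mem]
  have "tau_matrix M \<tau> V = cls (\<lambda>k. scalar_matrix C)"
    unfolding tau_matrix_def C_def[symmetric] A_def[symmetric] phi_def[symmetric] by (rule L1_of_cls)
  then have Vy: "L1_diff A \<phi> V (tau_matrix M \<tau> V) = cls y"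
    unfolding v(3) y_def by (simp only: L1_diff_cls[OF vC C1_const[OF scalar_matrix_in_A]])
  obtain s where s: "(\<lambda>k. \<phi> (y k \<cdot> y k)) \<longlonglongrightarrow> s" using C1_phi_convergent[OF C2_mult[OF yC yC]] .
  have lhs: "square_trace A \<phi> (\<lambda>X. L1_trace \<tau> (L1_tr M \<tau> X)) (L1_diff A \<phi> V (tau_matrix M \<tau> V))
      = ereal (?d * Re s)"
    unfolding Vy square_trace_cls[OF yC] L1_trace_tr_cls[OF C2_mult[OF yC yC] s] by simp
  \<comment> \<open>The error from using the traces of the limit V in place of those of v k.\<close>
  define \<delta> where "\<delta> k = (\<Sum>i\<in>UNIV. \<Sum>j\<in>UNIV. (cmod (\<tau> (entry i j (v k)) - C $ i $ j))\<^sup>2) / ?d" for k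
  have "\<delta> \<longlonglongrightarrow> (\<Sum>i\<in>(UNIV :: 'd set). \<Sum>j\<in>(UNIV :: 'd set). (cmod (C $ i $ j - C $ i $ j))\<^sup>2) / ?d"
    unfolding \<delta>_def by (intro tendsto_divide tendsto_sum tendsto_power tendsto_norm tendsto_diff C_lim tendsto_const) simp
  then have \<delta>: "\<delta> \<longlonglongrightarrow> 0" by simp
  have "Re s \<le> (\<Sum>j\<in>?I. Re ta - (r j)\<^sup>2) + 0"
  proof (rule LIMSEQ_le[OF tendsto_Re[OF s]])
    show "(\<lambda>k. (\<Sum>j\<in>?I. (N2 (v k))\<^sup>2 - (N2 (E j (v k)))\<^sup>2) + \<delta> k) \<longlonglongrightarrow> (\<Sum>j\<in>?I. Re ta - (r j)\<^sup>2) + 0"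
      by (intro tendsto_add tendsto_sum tendsto_diff tendsto_power v_lim r \<delta>)
    have "Re (\<phi> (y k \<cdot> y k)) \<le> (\<Sum>j\<in>?I. (N2 (v k))\<^sup>2 - (N2 (E j (v k)))\<^sup>2) + \<delta> k" for k
    proof -
      have "Re (\<phi> (y k \<cdot> y k)) \<le> N2 (y k) * N2 (y k)"
        using phi_cauchy_schwarz[OF my my, of k k] complex_Re_le_cmod[of "\<phi> (y k \<cdot> y k)"] by linarith
      also have "\<dots> = (N2 (y k))\<^sup>2" by (simp add: power2_eq_square)
      also have "\<dots> \<le> (N2 (v k - op_scale (\<phi> (v k)) id_blinfun))\<^sup>2 + \<delta> k"
        unfolding y_def \<delta>_def by (rule N2_diff_scalar_matrix_le[OF mv])
      also have "(N2 (v k - op_scale (\<phi> (v k)) id_blinfun))\<^sup>2 \<le> (\<Sum>j\<in>?I. (N2 (v k))\<^sup>2 - (N2 (E j (v k)))\<^sup>2)"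
        by (rule variance_le_sum_conditional[OF n CE indep mv])
      finally show ?thesis by simp
    qed
    then show "\<exists>K. \<forall>k\<ge>K. Re (\<phi> (y k \<cdot> y k)) \<le> (\<Sum>j\<in>?I. (N2 (v k))\<^sup>2 - (N2 (E j (v k)))\<^sup>2) + \<delta> k" by blast
  qed
  also have "\<dots> \<le> (\<Sum>j\<in>?I. Re (t j) / 2)"
    using rt by (simp only: add_0_right) (intro sum_mono, force)
  \<comment> \<open>The factor d passes from the normalized trace to the unnormalized one on both
    sides.\<close>
  finally have "?d * Re s \<le> ?d * ((1/2) * (\<Sum>j\<in>?I. Re (t j)))"
    by (intro mult_left_mono) (simp_all add: sum_divide_distrib)
  then show ?thesis unfolding lhs rhs by simp
qed

text \<open>The bound \<open>2 \<le> n\<close> is essential. For n = 1 take N 1 = A, E 1 the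
  identity, F the evaluation at 1 and U' 1 = U 1 square-integrable: all other hypotheses hold and
  the right-hand side is 0, while the left-hand side is positive unless V is a scalar
  matrix.\<close>

theorem theorem3p1:
  fixes M :: "'h::complex_hilbert bop set" and \<tau> :: "'h bop \<Rightarrow> complex"
    and A :: "('h ^ 'd::finite) bop set" and \<phi> :: "('h ^ 'd) bop \<Rightarrow> complex"
    and n :: nat
    and N :: "nat \<Rightarrow> ('h ^ 'd) bop set" and E :: "nat \<Rightarrow> ('h ^ 'd) bop \<Rightarrow> ('h ^ 'd) bop"
    and U U' W :: "nat \<Rightarrow> ('h ^ 'd) lp" and V :: "('h ^ 'd) lp"
    and F :: "(nat \<Rightarrow> ('h ^ 'd) lp) \<Rightarrow> ('h ^ 'd) lp"
  assumes "nc_prob_space M \<tau>"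
    and "A = matrices M" and "\<phi> = tau_bar \<tau>"
    and "2 \<le> n"
    and "\<forall>j\<in>{1..n}. vn_subalgebra A (N j)"
    and "freely_independent \<phi> n N \<or> tensor_independent \<phi> n N"
    and "\<forall>j\<in>{1..n}. U j \<in> Lp_sub A \<phi> 1 (N j) \<and> U j \<in> L1_sa A \<phi>"
    and "F \<in> ({1..n} \<rightarrow>\<^sub>E L1_sa A \<phi>) \<rightarrow> L1_sa A \<phi>"
    and "\<forall>j\<in>{1..n}. U' j \<in> L1_sa A \<phi>"
    and "V = F (restrict U {1..n})"
    and "\<forall>j\<in>{1..n}. W j = F ((restrict U {1..n})(j := U' j))"
    and "\<forall>j\<in>{1..n}. cond_expectation A \<phi> (N j) (E j)"
    and "\<forall>j\<in>{1..n}. prod_in_L1 A \<phi> V (W j) \<and>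
      ereal (Re (L1_trace \<phi> (L1_mult A \<phi> V (W j)))) \<le> (Lp_norm A \<phi> 2 (L1_map A \<phi> (E j) V))\<^sup>2"
    and "\<forall>j\<in>{1..n}. square_trace A \<phi> (L1_trace \<phi>) (W j) \<ge> square_trace A \<phi> (L1_trace \<phi>) V"
  shows "square_trace A \<phi> (\<lambda>X. L1_trace \<tau> (L1_tr M \<tau> X)) (L1_diff A \<phi> V (tau_matrix M \<tau> V))
    \<le> ereal (1/2) * sum_squares_trace A \<phi> (\<lambda>X. L1_trace \<tau> (L1_tr M \<tau> X))
        {1..n} (\<lambda>j. L1_diff A \<phi> V (W j))"
proof -
  interpret M: tracial_algebra M \<tau> by (rule nc_prob_space_tracial_algebra[OF assms(1)])
  interpret matrix_algebra M \<tau> A \<phi> by unfold_locales (fact assms(2), fact assms(3))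
  have N: "op_algebra (N j)" "N j \<subseteq> A" if "j \<in> {1..n}" for j
    using assms(5) that by (auto simp: vn_subalgebra_def intro: von_neumann_op_algebra)
  have U: "restrict U {1..n} \<in> {1..n} \<rightarrow>\<^sub>E L1_sa A \<phi>"
    using assms(7) by auto
  show ?thesis
  proof (rule efron_stein[OF assms(4)])
    show "conditional_expectation A \<phi> (N j) (E j)" if "j \<in> {1..n}" for j
      using N[OF that] assms(12) that tracial_algebra_axioms
      by (simp add: conditional_expectation_def conditional_expectation_axioms_def)
    show "\<phi> (a \<cdot> b) = \<phi> a * \<phi> b"
      if "i \<in> {1..n}" "j \<in> {1..n}" "i \<noteq> j" "a \<in> N i" "b \<in> N j" for i j a b
      by (rule independent_product[OF assms(6) N that])
    show "V \<in> L1_sa A \<phi>" using assms(8,10) U by blast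
    show "W j \<in> L1_sa A \<phi>" if j: "j \<in> {1..n}" for j
    proof -
      have "(restrict U {1..n})(j := U' j) \<in> {1..n} \<rightarrow>\<^sub>E L1_sa A \<phi>"
        using U assms(9) j by (auto simp: PiE_iff extensional_def)
      then show ?thesis using assms(8,11) j by auto
    qed
  qed (use assms(13,14) in blast)+
qed

end
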